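(* Let $K$ be a field, let $G=(V,E,w)$ be a connected weighted simple graph with vertices $t_1,\ldots,t_s$ and positive integer edge weights, let $I\subset S=K[t_1,\ldots,t_s]$ be its Laplacian ideal and let $\mathcal{L}\subset\mathbb{Z}^s$ be the lattice spanned by the columns of the Laplacian matrix $L(G)$. Then the following hold. (a) $V(I,t_i)=\{0\}$ for all $i$. (b) $\deg(S/I)=\deg(S/I(\mathcal{L}))=|K(G)|$. (c) ${\rm Hull}(I)=I(\mathcal{L})$. (d) If $|E(t_i)|\geq 3$ for all $i$, then $I$ is not a lattice ideal. (e) If $G=\mathcal{K}_s$ is a complete graph, then $\deg(S/I)=s^{s-2}$. (f) If $G$ is a tree, then $\deg(S/I)=\deg(S/I(\mathcal{L}))=1$.
   Context: The weight function $w$ associates a weight $w_e$ with every edge $e\in E$. The Laplacian matrix $L(G)$ has entries $L(G)_{i,i}=\sum_{e\in E(t_i)}w_e$, where $E(t_i)$ is the set of edges incident to $t_i$; and for $i\neq j$, $L(G)_{i,j}=-w_e$ if $e=\{t_i,t_j\}\in E$ and $0$ otherwise. For $a\in\mathbb{Z}^s$ write $a=a^+-a^-$ with $a^+,a^-\in\mathbb{N}^s$ of disjoint support, and for $c\in\mathbb{N}^s$ put $t^c=t_1^{c_1}\cdots t_s^{c_s}$. The Laplacian ideal $I$ of $G$ is the ideal of $S$ generated by the binomials $t^{a^+}-t^{a^-}$ where $a$ runs over the columns of $L(G)$. For a lattice (subgroup) $\mathcal{L}\subset\mathbb{Z}^s$, the lattice ideal of $\mathcal{L}$ is $I(\mathcal{L})=(t^{a^+}-t^{a^-}\mid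 a\in\mathcal{L})$, and a lattice ideal is an ideal of this form for some lattice; for the lattice spanned by the columns of $L(G)$, $I(\mathcal{L})=(I:(t_1\cdots t_s)^\infty)$ is the toppling ideal of $G$. $K(G)$, the critical (sandpile) group of $G$, is the torsion subgroup of $\mathbb{Z}^s/{\rm Im}(L(G))=\mathbb{Z}^s/\mathcal{L}$. $V(\cdot)$ is the set of common zeros in $K^s$ and $V(I,t_i)$ is the variety of the ideal $(I,t_i)$. ${\rm Hull}(I)$ is the intersection of the isolated primary components of $I$. $\mathcal{K}_s$ denotes the complete graph on the $s$ vertices. For an ideal $J\subset S$ with $k=\dim(S/J)$ (Krull dimension), $\deg(S/J)=k!\lim_{i\to\infty}\dim_K(S_{\le i}/J_{\le i})/i^k$, where $S_{\le i}$ (resp. $J_{\le i}$) is the space of polynomials of $S$ (resp. of $J$) of standard total degree at most $i$.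
   Formalization: In (e) and (f) all edge weights are assumed to be 1; with arbitrary positive weights both claims fail, e.g. a single edge of weight 2 on two vertices is a tree and equals K_2, but the degree is 2. *)

theory Defs
  imports
    "HOL-Library.Poly_Mapping"
    "HOL-Library.Extended_Nat"
    "HOL-Analysis.Determinants"
    "HOL-Algebra.Algebraic_Closure_Type"
    "HOL-Algebra.Generated_Groups"
    "HOL-Algebra.QuotRing"
begin

section \<open>Weighted simple graphs\<close>

text \<open>
  The vertex set is the whole finite type \<open>'v\<close>, so $s$ is \<open>CARD('v)\<close>. Edges are two-element
  sets of vertices; the values of a weight function outside the edge set are irrelevant.
\<close>

definition simple_graph :: "'v set set \<Rightarrow> bool" where
  "simple_graph E \<longleftrightarrow> (\<forall>e\<in>E. card e = 2)"

definition incident_edges :: "'v set set \<Rightarrow> 'v \<Rightarrow> 'v set set" where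
  "incident_edges E v = {e \<in> E. v \<in> e}"

definition connected_graph :: "'v set set \<Rightarrow> bool" where
  "connected_graph E \<longleftrightarrow> (\<forall>u v. (u, v) \<in> {(x, y). {x, y} \<in> E}\<^sup>*)"

text \<open>A cycle is given by the list of its pairwise distinct vertices, at least three of them.\<close>

definition graph_cycle :: "'v set set \<Rightarrow> 'v list \<Rightarrow> bool" where
  "graph_cycle E c \<longleftrightarrow> 3 \<le> length c \<and> distinct c \<and>
     (\<forall>i<length c. {c ! i, c ! (Suc i mod length c)} \<in> E)"

definition tree_graph :: "'v set set \<Rightarrow> bool" where
  "tree_graph E \<longleftrightarrow> simple_graph E \<and> connected_graph E \<and> (\<nexists>c. graph_cycle E c)"

definition complete_graph_edges :: "'v set set" where
  "complete_graph_edges = {{u, v} | u v. u \<noteq> v}"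

definition laplacian :: "'v::finite set set \<Rightarrow> ('v set \<Rightarrow> nat) \<Rightarrow> int^'v^'v" where
  "laplacian E w = (\<chi> i j.
     if i = j then (\<Sum>e\<in>incident_edges E i. int (w e))
     else if {i, j} \<in> E then - int (w {i, j})
     else 0)"

section \<open>Lattices and the critical group\<close>

definition int_vec_group :: "(int^'v) monoid" where
  "int_vec_group = \<lparr>carrier = UNIV, monoid.mult = (+), one = 0\<rparr>"

definition column_lattice :: "int^'v^'v \<Rightarrow> (int^'v) set" where
  "column_lattice A = generate int_vec_group (columns A)"

definition torsion_subgroup :: "('a, 'm) monoid_scheme \<Rightarrow> ('a, 'm) monoid_scheme" where
  "torsion_subgroup G = G\<lparr>carrier := {x \<in> carrier G. \<exists>n::nat. n > 0 \<and> x [^]\<^bsub>G\<^esub> n = \<one>\<^bsub>G\<^esub>}\<rparr>"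

definition critical_group ::
    "'v::finite set set \<Rightarrow> ('v set \<Rightarrow> nat) \<Rightarrow> (int^'v) set monoid" where
  "critical_group E w =
     torsion_subgroup (int_vec_group Mod range (\<lambda>x. laplacian E w *v x))"

section \<open>The polynomial ring\<close>

text \<open>
  A polynomial is a finitely supported function from exponent vectors to coefficients; the
  multiplication on \<^type>\<open>poly_mapping\<close> is the convolution product.
\<close>

type_synonym ('v, 'k) mpoly = "('v \<Rightarrow>\<^sub>0 nat) \<Rightarrow>\<^sub>0 'k"

abbreviation mpoly_ring :: "('v, 'k::comm_ring_1) mpoly ring" where
  "mpoly_ring \<equiv> ring_of_type_algebra"

definition mpoly_var :: "'v \<Rightarrow> ('v, 'k::comm_ring_1) mpoly" where
  "mpoly_var i = Poly_Mapping.single (Poly_Mapping.single i 1) 1"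

definition mpoly_scale :: "'k::comm_ring_1 \<Rightarrow> ('v, 'k) mpoly \<Rightarrow> ('v, 'k) mpoly" where
  "mpoly_scale c p = Poly_Mapping.single 0 c * p"

definition mpoly_eval :: "('v::finite, 'k::comm_ring_1) mpoly \<Rightarrow> 'k^'v \<Rightarrow> 'k" where
  "mpoly_eval p x = (\<Sum>m\<in>Poly_Mapping.keys p.
     Poly_Mapping.lookup p m * (\<Prod>i\<in>UNIV. (x $ i) ^ Poly_Mapping.lookup m i))"

definition zero_locus :: "('v::finite, 'k::comm_ring_1) mpoly set \<Rightarrow> ('k^'v) set" where
  "zero_locus J = {x. \<forall>p\<in>J. mpoly_eval p x = 0}"

definition mpoly_deg_le :: "nat \<Rightarrow> ('v::finite, 'k::comm_ring_1) mpoly set" where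
  "mpoly_deg_le d =
     {p. \<forall>m\<in>Poly_Mapping.keys p. (\<Sum>i\<in>UNIV. Poly_Mapping.lookup m i) \<le> d}"

section \<open>Lattice ideals and the Laplacian ideal\<close>

text \<open>
  \<open>pos_exponent a\<close> is $a^+$, as an exponent vector, and \<open>pos_exponent (- a)\<close> is $a^-$: the
  function \<^const>\<open>nat\<close> sends negative integers to \<open>0\<close>.
\<close>

definition pos_exponent :: "int^'v::finite \<Rightarrow> ('v \<Rightarrow>\<^sub>0 nat)" where
  "pos_exponent a = Abs_poly_mapping (\<lambda>i. nat (a $ i))"

definition binomial_of :: "int^'v::finite \<Rightarrow> ('v, 'k::comm_ring_1) mpoly" where
  "binomial_of a =
     Poly_Mapping.single (pos_exponent a) 1 - Poly_Mapping.single (pos_exponent (- a)) 1"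

definition lattice_ideal :: "(int^'v::finite) set \<Rightarrow> ('v, 'k::comm_ring_1) mpoly set" where
  "lattice_ideal H = genideal mpoly_ring (binomial_of ` H)"

definition is_lattice_ideal :: "('v::finite, 'k::comm_ring_1) mpoly set \<Rightarrow> bool" where
  "is_lattice_ideal J \<longleftrightarrow> (\<exists>H. subgroup H int_vec_group \<and> J = lattice_ideal H)"

definition laplacian_ideal ::
    "'v::finite set set \<Rightarrow> ('v set \<Rightarrow> nat) \<Rightarrow> ('v, 'k::comm_ring_1) mpoly set" where
  "laplacian_ideal E w = genideal mpoly_ring (binomial_of ` columns (laplacian E w))"

section \<open>Krull dimension and degree\<close>

text \<open>For the zero ring this supremum is \<open>0\<close>.\<close>

definition krull_dim :: "('a, 'm) ring_scheme \<Rightarrow> enat" where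
  "krull_dim R = Sup {enat n | n. \<exists>P :: nat \<Rightarrow> 'a set.
     (\<forall>i\<le>n. primeideal (P i) R) \<and> (\<forall>i<n. P i \<subset> P (Suc i))}"

text \<open>
  \<open>basis_modulo smul U W B\<close> says that the cosets of the elements of the finite set \<open>B\<close> form a
  basis of the quotient space $U/W$ and are pairwise distinct: every element of $U$ is modulo
  $W$ a unique linear combination of \<open>B\<close>. Coefficient functions are extensional, so that
  uniqueness only concerns their values on \<open>B\<close>.
\<close>

definition basis_modulo ::
    "('k \<Rightarrow> 'b \<Rightarrow> 'b::ab_group_add) \<Rightarrow> 'b set \<Rightarrow> 'b set \<Rightarrow> 'b set \<Rightarrow> bool" where
  "basis_modulo smul U W B \<longleftrightarrow> finite B \<and> B \<subseteq> U \<and>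
     (\<forall>u\<in>U. \<exists>!c. c \<in> B \<rightarrow>\<^sub>E UNIV \<and> u - (\<Sum>b\<in>B. smul (c b) b) \<in> W)"

definition quotient_dim ::
    "('k \<Rightarrow> 'b \<Rightarrow> 'b::ab_group_add) \<Rightarrow> 'b set \<Rightarrow> 'b set \<Rightarrow> nat" where
  "quotient_dim smul U W = (THE n. \<exists>B. basis_modulo smul U W B \<and> card B = n)"

text \<open>\<open>quotient_degree J\<close> is the degree of the quotient of the polynomial ring by $J$.\<close>

definition quotient_degree :: "('v::finite, 'k::field) mpoly set \<Rightarrow> real" where
  "quotient_degree J = (let k = the_enat (krull_dim (mpoly_ring Quot J)) in
     fact k * lim (\<lambda>i. real (quotient_dim mpoly_scale (mpoly_deg_le i) (J \<inter> mpoly_deg_le i))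
                      / real i ^ k))"

section \<open>Isolated primary components and the hull\<close>

definition radical :: "('a, 'm) ring_scheme \<Rightarrow> 'a set \<Rightarrow> 'a set" where
  "radical R J = {a \<in> carrier R. \<exists>n::nat. n > 0 \<and> a [^]\<^bsub>R\<^esub> n \<in> J}"

definition primary_ideal :: "('a, 'm) ring_scheme \<Rightarrow> 'a set \<Rightarrow> bool" where
  "primary_ideal R Q \<longleftrightarrow> ideal Q R \<and> Q \<noteq> carrier R \<and>
     (\<forall>a\<in>carrier R. \<forall>b\<in>carrier R. a \<otimes>\<^bsub>R\<^esub> b \<in> Q \<longrightarrow> a \<in> Q \<or> b \<in> radical R Q)"

text \<open>
  Intersections are taken inside the carrier, so that the empty intersection is the whole ring.
\<close>

definition primary_decomposition :: "('a, 'm) ring_scheme \<Rightarrow> 'a set \<Rightarrow> 'a set set \<Rightarrow> bool" where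
  "primary_decomposition R J D \<longleftrightarrow>
     finite D \<and> (\<forall>Q\<in>D. primary_ideal R Q) \<and> J = carrier R \<inter> \<Inter>D"

definition minimal_primary_decomposition ::
    "('a, 'm) ring_scheme \<Rightarrow> 'a set \<Rightarrow> 'a set set \<Rightarrow> bool" where
  "minimal_primary_decomposition R J D \<longleftrightarrow> primary_decomposition R J D \<and>
     inj_on (radical R) D \<and> (\<forall>Q\<in>D. \<not> carrier R \<inter> \<Inter>(D - {Q}) \<subseteq> Q)"

definition isolated_primary_component ::
    "('a, 'm) ring_scheme \<Rightarrow> 'a set \<Rightarrow> 'a set \<Rightarrow> bool" where
  "isolated_primary_component R J Q \<longleftrightarrow>
     (\<exists>D. minimal_primary_decomposition R J D \<and> Q \<in> D \<and>
        (\<forall>Q'\<in>D. \<not> radical R Q' \<subset> radical R Q))"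

text \<open>
  The isolated components do not depend on the minimal primary decomposition, which is why
  \<open>ideal_hull\<close> may intersect those of all minimal primary decompositions at once.
\<close>

definition ideal_hull :: "('a, 'm) ring_scheme \<Rightarrow> 'a set \<Rightarrow> 'a set" where
  "ideal_hull R J = carrier R \<inter> \<Inter>{Q. isolated_primary_component R J Q}"

end

theory Submission
  imports Defs
begin

text \<open>
  The columns of the Laplacian have coordinate sum zero, so $I$ and $I(\mathcal{L})$ are homogeneous
  and spanned by differences of monomials that are congruent for the monoid congruence
  generated by the columns, respectively for the lattice. Hence the Hilbert function counts
  congruence classes of monomials. Since the graph is connected, every monomial of large degree is
  congruent to a multiple of $t_i$, for each $i$, which gives (a). It also makes the number of
  classes eventually constant and multiplication by each $t_i$ eventually bijective on classes, so
  that both congruences agree in large degree, where the number of classes is the order of the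
  group of sum-zero vectors modulo $\mathcal{L}$, the torsion subgroup of
  $\mathbb{Z}^s/\mathcal{L}$.

  The Hilbert function being bounded, a strict inclusion of primes over $I$ makes the larger one
  meet $K[g]$ for every $g$, so the dimension is one. Nonzero polynomials in $t_i$ are
  nonzerodivisors modulo $I(\mathcal{L})$, and ideals saturated with respect to them satisfy the
  ascending chain condition; thus $I(\mathcal{L})$ is a finite intersection of saturated primary
  ideals, whose radicals are pairwise incomparable or equal. Together with $I + (t_i^N)$, which is
  primary to the irrelevant ideal, they give a decomposition of $I$ with hull $I(\mathcal{L})$.

  For (d), the positive part of the sum of two adjacent columns is a monomial divisible by no term
  of a generator.
\<close>

section \<open>Ideals of a commutative ring type\<close>

text \<open>The field is arbitrary, perhaps finite, so the ideal theory rests on counting monomial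
  classes. The name \<open>lattice_ideal\<close> is applied to any set of integer vectors: I is
  \<open>lattice_ideal\<close> of the set of columns, and the toppling ideal is that of the group
  they generate. Both sets satisfy the axioms of \<open>graded_binomials\<close>, so dimension and
  degree are proved once and used twice. The two inclusions for the hull differ in nature. As
  \<open>ideal_hull\<close> intersects the isolated components of all minimal primary
  decompositions, the inclusion of the toppling ideal in the hull has to be shown for an arbitrary
  decomposition, while the converse needs one to exist: with none, the hull would be the whole ring.
  Existence is the obstacle. It is reached by climbing only through ideals modulo which every
  nonzerodivisor of the toppling ideal stays a nonzerodivisor; such chains stop because the affine
  Hilbert function grows linearly. What they miss of I is supplied by a single component at the
  origin.\<close>

lemma ring_of_type_algebra_simps [simp]:
  "carrier (ring_of_type_algebra :: 'a::comm_ring_1 ring) = UNIV"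
  "x \<otimes>\<^bsub>ring_of_type_algebra\<^esub> y = (x * y :: 'a)"
  "x \<oplus>\<^bsub>ring_of_type_algebra\<^esub> y = (x + y :: 'a)"
  "\<one>\<^bsub>ring_of_type_algebra\<^esub> = (1 :: 'a)"
  "\<zero>\<^bsub>ring_of_type_algebra\<^esub> = (0 :: 'a)"
  by (simp_all add: ring_of_type_algebra_def)

lemma ring_of_type_algebra_pow [simp]:
  "(x :: 'a::comm_ring_1) [^]\<^bsub>ring_of_type_algebra\<^esub> (n :: nat) = x ^ n"
proof -
  interpret cring "ring_of_type_algebra :: 'a ring" by (rule cring_from_type_algebra)
  show ?thesis by (induction n) (simp_all add: mult.commute)
qed

lemma ideal_type_iff:
  fixes J :: "'a::comm_ring_1 set"
  shows "ideal J ring_of_type_algebra \<longleftrightarrow>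
    0 \<in> J \<and> (\<forall>x\<in>J. \<forall>y\<in>J. x + y \<in> J) \<and> (\<forall>x\<in>J. \<forall>q. q * x \<in> J)" (is "_ \<longleftrightarrow> ?R")
proof
  interpret cring "ring_of_type_algebra :: 'a ring" by (rule cring_from_type_algebra)
  assume "ideal J ring_of_type_algebra"
  then interpret ideal J "ring_of_type_algebra :: 'a ring" .
  show ?R
    using additive_subgroup.zero_closed[OF additive_subgroup_axioms]
      additive_subgroup.a_closed[OF additive_subgroup_axioms] I_l_closed
    by simp
next
  interpret cring "ring_of_type_algebra :: 'a ring" by (rule cring_from_type_algebra)
  assume R: ?R
  have uminus: "- x \<in> J" if "x \<in> J" for x
    using R that by (metis mult_minus1)
  have inv: "\<ominus>\<^bsub>ring_of_type_algebra\<^esub> x = - x" for x :: 'a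
    by (rule minus_equality) auto
  show "ideal J ring_of_type_algebra"
  proof (rule idealI)
    show "ring (ring_of_type_algebra :: 'a ring)" by (rule ring_from_type_algebra)
    show "subgroup J (add_monoid (ring_of_type_algebra :: 'a ring))"
      using R uminus inv by (intro subgroup.intro) (auto simp: a_inv_def)
  qed (use R in \<open>auto simp: mult.commute\<close>)
qed

context
  fixes J :: "'a::comm_ring_1 set"
  assumes J: "ideal J ring_of_type_algebra"
begin

lemma ideal_zero: "0 \<in> J"
  and ideal_add: "x \<in> J \<Longrightarrow> y \<in> J \<Longrightarrow> x + y \<in> J"
  and ideal_mult_left: "x \<in> J \<Longrightarrow> q * x \<in> J"
  using J unfolding ideal_type_iff by auto

lemma ideal_mult_right: "x \<in> J \<Longrightarrow> x * q \<in> J"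
  by (metis ideal_mult_left mult.commute)

lemma ideal_uminus: "x \<in> J \<Longrightarrow> - x \<in> J"
  by (metis ideal_mult_left mult_minus1)

lemma ideal_diff: "x \<in> J \<Longrightarrow> y \<in> J \<Longrightarrow> x - y \<in> J"
  by (metis ideal_uminus ideal_add diff_conv_add_uminus)

lemma ideal_sum: "(\<And>t. t \<in> T \<Longrightarrow> f t \<in> J) \<Longrightarrow> sum f T \<in> J"
  by (induction T rule: infinite_finite_induct) (auto intro: ideal_zero ideal_add)

lemma ideal_add_cancel: "x \<in> J \<Longrightarrow> x + y \<in> J \<longleftrightarrow> y \<in> J"
  by (metis ideal_add ideal_diff add_diff_cancel_left')

lemma ideal_pow_le: "x ^ n \<in> J \<Longrightarrow> n \<le> m \<Longrightarrow> x ^ m \<in> J"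
  by (metis ideal_mult_right le_add_diff_inverse power_add)

end

lemma genideal_type_ideal:
  "ideal (genideal ring_of_type_algebra B) (ring_of_type_algebra :: 'a::comm_ring_1 ring)"
  by (rule ring.genideal_ideal[OF ring_from_type_algebra]) simp

lemma genideal_type_self: "B \<subseteq> genideal (ring_of_type_algebra :: 'a::comm_ring_1 ring) B"
  by (rule ring.genideal_self[OF ring_from_type_algebra]) simp

lemma genideal_type_minimal:
  fixes J :: "'a::comm_ring_1 set"
  assumes "ideal J ring_of_type_algebra" "B \<subseteq> J"
  shows "genideal ring_of_type_algebra B \<subseteq> J"
  by (rule ring.genideal_minimal[OF ring_from_type_algebra assms])

lemma primeideal_type_iff:
  fixes P :: "'a::comm_ring_1 set"
  shows "primeideal P ring_of_type_algebra \<longleftrightarrow>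
    ideal P ring_of_type_algebra \<and> 1 \<notin> P \<and> (\<forall>x y. x * y \<in> P \<longrightarrow> x \<in> P \<or> y \<in> P)" (is "_ \<longleftrightarrow> ?R")
proof
  assume "primeideal P ring_of_type_algebra"
  then interpret primeideal P "ring_of_type_algebra :: 'a ring" .
  show ?R
    using is_ideal I_notcarr I_prime one_imp_carrier by auto
next
  assume R: ?R
  then show "primeideal P ring_of_type_algebra"
    by (intro primeidealI) (auto simp: cring_from_type_algebra)
qed

lemma radical_type: "radical ring_of_type_algebra J = {a::'a::comm_ring_1. \<exists>n>0. a ^ n \<in> J}"
  by (simp add: radical_def)

lemma primary_type_iff:
  fixes Q :: "'a::comm_ring_1 set"
  shows "primary_ideal ring_of_type_algebra Q \<longleftrightarrow> ideal Q ring_of_type_algebra \<and> 1 \<notin> Q \<and>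
    (\<forall>a b. a * b \<in> Q \<longrightarrow> a \<in> Q \<or> b \<in> radical ring_of_type_algebra Q)"
  unfolding primary_ideal_def
  using ideal_mult_left[of Q 1] by auto

lemma ideal_Int:
  assumes "ideal J (ring_of_type_algebra :: 'a::comm_ring_1 ring)" "ideal J' (ring_of_type_algebra :: 'a ring)"
  shows "ideal (J \<inter> J') (ring_of_type_algebra :: 'a ring)"
  using assms unfolding ideal_type_iff by auto

lemma ideal_plus_principal:
  fixes J :: "'a::comm_ring_1 set"
  assumes "ideal J ring_of_type_algebra"
  shows "ideal {j + x * g | j g. j \<in> J} ring_of_type_algebra"
  unfolding ideal_type_iff
proof (intro conjI ballI allI)
  show "0 \<in> {j + x * g | j g. j \<in> J}"
    using ideal_zero[OF assms] by (intro CollectI exI[of _ 0]) auto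
next
  fix a b assume "a \<in> {j + x * g | j g. j \<in> J}" "b \<in> {j + x * g | j g. j \<in> J}"
  then obtain j g j' g' where "a = j + x * g" "b = j' + x * g'" "j \<in> J" "j' \<in> J" by auto
  then have "a + b = (j + j') + x * (g + g')" "j + j' \<in> J"
    by (auto simp: algebra_simps ideal_add[OF assms])
  then show "a + b \<in> {j + x * g | j g. j \<in> J}" by blast
next
  fix a q assume "a \<in> {j + x * g | j g. j \<in> J}"
  then obtain j g where "a = j + x * g" "j \<in> J" by auto
  then have "q * a = q * j + x * (q * g)" "q * j \<in> J"
    using ideal_mult_left[OF assms] by (auto simp add: distrib_left mult.left_commute)
  then show "q * a \<in> {j + x * g | j g. j \<in> J}" by blast
qed

lemma prime_power_mem:
  fixes P :: "'a::comm_ring_1 set"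
  assumes "primeideal P ring_of_type_algebra" "a ^ n \<in> P"
  shows "a \<in> P"
  using assms(2)
proof (induction n)
  case 0
  then show ?case using assms(1) by (auto simp: primeideal_type_iff)
next
  case (Suc n)
  then show ?case using assms(1) unfolding primeideal_type_iff by auto
qed

text \<open>If every member had an element outside \<open>P\<close>, the product of these witnesses
  would lie in the intersection but not in \<open>P\<close>. The empty family is excluded because
  its intersection is the whole ring.\<close>

lemma prime_contains_of_Inter:
  fixes P :: "'a::comm_ring_1 set"
  assumes "finite D" "primeideal P ring_of_type_algebra"
    and "\<And>Q. Q \<in> D \<Longrightarrow> ideal Q ring_of_type_algebra" and "\<Inter>D \<subseteq> P"
  shows "\<exists>Q\<in>D. Q \<subseteq> P"
  using assms(1,3,4)
proof (induction D)
  case empty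
  then show ?case using assms(2) by (auto simp: primeideal_type_iff)
next
  case (insert Q D)
  show ?case
  proof (rule ccontr)
    assume c: "\<not> (\<exists>Q\<in>insert Q D. Q \<subseteq> P)"
    then obtain x where x: "x \<in> Q" "x \<notin> P" by blast
    obtain y where y: "y \<in> \<Inter>D" "y \<notin> P"
      using insert.IH insert.prems(1) c by blast
    have "x * y \<in> \<Inter>(insert Q D)"
      using x(1) y(1) ideal_mult_right[OF insert.prems(1)] ideal_mult_left[OF insert.prems(1)] by blast
    then have "x * y \<in> P" using insert.prems(2) by blast
    then show False using x y assms(2) unfolding primeideal_type_iff by blast
  qed
qed

lemma subset_radical: "J \<subseteq> radical ring_of_type_algebra (J :: 'a::comm_ring_1 set)"
  unfolding radical_type by (auto intro: exI[of _ 1])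

lemma radical_mono:
  "J \<subseteq> J' \<Longrightarrow> radical ring_of_type_algebra (J :: 'a::comm_ring_1 set) \<subseteq> radical ring_of_type_algebra J'"
  unfolding radical_type by auto

lemma radical_subset_prime:
  assumes "primeideal P (ring_of_type_algebra :: 'a::comm_ring_1 ring)" "J \<subseteq> P"
  shows "radical ring_of_type_algebra J \<subseteq> P"
  using assms prime_power_mem unfolding radical_type by blast

lemma ideal_radical:
  fixes J :: "'a::comm_ring_1 set"
  assumes "ideal J ring_of_type_algebra"
  shows "ideal (radical ring_of_type_algebra J) ring_of_type_algebra"
  unfolding ideal_type_iff
proof (intro conjI ballI allI)
  show "0 \<in> radical ring_of_type_algebra J"
    using ideal_zero[OF assms] subset_radical by blast
next
  fix x y assume "x \<in> radical ring_of_type_algebra J" "y \<in> radical ring_of_type_algebra J"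
  then obtain n m where nm: "x ^ n \<in> J" "y ^ m \<in> J" "n > 0" "m > 0"
    by (auto simp: radical_type)
  have "(x + y) ^ (n + m) = (\<Sum>k\<le>n + m. of_nat ((n + m) choose k) * x ^ k * y ^ (n + m - k))"
    by (rule binomial_ring)
  also have "\<dots> \<in> J"
  proof (rule ideal_sum[OF assms])
    fix k assume k: "k \<in> {..n + m}"
    show "of_nat ((n + m) choose k) * x ^ k * y ^ (n + m - k) \<in> J"
    proof (cases "k \<ge> n")
      case True
      then show ?thesis
        using ideal_pow_le[OF assms nm(1)] ideal_mult_left[OF assms] ideal_mult_right[OF assms] by blast
    next
      case False
      then have "m \<le> n + m - k" by simp
      then show ?thesis
        using ideal_pow_le[OF assms nm(2)] ideal_mult_left[OF assms] by blast
    qed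
  qed
  finally show "x + y \<in> radical ring_of_type_algebra J"
    using nm by (auto simp: radical_type intro!: exI[of _ "n + m"])
next
  fix x q assume "x \<in> radical ring_of_type_algebra J"
  then show "q * x \<in> radical ring_of_type_algebra J"
    using ideal_mult_left[OF assms] by (auto simp: radical_type power_mult_distrib)
qed

lemma primeideal_radical:
  fixes Q :: "'a::comm_ring_1 set"
  assumes "primary_ideal ring_of_type_algebra Q"
  shows "primeideal (radical ring_of_type_algebra Q) ring_of_type_algebra"
proof -
  have Q: "ideal Q ring_of_type_algebra" "1 \<notin> Q"
    and prim: "\<And>a b. a * b \<in> Q \<Longrightarrow> a \<in> Q \<or> b \<in> radical ring_of_type_algebra Q"
    using assms by (auto simp: primary_type_iff)
  show ?thesis
    unfolding primeideal_type_iff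
  proof (intro conjI allI impI)
    show "ideal (radical ring_of_type_algebra Q) ring_of_type_algebra"
      by (rule ideal_radical[OF Q(1)])
    show "1 \<notin> radical ring_of_type_algebra Q" using Q(2) by (simp add: radical_type)
  next
    fix x y assume "x * y \<in> radical ring_of_type_algebra Q"
    then obtain n where n: "n > 0" "x ^ n * y ^ n \<in> Q"
      by (auto simp: radical_type power_mult_distrib)
    show "x \<in> radical ring_of_type_algebra Q \<or> y \<in> radical ring_of_type_algebra Q"
      using prim[OF n(2)]
    proof
      assume "y ^ n \<in> radical ring_of_type_algebra Q"
      then obtain k where "k > 0" "y ^ (n * k) \<in> Q" by (auto simp: radical_type power_mult)
      then show ?thesis using n by (auto simp: radical_type intro!: exI[of _ "n * k"])
    qed (use n in \<open>auto simp: radical_type\<close>)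
  qed
qed

lemma radical_Int:
  fixes J J' :: "'a::comm_ring_1 set"
  assumes "ideal J ring_of_type_algebra" "ideal J' ring_of_type_algebra"
  shows "radical ring_of_type_algebra (J \<inter> J') =
    radical ring_of_type_algebra J \<inter> radical ring_of_type_algebra J'"
proof
  show "radical ring_of_type_algebra J \<inter> radical ring_of_type_algebra J'
      \<subseteq> radical ring_of_type_algebra (J \<inter> J')"
  proof
    fix x assume "x \<in> radical ring_of_type_algebra J \<inter> radical ring_of_type_algebra J'"
    then obtain n m where "n > 0" "x ^ n \<in> J" "x ^ m \<in> J'" by (auto simp: radical_type)
    then have "n + m > 0" "x ^ (n + m) \<in> J \<inter> J'"
      using ideal_pow_le[OF assms(1), of x n "n + m"] ideal_pow_le[OF assms(2), of x m "n + m"] by auto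
    then show "x \<in> radical ring_of_type_algebra (J \<inter> J')" by (auto simp: radical_type)
  qed
qed (use radical_mono in blast)

lemma primary_Int:
  fixes Q Q' :: "'a::comm_ring_1 set"
  assumes "primary_ideal ring_of_type_algebra Q" "primary_ideal ring_of_type_algebra Q'"
    and "radical ring_of_type_algebra Q = radical ring_of_type_algebra Q'"
  shows "primary_ideal ring_of_type_algebra (Q \<inter> Q')"
    and "radical ring_of_type_algebra (Q \<inter> Q') = radical ring_of_type_algebra Q"
proof -
  show *: "radical ring_of_type_algebra (Q \<inter> Q') = radical ring_of_type_algebra Q"
    using assms radical_Int[of Q Q'] by (simp add: primary_type_iff)
  show "primary_ideal ring_of_type_algebra (Q \<inter> Q')"
    using assms ideal_Int[of Q Q'] unfolding primary_type_iff * by auto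
qed

text \<open>Hypothesis \<open>inv\<close> makes every element outside the radical invertible modulo
  the radical. A power of \<open>1 - u * b\<close> that lies in \<open>Q\<close> turns this into an
  inverse of \<open>b\<close> modulo \<open>Q\<close> itself, by which \<open>b\<close> is cancelled
  from \<open>a * b\<close>.\<close>

lemma primary_of_maximal_radical:
  fixes Q :: "'a::comm_ring_1 set"
  assumes Q: "ideal Q ring_of_type_algebra" "1 \<notin> Q"
    and inv: "\<And>b. b \<notin> radical ring_of_type_algebra Q \<Longrightarrow> \<exists>u. 1 - u * b \<in> radical ring_of_type_algebra Q"
  shows "primary_ideal ring_of_type_algebra Q"
  unfolding primary_type_iff
proof (intro conjI allI impI)
  fix a b assume ab: "a * b \<in> Q"
  show "a \<in> Q \<or> b \<in> radical ring_of_type_algebra Q"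
  proof (rule disjCI)
    assume "b \<notin> radical ring_of_type_algebra Q"
    then obtain u where "1 - u * b \<in> radical ring_of_type_algebra Q" using inv by blast
    then obtain n where un: "(1 - u * b) ^ n \<in> Q" unfolding radical_type by blast
    have "\<exists>u'. (1 - u * b) ^ n = 1 - u' * b"
    proof (induction n)
      case (Suc n)
      then obtain u' where "(1 - u * b) ^ n = 1 - u' * b" by blast
      then have "(1 - u * b) ^ Suc n = (1 - u * b) * (1 - u' * b)" by simp
      also have "\<dots> = 1 - (u + u' - u * u' * b) * b" by (simp add: algebra_simps)
      finally have "(1 - u * b) ^ Suc n = 1 - (u + u' - u * u' * b) * b" .
      then show ?case by blast
    qed (auto intro: exI[of _ 0])
    then obtain u' where "1 - u' * b \<in> Q" using un by auto
    then have "a * (1 - u' * b) + u' * (a * b) \<in> Q"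
      using ab ideal_add[OF Q(1)] ideal_mult_left[OF Q(1)] by blast
    then show "a \<in> Q" by (simp add: algebra_simps)
  qed
qed (use Q in auto)

section \<open>Krull dimension of a quotient\<close>

text \<open>A prime of the quotient is recovered as the image of its preimage, so strict chains in
  the quotient pull back to strict chains above \<open>J\<close>.\<close>

lemma primeideal_quot_vimage:
  fixes J :: "'a::comm_ring_1 set"
  assumes J: "ideal J ring_of_type_algebra"
    and P: "primeideal P (ring_of_type_algebra Quot J)"
  defines "P' \<equiv> {x. J +>\<^bsub>ring_of_type_algebra\<^esub> x \<in> P}"
  shows "primeideal P' ring_of_type_algebra" and "J \<subseteq> P'"
    and "P = (+>\<^bsub>ring_of_type_algebra\<^esub>) J ` P'"
proof -
  let ?R = "ring_of_type_algebra :: 'a ring"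
  interpret J: ideal J ?R by (rule J)
  interpret P: primeideal P "?R Quot J" by (rule P)
  interpret h: ring_hom_ring ?R "?R Quot J" "(+>\<^bsub>?R\<^esub>) J" by (rule J.rcos_ring_hom_ring)
  have carr: "carrier (?R Quot J) = range ((+>\<^bsub>?R\<^esub>) J)"
    by (auto simp: FactRing_def A_RCOSETS_def')
  have one: "J +>\<^bsub>?R\<^esub> 1 = \<one>\<^bsub>?R Quot J\<^esub>"
    using h.hom_one by simp
  show "primeideal P' ?R"
    unfolding primeideal_type_iff
  proof (intro conjI allI impI)
    show "ideal P' ?R"
      unfolding ideal_type_iff P'_def
    proof (intro conjI ballI allI; (unfold mem_Collect_eq)?)
      show "J +>\<^bsub>?R\<^esub> 0 \<in> P"
        using h.hom_zero P.zero_closed by simp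
    next
      fix x y assume "J +>\<^bsub>?R\<^esub> x \<in> P" "J +>\<^bsub>?R\<^esub> y \<in> P"
      then show "J +>\<^bsub>?R\<^esub> (x + y) \<in> P"
        using h.hom_add[of x y] P.a_closed by simp
    next
      fix x q assume "J +>\<^bsub>?R\<^esub> x \<in> P"
      then show "J +>\<^bsub>?R\<^esub> (q * x) \<in> P"
        using h.hom_mult[of q x] P.I_l_closed[of _ "J +>\<^bsub>?R\<^esub> q"] h.hom_closed[of q] by simp
    qed
    show "1 \<notin> P'"
      unfolding P'_def using P.one_imp_carrier P.I_notcarr one by auto
  next
    fix x y assume "x * y \<in> P'"
    then show "x \<in> P' \<or> y \<in> P'"
      using h.hom_mult[of x y] P.I_prime[of "J +>\<^bsub>?R\<^esub> x" "J +>\<^bsub>?R\<^esub> y"] h.hom_closed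
      by (auto simp: P'_def)
  qed
  show "J \<subseteq> P'"
  proof
    fix x assume "x \<in> J"
    then have "J +>\<^bsub>?R\<^esub> x = J +>\<^bsub>?R\<^esub> 0"
      using J.a_rcos_zero[OF J, of x] J.a_rcos_zero[OF J, of 0] ideal_zero[OF J] by simp
    then show "x \<in> P'" using h.hom_zero P.zero_closed by (simp add: P'_def)
  qed
  show "P = (+>\<^bsub>?R\<^esub>) J ` P'"
    using P.a_subset carr by (auto simp: P'_def)
qed

lemma primeideal_quot_image:
  fixes J :: "'a::comm_ring_1 set"
  assumes J: "ideal J ring_of_type_algebra"
    and P: "primeideal P ring_of_type_algebra" "J \<subseteq> P"
  shows "primeideal ((+>\<^bsub>ring_of_type_algebra\<^esub>) J ` P) (ring_of_type_algebra Quot J)"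
    and "J +>\<^bsub>ring_of_type_algebra\<^esub> x \<in> (+>\<^bsub>ring_of_type_algebra\<^esub>) J ` P \<longleftrightarrow> x \<in> P"
proof -
  let ?R = "ring_of_type_algebra :: 'a ring"
  interpret J: ideal J ?R by (rule J)
  have Pi: "ideal P ?R" using P by (simp add: primeideal_type_iff)
  interpret h: ring_hom_ring ?R "?R Quot J" "(+>\<^bsub>?R\<^esub>) J" by (rule J.rcos_ring_hom_ring)
  have carr: "carrier (?R Quot J) = range ((+>\<^bsub>?R\<^esub>) J)"
    by (auto simp: FactRing_def A_RCOSETS_def')
  have mem: "J +>\<^bsub>?R\<^esub> y \<in> (+>\<^bsub>?R\<^esub>) J ` P \<longleftrightarrow> y \<in> P" for y
  proof
    assume "J +>\<^bsub>?R\<^esub> y \<in> (+>\<^bsub>?R\<^esub>) J ` P"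
    then obtain z where z: "z \<in> P" "J +>\<^bsub>?R\<^esub> y = J +>\<^bsub>?R\<^esub> z" by auto
    have "y \<in> J +>\<^bsub>?R\<^esub> y" using J.a_rcos_self[of y] by simp
    then obtain j where "j \<in> J" "y = j + z"
      unfolding z(2) by (auto simp: a_r_coset_def')
    then show "y \<in> P" using z(1) P(2) ideal_add[OF Pi] by auto
  qed auto
  show "J +>\<^bsub>?R\<^esub> x \<in> (+>\<^bsub>?R\<^esub>) J ` P \<longleftrightarrow> x \<in> P" by (rule mem)
  show "primeideal ((+>\<^bsub>?R\<^esub>) J ` P) (?R Quot J)"
  proof (rule primeidealI)
    show "ideal ((+>\<^bsub>?R\<^esub>) J ` P) (?R Quot J)"
      by (rule ring.ring_ideal_imp_quot_ideal[OF ring_from_type_algebra J Pi])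
    show "cring (?R Quot J)" by (rule J.quotient_is_cring[OF cring_from_type_algebra])
    show "carrier (?R Quot J) \<noteq> (+>\<^bsub>?R\<^esub>) J ` P"
      using mem[of 1] carr P(1) rangeI[of "(+>\<^bsub>?R\<^esub>) J" 1] unfolding primeideal_type_iff by metis
  next
    fix a b assume "a \<in> carrier (?R Quot J)" "b \<in> carrier (?R Quot J)"
      and ab: "a \<otimes>\<^bsub>?R Quot J\<^esub> b \<in> (+>\<^bsub>?R\<^esub>) J ` P"
    then obtain x y where xy: "a = J +>\<^bsub>?R\<^esub> x" "b = J +>\<^bsub>?R\<^esub> y" using carr by auto
    then have "x * y \<in> P" using ab h.hom_mult[of x y] mem[of "x * y"] by simp
    then show "a \<in> (+>\<^bsub>?R\<^esub>) J ` P \<or> b \<in> (+>\<^bsub>?R\<^esub>) J ` P"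
      using P(1) xy unfolding primeideal_type_iff by auto
  qed
qed

text \<open>A chain with at least two strict steps already exhibits three primes, so only its first
  three members are used for the upper bound; the pair \<open>P0\<close>, \<open>P1\<close> gives
  the lower one.\<close>

lemma krull_dim_quot_eq_1:
  fixes J :: "'a::comm_ring_1 set"
  assumes J: "ideal J ring_of_type_algebra"
    and "primeideal P0 ring_of_type_algebra" "primeideal P1 ring_of_type_algebra" "J \<subseteq> P0" "P0 \<subset> P1"
    and no_chain: "\<And>P Q R. primeideal P ring_of_type_algebra \<Longrightarrow> primeideal Q ring_of_type_algebra \<Longrightarrow>
      primeideal R ring_of_type_algebra \<Longrightarrow> J \<subseteq> P \<Longrightarrow> P \<subset> Q \<Longrightarrow> Q \<subset> R \<Longrightarrow> False"
  shows "krull_dim (ring_of_type_algebra Quot J) = 1"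
proof (rule antisym)
  let ?R = "ring_of_type_algebra :: 'a ring" and ?h = "(+>\<^bsub>ring_of_type_algebra\<^esub>) J"
  let ?S = "{enat n | n. \<exists>P :: nat \<Rightarrow> 'a set set.
     (\<forall>i\<le>n. primeideal (P i) (?R Quot J)) \<and> (\<forall>i<n. P i \<subset> P (Suc i))}"
  have J1: "J \<subseteq> P1" using assms by auto
  let ?P = "\<lambda>i::nat. if i = 0 then ?h ` P0 else ?h ` P1"
  have "?h ` P0 \<subset> ?h ` P1"
  proof -
    obtain x where "x \<in> P1" "x \<notin> P0" using assms by auto
    then have "?h x \<in> ?h ` P1" "?h x \<notin> ?h ` P0"
      using primeideal_quot_image(2)[OF J assms(2,4)] by auto
    then show ?thesis using assms(5) by blast
  qed
  then have P: "(\<forall>i\<le>1. primeideal (?P i) (?R Quot J)) \<and> (\<forall>i<1. ?P i \<subset> ?P (Suc i))"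
    using primeideal_quot_image(1)[OF J assms(2,4)] primeideal_quot_image(1)[OF J assms(3) J1] by auto
  have "enat 1 \<in> ?S"
    unfolding mem_Collect_eq by (rule exI[of _ 1], rule conjI[OF refl], rule exI[of _ ?P], rule P)
  then show "1 \<le> krull_dim (?R Quot J)"
    unfolding krull_dim_def one_enat_def by (rule Sup_upper)
  show "krull_dim (?R Quot J) \<le> 1"
    unfolding krull_dim_def
  proof (rule Sup_least)
    fix k assume "k \<in> ?S"
    then obtain n P where k: "k = enat n"
      and P: "\<And>i. i \<le> n \<Longrightarrow> primeideal (P i) (?R Quot J)" and lt: "\<And>i. i < n \<Longrightarrow> P i \<subset> P (Suc i)"
      unfolding mem_Collect_eq by metis
    have "n \<le> 1"
    proof (rule ccontr)
      assume "\<not> n \<le> 1"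
      then have n: "0 \<le> n" "Suc 0 \<le> n" "Suc (Suc 0) \<le> n" by auto
      define V where "V i = {x. ?h x \<in> P i}" for i
      have V: "primeideal (V i) ?R" "J \<subseteq> V i" "P i = ?h ` V i" if "i \<le> n" for i
        using primeideal_quot_vimage[OF J P[OF that]] unfolding V_def by auto
      have st: "V i \<subset> V (Suc i)" if "i < n" for i
      proof -
        have "V i \<subseteq> V (Suc i)" using lt[OF that] unfolding V_def by auto
        moreover have "V i \<noteq> V (Suc i)" using lt[OF that] V(3)[of i] V(3)[of "Suc i"] that by auto
        ultimately show ?thesis by blast
      qed
      show False
        using no_chain[OF V(1)[OF n(1)] V(1)[OF n(2)] V(1)[OF n(3)] V(2)[OF n(1)]] st n by simp
    qed
    then show "k \<le> 1" using k by (simp add: one_enat_def)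
  qed
qed

section \<open>Dimension of a quotient space\<close>

text \<open>Gaussian elimination: a pivot \<open>s\<close> with nonzero coefficient in equation
  \<open>b\<close> is solved for and removed, leaving one equation and one unknown fewer.\<close>

lemma homogeneous_system_nontrivial_solution:
  fixes c :: "'t \<Rightarrow> 'b \<Rightarrow> 'k::field"
  assumes "finite F" "finite T" "card F < card T"
  shows "\<exists>a. (\<exists>t\<in>T. a t \<noteq> 0) \<and> (\<forall>b\<in>F. (\<Sum>t\<in>T. a t * c t b) = 0)"
  using assms
proof (induction F arbitrary: T c rule: finite_induct)
  case empty
  then obtain t where "t \<in> T" by fastforce
  then show ?case by (intro exI[of _ "\<lambda>_. 1"]) auto
next
  case (insert b F)
  show ?case
  proof (cases "\<forall>t\<in>T. c t b = 0")
    case True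
    have "card F < card T" using insert by simp
    from insert.IH[OF insert.prems(1) this] obtain a where
      "\<exists>t\<in>T. a t \<noteq> 0" "\<forall>b\<in>F. (\<Sum>t\<in>T. a t * c t b) = 0" by blast
    moreover have "(\<Sum>t\<in>T. a t * c t b) = 0" using True by simp
    ultimately show ?thesis by (intro exI[of _ a]) auto
  next
    case False
    then obtain s where s: "s \<in> T" "c s b \<noteq> 0" by blast
    have "card F < card (T - {s})" using insert s by simp
    from insert.IH[OF _ this, of "\<lambda>t b'. c t b' - c t b / c s b * c s b'"] obtain a where
      a: "\<exists>t\<in>T - {s}. a t \<noteq> 0"
        "\<forall>b'\<in>F. (\<Sum>t\<in>T - {s}. a t * (c t b' - c t b / c s b * c s b')) = 0"
      using insert.prems by auto
    define a' where "a' t = (if t = s then - (\<Sum>t\<in>T - {s}. a t * c t b) / c s b else a t)" for t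
    have split: "(\<Sum>t\<in>T. a' t * c t b') =
        - (\<Sum>t\<in>T - {s}. a t * c t b) / c s b * c s b' + (\<Sum>t\<in>T - {s}. a t * c t b')" for b'
    proof -
      have "(\<Sum>t\<in>T. a' t * c t b') = a' s * c s b' + (\<Sum>t\<in>T - {s}. a' t * c t b')"
        by (rule sum.remove[OF insert.prems(1) s(1)])
      also have "(\<Sum>t\<in>T - {s}. a' t * c t b') = (\<Sum>t\<in>T - {s}. a t * c t b')"
        by (rule sum.cong) (auto simp: a'_def)
      finally show ?thesis by (simp add: a'_def)
    qed
    have "(\<Sum>t\<in>T. a' t * c t b') = 0" if "b' \<in> F" for b'
    proof -
      have "(\<Sum>t\<in>T. a' t * c t b') =
          (\<Sum>t\<in>T - {s}. a t * c t b') - (\<Sum>t\<in>T - {s}. a t * c t b) * (c s b' / c s b)"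
        unfolding split by simp
      also have "\<dots> = (\<Sum>t\<in>T - {s}. a t * (c t b' - c t b / c s b * c s b'))"
        unfolding sum_distrib_right sum_subtractf[symmetric]
        by (rule sum.cong) (simp_all add: algebra_simps)
      also have "\<dots> = 0" using a(2) that by blast
      finally show ?thesis .
    qed
    moreover have "(\<Sum>t\<in>T. a' t * c t b) = 0" unfolding split using s by simp
    moreover have "\<exists>t\<in>T. a' t \<noteq> 0" using a(1) by (auto simp: a'_def)
    ultimately show ?thesis by (intro exI[of _ a']) auto
  qed
qed

text \<open>Linear algebra in U/W without forming the quotient: statements are about representatives
  in \<open>U\<close> up to an error in \<open>W\<close>. It is applied to polynomials of bounded
  degree and the ideal elements among them.\<close>

locale scaled_quotient =
  fixes smul :: "'k::field \<Rightarrow> 'b::ab_group_add \<Rightarrow> 'b" and U W :: "'b set"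
  assumes smul_add: "smul a (x + y) = smul a x + smul a y"
    and smul_add_left: "smul (a + b) x = smul a x + smul b x"
    and smul_smul: "smul a (smul b x) = smul (a * b) x"
    and U_zero: "0 \<in> U" and U_add: "x \<in> U \<Longrightarrow> y \<in> U \<Longrightarrow> x + y \<in> U" and U_smul: "x \<in> U \<Longrightarrow> smul a x \<in> U"
    and W_zero: "0 \<in> W" and W_add: "x \<in> W \<Longrightarrow> y \<in> W \<Longrightarrow> x + y \<in> W" and W_smul: "x \<in> W \<Longrightarrow> smul a x \<in> W"
begin

lemma smul_zero_left: "smul 0 x = 0"
  using smul_add_left[of 0 0 x] by simp

lemma smul_zero: "smul a 0 = 0"
  using smul_add[of a 0 0] by simp

lemma smul_diff: "smul a (x - y) = smul a x - smul a y"
  by (metis add_diff_cancel_right' diff_add_cancel smul_add)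

lemma smul_sum_right: "smul a (sum f T) = (\<Sum>t\<in>T. smul a (f t))"
  by (induction T rule: infinite_finite_induct) (auto simp: smul_zero smul_add)

lemma smul_sum_left: "smul (sum f T) x = (\<Sum>t\<in>T. smul (f t) x)"
  by (induction T rule: infinite_finite_induct) (auto simp: smul_zero_left smul_add_left)

lemma W_sum: "(\<And>t. t \<in> T \<Longrightarrow> f t \<in> W) \<Longrightarrow> sum f T \<in> W"
  by (induction T rule: infinite_finite_induct) (auto simp: W_zero W_add)

text \<open>Expanding each \<open>v t\<close> in the spanning family modulo \<open>W\<close> gives
  one linear equation per member of \<open>F\<close>, in one unknown per member of
  \<open>T\<close>.\<close>

lemma dependent_modulo:
  assumes "finite F" "finite T" "card F < card T"
    and span: "\<And>u. u \<in> U \<Longrightarrow> \<exists>c. u - (\<Sum>b\<in>F. smul (c b) b) \<in> W"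
    and v: "\<And>t. t \<in> T \<Longrightarrow> v t \<in> U"
  shows "\<exists>a. (\<exists>t\<in>T. a t \<noteq> 0) \<and> (\<Sum>t\<in>T. smul (a t) (v t)) \<in> W"
proof -
  have "\<forall>t\<in>T. \<exists>c. v t - (\<Sum>b\<in>F. smul (c b) b) \<in> W" using span v by blast
  then obtain c where c: "\<And>t. t \<in> T \<Longrightarrow> v t - (\<Sum>b\<in>F. smul (c t b) b) \<in> W" by metis
  obtain a where a: "\<exists>t\<in>T. a t \<noteq> 0" "\<And>b. b \<in> F \<Longrightarrow> (\<Sum>t\<in>T. a t * c t b) = 0"
    using homogeneous_system_nontrivial_solution[OF assms(1-3), of c] by blast
  have "(\<Sum>t\<in>T. smul (a t) (\<Sum>b\<in>F. smul (c t b) b)) = (\<Sum>t\<in>T. \<Sum>b\<in>F. smul (a t * c t b) b)"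
    by (simp add: smul_sum_right smul_smul)
  also have "\<dots> = (\<Sum>b\<in>F. smul (\<Sum>t\<in>T. a t * c t b) b)"
    unfolding smul_sum_left by (rule sum.swap)
  also have "\<dots> = 0" using a(2) by (simp add: smul_zero_left)
  finally have "(\<Sum>t\<in>T. smul (a t) (v t)) = (\<Sum>t\<in>T. smul (a t) (v t - (\<Sum>b\<in>F. smul (c t b) b)))"
    by (simp add: smul_diff sum_subtractf)
  also have "\<dots> \<in> W" using c by (auto intro: W_sum W_smul)
  finally show ?thesis using a(1) by blast
qed

lemma basis_modulo_card_le:
  assumes B: "basis_modulo smul U W B" and B': "basis_modulo smul U W B'"
  shows "card B' \<le> card B"
proof (rule ccontr)
  assume "\<not> card B' \<le> card B"
  then have "card B < card B'" by simp
  moreover have "finite B" "finite B'" "B' \<subseteq> U"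
    and "\<And>u. u \<in> U \<Longrightarrow> \<exists>c. u - (\<Sum>b\<in>B. smul (c b) b) \<in> W"
    using B B' unfolding basis_modulo_def by blast+
  ultimately obtain a where a: "\<exists>t\<in>B'. a t \<noteq> 0" "(\<Sum>t\<in>B'. smul (a t) t) \<in> W"
    using dependent_modulo[of B B' "\<lambda>t. t"] by blast
  \<comment> \<open>A nontrivial relation represents 0 in two ways, by \<open>d\<close> and by the
    zero function \<open>z\<close>, against uniqueness. Restriction makes both functions
    extensional.\<close>
  define d where "d = restrict (\<lambda>t. - a t) B'"
  define z where "z = restrict (\<lambda>t. 0 :: 'k) B'"
  have neg: "smul (- x) y = - smul x y" for x y
    using smul_add_left[of x "- x" y] by (simp add: smul_zero_left add_eq_0_iff)
  have "d \<in> B' \<rightarrow>\<^sub>E UNIV" "0 - (\<Sum>t\<in>B'. smul (d t) t) \<in> W"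
    using a(2) by (auto simp: d_def neg sum_negf)
  moreover have "z \<in> B' \<rightarrow>\<^sub>E UNIV" "0 - (\<Sum>t\<in>B'. smul (z t) t) \<in> W"
    by (auto simp: z_def smul_zero_left W_zero)
  ultimately have "d = z" using B' U_zero unfolding basis_modulo_def by blast
  then have "a t = 0" if "t \<in> B'" for t
    using that by (auto simp: d_def z_def fun_eq_iff split: if_splits)
  then show False using a(1) by blast
qed

lemma quotient_dim_eq_card:
  assumes "basis_modulo smul U W B"
  shows "quotient_dim smul U W = card B"
  unfolding quotient_dim_def
proof (rule the_equality)
  show "\<exists>B'. basis_modulo smul U W B' \<and> card B' = card B" using assms by blast
  show "n = card B" if "\<exists>B'. basis_modulo smul U W B' \<and> card B' = n" for n
    using that basis_modulo_card_le assms by (meson le_antisym)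
qed

end

section \<open>Linear functionals and evaluation of polynomials\<close>

text \<open>Evaluation, class sums, the constant term and the substitution of one indeterminate for
  all variables are instances, so additivity and multiplicativity are proved once for all of
  them.\<close>

definition mpoly_ext :: "('k \<Rightarrow> 'r) \<Rightarrow> (('v \<Rightarrow>\<^sub>0 nat) \<Rightarrow> 'r) \<Rightarrow> ('v, 'k::comm_ring_1) mpoly \<Rightarrow> 'r::comm_ring_1" where
  "mpoly_ext f g p = (\<Sum>m\<in>Poly_Mapping.keys p. f (Poly_Mapping.lookup p m) * g m)"

locale additive_map =
  fixes f :: "'k::comm_ring_1 \<Rightarrow> 'r::comm_ring_1"
  assumes map_add: "f (x + y) = f x + f y"
begin

lemma map_zero [simp]: "f 0 = 0"
  using map_add[of 0 0] by simp

lemma mpoly_ext_superset: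
  assumes "finite S" "Poly_Mapping.keys p \<subseteq> S"
  shows "mpoly_ext f g p = (\<Sum>m\<in>S. f (Poly_Mapping.lookup p m) * g m)"
  unfolding mpoly_ext_def
  by (rule sum.mono_neutral_left) (use assms in \<open>auto simp: in_keys_iff\<close>)

lemma mpoly_ext_add: "mpoly_ext f g (p + q) = mpoly_ext f g p + mpoly_ext f g q"
proof -
  let ?S = "Poly_Mapping.keys p \<union> Poly_Mapping.keys q"
  have "Poly_Mapping.keys (p + q) \<subseteq> ?S" by (rule Poly_Mapping.keys_add)
  then show ?thesis
    using mpoly_ext_superset[of ?S p g] mpoly_ext_superset[of ?S q g] mpoly_ext_superset[of ?S "p + q" g]
    by (simp add: lookup_add map_add ring_distribs sum.distrib)
qed

lemma mpoly_ext_zero [simp]: "mpoly_ext f g 0 = 0"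
  by (simp add: mpoly_ext_def)

lemma mpoly_ext_uminus: "mpoly_ext f g (- p) = - mpoly_ext f g p"
  using mpoly_ext_add[of g p "- p"] by (simp add: add_eq_0_iff2 minus_equation_iff)

lemma mpoly_ext_diff: "mpoly_ext f g (p - q) = mpoly_ext f g p - mpoly_ext f g q"
  using mpoly_ext_add[of g p "- q"] by (simp add: mpoly_ext_uminus)

lemma mpoly_ext_sum: "mpoly_ext f g (\<Sum>t\<in>T. h t) = (\<Sum>t\<in>T. mpoly_ext f g (h t))"
  by (induction T rule: infinite_finite_induct) (auto simp: mpoly_ext_add)

lemma mpoly_ext_single [simp]: "mpoly_ext f g (Poly_Mapping.single m c) = f c * g m"
  by (cases "c = 0") (auto simp: mpoly_ext_def)

end

lemma mpoly_sum_single: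
  "(p :: ('v, 'k::comm_ring_1) mpoly) =
     (\<Sum>m\<in>Poly_Mapping.keys p. Poly_Mapping.single m (Poly_Mapping.lookup p m))"
  by (rule poly_mapping_eqI)
    (auto simp: lookup_sum lookup_single when_def sum.delta in_keys_iff)

lemma mpoly_mult_sum:
  "(p :: ('v, 'k::comm_ring_1) mpoly) * q =
     (\<Sum>m\<in>Poly_Mapping.keys p. Poly_Mapping.single m (Poly_Mapping.lookup p m) * q)"
  by (subst (1) mpoly_sum_single[of p]) (simp add: sum_distrib_right)

locale ring_map = additive_map +
  assumes map_mult: "f (x * y) = f x * f y"
begin

lemma mpoly_ext_mult:
  assumes g: "\<And>m n. g (m + n) = g m * g n"
  shows "mpoly_ext f g (p * q) = mpoly_ext f g p * mpoly_ext f g q"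
proof -
  have 1: "mpoly_ext f g (Poly_Mapping.single m c * q) = f c * g m * mpoly_ext f g q" for m c
  proof -
    have "Poly_Mapping.single m c * q =
        (\<Sum>n\<in>Poly_Mapping.keys q. Poly_Mapping.single (m + n) (c * Poly_Mapping.lookup q n))"
      by (subst (1) mpoly_sum_single[of q]) (simp add: sum_distrib_left mult_single)
    then show ?thesis
      by (simp add: mpoly_ext_sum map_mult g mpoly_ext_def[of f g q] sum_distrib_left mult_ac)
  qed
  show ?thesis
    by (subst mpoly_mult_sum)
      (simp add: mpoly_ext_sum 1 mpoly_ext_def[of f g p] sum_distrib_right)
qed

lemma ideal_mpoly_ext_kernel:
  assumes g: "\<And>m n. g (m + n) = g m * g n"
  shows "ideal {p. mpoly_ext f g p = 0} mpoly_ring"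
  unfolding ideal_type_iff by (auto simp: mpoly_ext_add mpoly_ext_mult[OF g])

end

lemma primeideal_mpoly_ext_kernel:
  fixes f :: "'k::comm_ring_1 \<Rightarrow> 'r::idom"
  assumes "ring_map f" "f 1 = 1"
    and g: "\<And>m n. g (m + n) = g m * g n" "g 0 = 1"
  shows "primeideal {p. mpoly_ext f g p = 0} mpoly_ring"
proof -
  interpret ring_map f by (rule assms(1))
  have "mpoly_ext f g 1 = 1"
    unfolding single_one[symmetric] mpoly_ext_single using assms by simp
  then show ?thesis
    unfolding primeideal_type_iff
    using ideal_mpoly_ext_kernel[of g] g by (auto simp: mpoly_ext_mult)
qed

lemma ring_map_id: "ring_map (\<lambda>x. x :: 'a::comm_ring_1)"
  by unfold_locales auto

lemma ring_map_const_poly: "ring_map (\<lambda>c::'a::comm_ring_1. [:c:])"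
  by unfold_locales auto

lemma mpoly_eval_conv_ext:
  "mpoly_eval p x = mpoly_ext (\<lambda>c. c) (\<lambda>m. \<Prod>i\<in>UNIV. (x $ i) ^ Poly_Mapping.lookup m i) p"
  by (simp add: mpoly_eval_def mpoly_ext_def)

lemma mpoly_eval_single:
  "mpoly_eval (Poly_Mapping.single m c) x = c * (\<Prod>i\<in>UNIV. (x $ i) ^ Poly_Mapping.lookup m i)"
proof -
  interpret ring_map "\<lambda>x. x :: 'a" by (rule ring_map_id)
  show ?thesis unfolding mpoly_eval_conv_ext by simp
qed

lemma mpoly_eval_diff: "mpoly_eval (p - q) x = mpoly_eval p x - mpoly_eval q x"
proof -
  interpret ring_map "\<lambda>x. x :: 'a" by (rule ring_map_id)
  show ?thesis unfolding mpoly_eval_conv_ext by (rule mpoly_ext_diff)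
qed

lemma ideal_mpoly_eval_kernel: "ideal {p. mpoly_eval p x = 0} mpoly_ring"
proof -
  interpret ring_map "\<lambda>x. x :: 'b" by (rule ring_map_id)
  show ?thesis
    unfolding mpoly_eval_conv_ext
    by (rule ideal_mpoly_ext_kernel) (simp add: lookup_add power_add prod.distrib)
qed

lemma zero_locus_genideal: "zero_locus (genideal mpoly_ring B) = zero_locus B"
proof
  show "zero_locus B \<subseteq> zero_locus (genideal mpoly_ring B)"
  proof
    fix x assume "x \<in> zero_locus B"
    then have "B \<subseteq> {p. mpoly_eval p x = 0}" by (auto simp: zero_locus_def)
    then have "genideal mpoly_ring B \<subseteq> {p. mpoly_eval p x = 0}"
      by (rule genideal_type_minimal[OF ideal_mpoly_eval_kernel])
    then show "x \<in> zero_locus (genideal mpoly_ring B)" by (auto simp: zero_locus_def)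
  qed
qed (use genideal_type_self in \<open>auto simp: zero_locus_def\<close>)

section \<open>Binomial congruences and binomial ideals\<close>

definition exp_vec :: "('v::finite \<Rightarrow>\<^sub>0 nat) \<Rightarrow> int^'v" where
  "exp_vec m = (\<chi> i. int (Poly_Mapping.lookup m i))"

definition exp_deg :: "('v::finite \<Rightarrow>\<^sub>0 nat) \<Rightarrow> nat" where
  "exp_deg m = (\<Sum>i\<in>UNIV. Poly_Mapping.lookup m i)"

lemma lookup_pos_exponent [simp]: "Poly_Mapping.lookup (pos_exponent a) i = nat (a $ i)"
  by (simp add: pos_exponent_def)

lemma exp_vec_nth [simp]: "exp_vec m $ i = int (Poly_Mapping.lookup m i)"
  by (simp add: exp_vec_def)

lemma exp_vec_add: "exp_vec (m + n) = exp_vec m + exp_vec n"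
  by (simp add: vec_eq_iff lookup_add)

lemma exp_vec_inject: "exp_vec m = exp_vec n \<longleftrightarrow> m = n"
  by (simp add: vec_eq_iff poly_mapping_eq_iff fun_eq_iff)

lemma exp_vec_pos_exponent: "exp_vec (pos_exponent a) - exp_vec (pos_exponent (- a)) = a"
  by (simp add: vec_eq_iff)

lemma exp_vec_pos_exponent_nonneg: "(\<And>i. 0 \<le> a $ i) \<Longrightarrow> exp_vec (pos_exponent a) = a"
  by (simp add: vec_eq_iff)

lemma exp_deg_zero [simp]: "exp_deg 0 = 0"
  by (simp add: exp_deg_def)

lemma exp_deg_add: "exp_deg (m + n) = exp_deg m + exp_deg n"
  by (simp add: exp_deg_def lookup_add sum.distrib)

lemma exp_deg_single [simp]: "exp_deg (Poly_Mapping.single i n) = n"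
  by (simp add: exp_deg_def lookup_single when_def)

lemma exp_deg_eq_0_iff: "exp_deg m = 0 \<longleftrightarrow> m = 0"
  by (auto simp: exp_deg_def intro: poly_mapping_eqI)

lemma int_exp_deg: "int (exp_deg m) = (\<Sum>i\<in>UNIV. exp_vec m $ i)"
  by (simp add: exp_deg_def)

lemma finite_exp_deg_le: "finite {m :: 'v::finite \<Rightarrow>\<^sub>0 nat. exp_deg m \<le> d}"
proof (rule finite_subset)
  show "{m. exp_deg m \<le> d} \<subseteq> Abs_poly_mapping ` (PiE UNIV (\<lambda>_::'v. {..d}))"
  proof
    fix m :: "'v \<Rightarrow>\<^sub>0 nat" assume "m \<in> {m. exp_deg m \<le> d}"
    then have "exp_deg m \<le> d" by simp
    then have "Poly_Mapping.lookup m i \<le> d" for i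
      using member_le_sum[of i UNIV "Poly_Mapping.lookup m"] by (simp add: exp_deg_def)
    then have "Poly_Mapping.lookup m \<in> PiE UNIV (\<lambda>_. {..d})" by auto
    moreover have "m = Abs_poly_mapping (Poly_Mapping.lookup m)" by simp
    ultimately show "m \<in> Abs_poly_mapping ` (PiE UNIV (\<lambda>_. {..d}))" by blast
  qed
  show "finite (Abs_poly_mapping ` (PiE UNIV (\<lambda>_::'v. {..d})))"
    by (intro finite_imageI finite_PiE) auto
qed

lemma finite_exp_deg_eq: "finite {m :: 'v::finite \<Rightarrow>\<^sub>0 nat. exp_deg m = d}"
  by (rule finite_subset[OF _ finite_exp_deg_le[of d]]) auto

text \<open>The common part \<open>c\<close> is the componentwise minimum of \<open>m\<close> and
  \<open>n\<close>, obtained by truncated subtraction of the positive part of the difference from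
  \<open>m\<close>.\<close>

lemma exp_vec_diff_split:
  assumes "exp_vec m - exp_vec n = a"
  shows "\<exists>c. m = c + pos_exponent a \<and> n = c + pos_exponent (- a)"
proof (intro exI conjI)
  have ai: "a $ i = int (Poly_Mapping.lookup m i) - int (Poly_Mapping.lookup n i)" for i
    using assms by auto
  show "m = (m - pos_exponent a) + pos_exponent a"
  proof (rule poly_mapping_eqI)
    show "Poly_Mapping.lookup m i = Poly_Mapping.lookup (m - pos_exponent a + pos_exponent a) i" for i
      unfolding lookup_add lookup_minus lookup_pos_exponent using ai[of i] by linarith
  qed
  show "n = (m - pos_exponent a) + pos_exponent (- a)"
  proof (rule poly_mapping_eqI)
    show "Poly_Mapping.lookup n i = Poly_Mapping.lookup (m - pos_exponent a + pos_exponent (- a)) i" for i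
      unfolding lookup_add lookup_minus lookup_pos_exponent vector_uminus_component using ai[of i] by linarith
  qed
qed

text \<open>For Laplacian columns this is chip firing and its reverse on nonnegative configurations:
  a vertex topples only if it has enough chips. Lattice equivalence allows debts in between, and
  this is the difference between the Laplacian ideal and the toppling ideal.\<close>

inductive bcong :: "(int^'v::finite) set \<Rightarrow> ('v \<Rightarrow>\<^sub>0 nat) \<Rightarrow> ('v \<Rightarrow>\<^sub>0 nat) \<Rightarrow> bool" for A where
  bcong_base: "a \<in> A \<Longrightarrow> bcong A (c + pos_exponent a) (c + pos_exponent (- a))"
| bcong_refl: "bcong A m m"
| bcong_sym: "bcong A m n \<Longrightarrow> bcong A n m"
| bcong_trans: "bcong A m n \<Longrightarrow> bcong A n k \<Longrightarrow> bcong A m k"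

lemma bcong_add_left: "bcong A m n \<Longrightarrow> bcong A (c + m) (c + n)"
proof (induction rule: bcong.induct)
  case (bcong_base a c')
  then show ?case using bcong.bcong_base[of a A "c + c'"] by (simp add: add.assoc)
qed (blast intro: bcong.intros)+

lemma bcong_add:
  assumes "bcong A m n" "bcong A m' n'"
  shows "bcong A (m + m') (n + n')"
proof -
  have "bcong A (m + m') (m + n')" using assms(2) by (rule bcong_add_left)
  moreover have "bcong A (m + n') (n + n')"
    using bcong_add_left[OF assms(1), of n'] by (simp add: add.commute)
  ultimately show ?thesis by (rule bcong_trans)
qed

lemma bcong_mono: "bcong A m n \<Longrightarrow> A \<subseteq> B \<Longrightarrow> bcong B m n"
  by (induction rule: bcong.induct) (blast intro: bcong.intros)+

lemma group_int_vec_group: "group (int_vec_group :: (int^'v) monoid)"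
proof (rule groupI)
  fix x :: "int^'v" assume "x \<in> carrier int_vec_group"
  have "- x + x = 0" by simp
  then show "\<exists>y\<in>carrier int_vec_group. y \<otimes>\<^bsub>int_vec_group\<^esub> x = \<one>\<^bsub>int_vec_group\<^esub>"
    unfolding int_vec_group_def by (intro bexI[of _ "- x"]) simp_all
qed (auto simp: int_vec_group_def)

lemma int_vec_group_simps [simp]:
  "carrier int_vec_group = UNIV" "x \<otimes>\<^bsub>int_vec_group\<^esub> y = x + y" "\<one>\<^bsub>int_vec_group\<^esub> = 0"
  by (simp_all add: int_vec_group_def)

lemma int_vec_group_inv [simp]: "inv\<^bsub>int_vec_group\<^esub> x = - x"
  by (rule group.inv_equality[OF group_int_vec_group]) auto

lemma subgroup_int_vec_iff:
  "subgroup H int_vec_group \<longleftrightarrow> 0 \<in> H \<and> (\<forall>x\<in>H. \<forall>y\<in>H. x + y \<in> H) \<and> (\<forall>x\<in>H. - x \<in> H)"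
  unfolding subgroup_def by auto

text \<open>For a subgroup the closure adds nothing: two exponents with difference in
  \<open>H\<close> are already joined by one generating step.\<close>

lemma bcong_lattice_iff:
  assumes "subgroup H int_vec_group"
  shows "bcong H m n \<longleftrightarrow> exp_vec m - exp_vec n \<in> H"
proof
  have H: "0 \<in> H" "\<And>x y. x \<in> H \<Longrightarrow> y \<in> H \<Longrightarrow> x + y \<in> H" "\<And>x. x \<in> H \<Longrightarrow> - x \<in> H"
    using assms by (auto simp: subgroup_int_vec_iff)
  show "exp_vec m - exp_vec n \<in> H" if "bcong H m n"
    using that
  proof (induction rule: bcong.induct)
    case (bcong_base a c)
    then show ?case by (simp add: exp_vec_add exp_vec_pos_exponent)
  next
    case (bcong_sym m n)
    then show ?case using H(3) by fastforce
  next
    case (bcong_trans m n k)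
    then show ?case using H(2)[of "exp_vec m - exp_vec n" "exp_vec n - exp_vec k"] by simp
  qed (use H(1) in auto)
  assume H: "exp_vec m - exp_vec n \<in> H"
  obtain c where "m = c + pos_exponent (exp_vec m - exp_vec n)" "n = c + pos_exponent (- (exp_vec m - exp_vec n))"
    using exp_vec_diff_split[OF refl, of m n] by (elim exE conjE)
  with bcong_base[OF H, of c] show "bcong H m n" by simp
qed

lemma bcong_exp_deg:
  fixes A :: "(int^'v::finite) set"
  assumes "\<forall>a\<in>A. (\<Sum>i\<in>UNIV. a $ i) = 0" "bcong A m n"
  shows "exp_deg m = exp_deg n"
  using assms(2)
proof (induction rule: bcong.induct)
  case (bcong_base a c)
  have "int (exp_deg (pos_exponent a)) - int (exp_deg (pos_exponent (- a))) = (\<Sum>i\<in>UNIV. a $ i)"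
    unfolding int_exp_deg sum_subtractf[symmetric]
    by (rule sum.cong) auto
  then show ?case using bspec[OF assms(1) bcong_base] by (simp add: exp_deg_add)
qed auto

text \<open>Classes are named by one chosen member. Congruent monomials satisfy the same predicate
  under \<open>SOME\<close>, so the choice depends on the class only.\<close>

definition class_rep :: "(int^'v::finite) set \<Rightarrow> ('v \<Rightarrow>\<^sub>0 nat) \<Rightarrow> ('v \<Rightarrow>\<^sub>0 nat)" where
  "class_rep A m = (SOME n. bcong A n m)"

lemma bcong_class_rep: "bcong A (class_rep A m) m"
  unfolding class_rep_def by (rule someI[of _ m]) (rule bcong_refl)

lemma class_rep_eq_iff: "class_rep A m = class_rep A n \<longleftrightarrow> bcong A m n"
proof
  assume "class_rep A m = class_rep A n"
  then show "bcong A m n" by (metis bcong_class_rep bcong_sym bcong_trans)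
next
  assume "bcong A m n"
  then have "bcong A k m \<longleftrightarrow> bcong A k n" for k by (meson bcong_sym bcong_trans)
  then show "class_rep A m = class_rep A n" by (simp add: class_rep_def)
qed

lemma class_rep_idem [simp]: "class_rep A (class_rep A m) = class_rep A m"
  by (simp add: class_rep_eq_iff bcong_class_rep)

text \<open>The coefficient at the class of \<open>x\<close> after congruent monomials have been
  identified. These functionals together cut out the binomial ideal.\<close>

definition class_sum :: "(int^'v::finite) set \<Rightarrow> ('v \<Rightarrow>\<^sub>0 nat) \<Rightarrow> ('v, 'k::comm_ring_1) mpoly \<Rightarrow> 'k" where
  "class_sum A x = mpoly_ext (\<lambda>c. c) (\<lambda>m. of_bool (bcong A m x))"

lemma additive_map_id: "additive_map (\<lambda>x. x :: 'a::comm_ring_1)"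
  by unfold_locales auto

lemmas class_sum_zero [simp] = additive_map.mpoly_ext_zero[OF additive_map_id, of "\<lambda>m. of_bool (bcong A m x)", folded class_sum_def] for A x
lemmas class_sum_add = additive_map.mpoly_ext_add[OF additive_map_id, of "\<lambda>m. of_bool (bcong A m x)", folded class_sum_def] for A x
lemmas class_sum_diff = additive_map.mpoly_ext_diff[OF additive_map_id, of "\<lambda>m. of_bool (bcong A m x)", folded class_sum_def] for A x
lemmas class_sum_sum = additive_map.mpoly_ext_sum[OF additive_map_id, of "\<lambda>m. of_bool (bcong A m x)", folded class_sum_def] for A x
lemmas class_sum_single [simp] = additive_map.mpoly_ext_single[OF additive_map_id, of "\<lambda>m. of_bool (bcong A m x)", folded class_sum_def] for A x

lemma class_sum_cong: "bcong A x y \<Longrightarrow> class_sum A x p = class_sum A y p"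
proof -
  assume "bcong A x y"
  then have "bcong A m x \<longleftrightarrow> bcong A m y" for m by (meson bcong_sym bcong_trans)
  then show ?thesis by (simp add: class_sum_def)
qed

lemma class_sum_conv_sum:
  "class_sum A x p = (\<Sum>m\<in>{m\<in>Poly_Mapping.keys p. class_rep A m = class_rep A x}. Poly_Mapping.lookup p m)"
  unfolding class_sum_def mpoly_ext_def class_rep_eq_iff sum.inter_filter[OF finite_keys]
  by (rule sum.cong) auto

text \<open>Grouping the terms of \<open>p\<close> by class factors every class-invariant extension
  through the class sums. It is used with values in the scalars, in the polynomial ring itself and
  in univariate polynomials.\<close>

lemma mpoly_ext_class_invariant:
  fixes f :: "'k::comm_ring_1 \<Rightarrow> 'r::comm_ring_1"
  assumes "additive_map f" and p: "\<And>x. class_sum A x p = 0"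
    and h: "\<And>m n. bcong A m n \<Longrightarrow> h m = h n"
  shows "mpoly_ext f h p = 0"
proof -
  interpret additive_map f by (rule assms(1))
  let ?K = "Poly_Mapping.keys p" and ?r = "class_rep A"
  have fsum: "f (sum g T) = (\<Sum>t\<in>T. f (g t))" for g :: "('a \<Rightarrow>\<^sub>0 nat) \<Rightarrow> 'k" and T
    by (induction T rule: infinite_finite_induct) (auto simp: map_add)
  have "mpoly_ext f h p = (\<Sum>y\<in>?r ` ?K. \<Sum>m\<in>{m\<in>?K. ?r m = y}. f (Poly_Mapping.lookup p m) * h m)"
    unfolding mpoly_ext_def by (rule sum.image_gen) simp
  also have "\<dots> = (\<Sum>y\<in>?r ` ?K. f (class_sum A y p) * h y)"
  proof (rule sum.cong)
    fix y assume "y \<in> ?r ` ?K"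
    then have y: "?r y = y" by auto
    have "(\<Sum>m\<in>{m\<in>?K. ?r m = y}. f (Poly_Mapping.lookup p m) * h m)
        = (\<Sum>m\<in>{m\<in>?K. ?r m = y}. f (Poly_Mapping.lookup p m) * h y)"
    proof (rule sum.cong)
      fix m assume "m \<in> {m\<in>?K. ?r m = y}"
      then have "h m = h y" using h bcong_class_rep[of A m] by (metis (mono_tags, lifting) mem_Collect_eq)
      then show "f (Poly_Mapping.lookup p m) * h m = f (Poly_Mapping.lookup p m) * h y" by simp
    qed simp
    then show "(\<Sum>m\<in>{m\<in>?K. ?r m = y}. f (Poly_Mapping.lookup p m) * h m) = f (class_sum A y p) * h y"
      unfolding class_sum_conv_sum y fsum sum_distrib_right by simp
  qed simp
  also have "\<dots> = 0" using p by simp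
  finally show ?thesis .
qed

lemma class_sum_single_mult:
  "class_sum A x (Poly_Mapping.single c d * p) =
    d * mpoly_ext (\<lambda>e. e) (\<lambda>m. of_bool (bcong A (c + m) x)) p"
proof -
  have "Poly_Mapping.single c d * p =
      (\<Sum>m\<in>Poly_Mapping.keys p. Poly_Mapping.single (c + m) (d * Poly_Mapping.lookup p m))"
    by (subst (1) mpoly_sum_single[of p]) (simp add: sum_distrib_left mult_single)
  then show ?thesis
    by (simp only: class_sum_sum class_sum_single mpoly_ext_def sum_distrib_left mult.assoc)
qed

text \<open>A class sum of a monomial multiple of \<open>p\<close> is a sum over the preimage of a
  class under a shift, and such a preimage is a union of classes.\<close>

lemma ideal_class_sum_kernel:
  fixes A :: "(int^'v::finite) set"
  shows "ideal {p :: ('v, 'k::comm_ring_1) mpoly. \<forall>x. class_sum A x p = 0} mpoly_ring"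
proof -
  have "class_sum A x (q * p) = 0" if p: "\<And>x. class_sum A x p = 0" for p q :: "('v, 'k) mpoly" and x
  proof -
    have "class_sum A x (Poly_Mapping.single m c * p) = 0" for m c
    proof -
      have "mpoly_ext (\<lambda>c. c) (\<lambda>n. of_bool (bcong A (m + n) x)) p = 0"
      proof (rule mpoly_ext_class_invariant[OF additive_map_id p])
        fix n n' assume "bcong A n n'"
        then have "bcong A (m + n) (m + n')" by (rule bcong_add_left)
        then have "bcong A (m + n) x \<longleftrightarrow> bcong A (m + n') x"
          using bcong_sym bcong_trans by blast
        then show "of_bool (bcong A (m + n) x) = of_bool (bcong A (m + n') x)" by simp
      qed
      then show ?thesis by (simp add: class_sum_single_mult)
    qed
    then show ?thesis by (subst mpoly_mult_sum) (simp add: class_sum_sum)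
  qed
  then show ?thesis unfolding ideal_type_iff by (auto simp: class_sum_add)
qed

lemma ideal_lattice_ideal: "ideal (lattice_ideal A) mpoly_ring"
  unfolding lattice_ideal_def by (rule genideal_type_ideal)

lemma monomial_diff_mem:
  assumes "bcong A m n"
  shows "Poly_Mapping.single m c - Poly_Mapping.single n c \<in> lattice_ideal A"
  using assms
proof (induction rule: bcong.induct)
  case (bcong_base a c')
  have "binomial_of a \<in> lattice_ideal A"
    unfolding lattice_ideal_def by (rule subsetD[OF genideal_type_self], rule imageI, rule bcong_base)
  then have "Poly_Mapping.single c' c * binomial_of a \<in> lattice_ideal A"
    by (rule ideal_mult_left[OF ideal_lattice_ideal])
  then show ?case by (simp add: binomial_of_def right_diff_distrib mult_single)
next
  case (bcong_refl m)
  then show ?case using ideal_zero[OF ideal_lattice_ideal] by simp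
next
  case (bcong_sym m n)
  then show ?case using ideal_uminus[OF ideal_lattice_ideal] by fastforce
next
  case (bcong_trans m n k)
  then show ?case
    using ideal_add[OF ideal_lattice_ideal bcong_trans.IH] by simp
qed

text \<open>For the converse, replacing each monomial by its class representative sends
  \<open>p\<close> to 0; subtracting this zero writes \<open>p\<close> as a sum of differences of
  congruent terms.\<close>

lemma lattice_ideal_iff: "p \<in> lattice_ideal A \<longleftrightarrow> (\<forall>x. class_sum A x p = 0)"
proof
  have "binomial_of a \<in> {p. \<forall>x. class_sum A x p = 0}" if "a \<in> A" for a
  proof -
    have "bcong A (pos_exponent a) (pos_exponent (- a))" using bcong_base[OF that, of 0] by simp
    then have "bcong A (pos_exponent a) x \<longleftrightarrow> bcong A (pos_exponent (- a)) x" for x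
      by (meson bcong_sym bcong_trans)
    then show ?thesis by (simp add: binomial_of_def class_sum_diff)
  qed
  then have "lattice_ideal A \<subseteq> {p. \<forall>x. class_sum A x p = 0}"
    unfolding lattice_ideal_def by (intro genideal_type_minimal[OF ideal_class_sum_kernel]) auto
  then show "p \<in> lattice_ideal A \<Longrightarrow> \<forall>x. class_sum A x p = 0" by blast
next
  assume p: "\<forall>x. class_sum A x p = 0"
  have add: "additive_map (Poly_Mapping.single 0 :: 'b \<Rightarrow> ('a, 'b) mpoly)"
    by unfold_locales (simp add: single_add)
  have "mpoly_ext (Poly_Mapping.single 0) (\<lambda>m. Poly_Mapping.single (class_rep A m) 1) p = (0 :: ('a, 'b) mpoly)"
  proof (rule mpoly_ext_class_invariant[OF add])
    show "class_sum A x p = 0" for x using p by blast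
    fix m n assume "bcong A m n"
    then have "class_rep A m = class_rep A n" by (simp add: class_rep_eq_iff)
    then show "Poly_Mapping.single (class_rep A m) (1 :: 'b) = Poly_Mapping.single (class_rep A n) 1" by simp
  qed
  then have "(\<Sum>m\<in>Poly_Mapping.keys p. Poly_Mapping.single (class_rep A m) (Poly_Mapping.lookup p m)) = 0"
    by (simp add: mpoly_ext_def mult_single)
  then have "p = (\<Sum>m\<in>Poly_Mapping.keys p. Poly_Mapping.single m (Poly_Mapping.lookup p m)
      - Poly_Mapping.single (class_rep A m) (Poly_Mapping.lookup p m))"
    using mpoly_sum_single[of p] by (simp add: sum_subtractf)
  also have "\<dots> \<in> lattice_ideal A"
    by (rule ideal_sum[OF ideal_lattice_ideal], rule monomial_diff_mem, rule bcong_sym, rule bcong_class_rep)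
  finally show "p \<in> lattice_ideal A" .
qed

lemma monomial_diff_mem_iff:
  "Poly_Mapping.single m (1::'k::comm_ring_1) - Poly_Mapping.single n 1 \<in> lattice_ideal A \<longleftrightarrow> bcong A m n"
proof
  assume "Poly_Mapping.single m (1::'k) - Poly_Mapping.single n 1 \<in> lattice_ideal A"
  then have "class_sum A n (Poly_Mapping.single m (1::'k) - Poly_Mapping.single n 1) = 0"
    by (simp add: lattice_ideal_iff)
  then show "bcong A m n" 
    unfolding class_sum_diff class_sum_single by (simp add: bcong_refl of_bool_def split: if_splits)
qed (rule monomial_diff_mem)

lemma lattice_ideal_mono:
  "A \<subseteq> B \<Longrightarrow> (lattice_ideal A :: ('v::finite, 'k::comm_ring_1) mpoly set) \<subseteq> lattice_ideal B"
  unfolding lattice_ideal_def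
  using genideal_type_self[of "binomial_of ` B :: ('v, 'k) mpoly set"]
  by (intro genideal_type_minimal genideal_type_ideal) blast

section \<open>The affine Hilbert function\<close>

lemma mpoly_deg_le_iff: "p \<in> mpoly_deg_le d \<longleftrightarrow> (\<forall>m\<in>Poly_Mapping.keys p. exp_deg m \<le> d)"
  by (simp add: mpoly_deg_le_def exp_deg_def)

lemma mpoly_deg_le_zero: "0 \<in> mpoly_deg_le d"
  by (simp add: mpoly_deg_le_iff)

lemma mpoly_deg_le_add: "p \<in> mpoly_deg_le d \<Longrightarrow> q \<in> mpoly_deg_le d \<Longrightarrow> p + q \<in> mpoly_deg_le d"
  unfolding mpoly_deg_le_iff using Poly_Mapping.keys_add[of p q] by blast

lemma mpoly_deg_le_mult:
  "p \<in> mpoly_deg_le d \<Longrightarrow> q \<in> mpoly_deg_le e \<Longrightarrow> p * q \<in> mpoly_deg_le (d + e)"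
  unfolding mpoly_deg_le_iff using keys_mult[of p q]
  by (fastforce simp: exp_deg_add intro: add_mono)

lemma mpoly_deg_le_mono: "p \<in> mpoly_deg_le d \<Longrightarrow> d \<le> e \<Longrightarrow> p \<in> mpoly_deg_le e"
  unfolding mpoly_deg_le_iff by force

lemma mpoly_deg_le_one: "1 \<in> mpoly_deg_le d"
  by (simp add: mpoly_deg_le_iff)

lemma mpoly_deg_le_power: "p \<in> mpoly_deg_le d \<Longrightarrow> p ^ n \<in> mpoly_deg_le (n * d)"
  by (induction n) (auto simp: mpoly_deg_le_one mpoly_deg_le_mult)

lemma mpoly_deg_le_sum: "(\<And>t. t \<in> T \<Longrightarrow> f t \<in> mpoly_deg_le d) \<Longrightarrow> sum f T \<in> mpoly_deg_le d"
  by (induction T rule: infinite_finite_induct) (auto simp: mpoly_deg_le_zero mpoly_deg_le_add)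

lemma mpoly_deg_le_scale: "p \<in> mpoly_deg_le d \<Longrightarrow> mpoly_scale c p \<in> mpoly_deg_le d"
  using mpoly_deg_le_mult[of "Poly_Mapping.single 0 c" 0 p d]
  by (auto simp: mpoly_scale_def mpoly_deg_le_iff)

lemma mpoly_deg_le_single: "exp_deg m \<le> d \<Longrightarrow> Poly_Mapping.single m c \<in> mpoly_deg_le d"
  by (simp add: mpoly_deg_le_iff)

lemma ex_mpoly_deg_le: "\<exists>d. p \<in> mpoly_deg_le d"
  by (rule exI[of _ "\<Sum>m\<in>Poly_Mapping.keys p. exp_deg m"])
    (auto simp: mpoly_deg_le_iff intro: member_le_sum)

lemma scaled_quotient_mpoly:
  fixes J :: "('v::finite, 'k::field) mpoly set"
  assumes "ideal J mpoly_ring"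
  shows "scaled_quotient mpoly_scale (mpoly_deg_le d) (J \<inter> mpoly_deg_le d)"
proof
  fix a b :: 'k and x y :: "('v, 'k) mpoly"
  show "mpoly_scale a (mpoly_scale b x) = mpoly_scale (a * b) x"
    by (simp add: mpoly_scale_def mult.assoc[symmetric] mult_single)
qed (auto simp: mpoly_scale_def ring_distribs single_add
    intro: mpoly_deg_le_zero mpoly_deg_le_add mpoly_deg_le_scale[unfolded mpoly_scale_def]
      ideal_zero[OF assms] ideal_add[OF assms] ideal_mult_left[OF assms])

text \<open>The coefficients are forced: the one at \<open>y\<close> must be the class sum of
  \<open>u\<close> at \<open>y\<close>. Homogeneity keeps the representatives within the degree
  bound.\<close>

lemma basis_modulo_lattice_ideal:
  fixes A :: "(int^'v::finite) set"
  assumes deg: "\<forall>a\<in>A. (\<Sum>i\<in>UNIV. a $ i) = 0"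
  shows "basis_modulo mpoly_scale (mpoly_deg_le d :: ('v, 'k::field) mpoly set)
    (lattice_ideal A \<inter> mpoly_deg_le d)
    ((\<lambda>y. Poly_Mapping.single y 1) ` class_rep A ` {m. exp_deg m \<le> d})"
proof -
  let ?Y = "class_rep A ` {m. exp_deg m \<le> d}"
  let ?t = "\<lambda>y. Poly_Mapping.single y 1 :: ('v, 'k) mpoly"
  have fin: "finite ?Y" using finite_exp_deg_le by blast
  have inj: "inj_on ?t ?Y"
    by (rule inj_onI) (metis keys_single singleton_insert_inj_eq' zero_neq_one)
  have degY: "exp_deg y \<le> d" if "y \<in> ?Y" for y
    using that bcong_exp_deg[OF deg bcong_class_rep] by fastforce
  have sumY: "(\<Sum>b\<in>?t ` ?Y. mpoly_scale (c b) b) = (\<Sum>y\<in>?Y. Poly_Mapping.single y (c (?t y)))" for c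
    using inj by (simp add: sum.reindex mpoly_scale_def mult_single)
  have csY: "class_sum A x (\<Sum>b\<in>?t ` ?Y. mpoly_scale (c b) b) =
      (if exp_deg x \<le> d then c (?t (class_rep A x)) else 0)" for c x
  proof -
    have "class_sum A x (\<Sum>b\<in>?t ` ?Y. mpoly_scale (c b) b) =
        (\<Sum>y\<in>?Y. if y = class_rep A x then c (?t y) else 0)"
      unfolding sumY class_sum_sum
    proof (rule sum.cong)
      fix y assume "y \<in> ?Y"
      then have "bcong A y x \<longleftrightarrow> y = class_rep A x"
        by (auto simp: class_rep_eq_iff[symmetric])
      then show "class_sum A x (Poly_Mapping.single y (c (?t y))) = (if y = class_rep A x then c (?t y) else 0)"
        by simp
    qed simp
    also have "\<dots> = (if class_rep A x \<in> ?Y then c (?t (class_rep A x)) else 0)"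
      using fin by (simp add: sum.delta)
    also have "class_rep A x \<in> ?Y \<longleftrightarrow> exp_deg x \<le> d"
      using degY[of "class_rep A x"] bcong_exp_deg[OF deg bcong_class_rep, of x] by auto
    finally show ?thesis .
  qed
  show ?thesis
    unfolding basis_modulo_def
  proof (intro conjI ballI)
    show "finite (?t ` ?Y)" using fin by simp
    show sub: "?t ` ?Y \<subseteq> mpoly_deg_le d"
      by (rule image_subsetI, rule mpoly_deg_le_single, rule degY)
    fix u :: "('v, 'k) mpoly" assume u: "u \<in> mpoly_deg_le d"
    have diff: "u - (\<Sum>b\<in>?t ` ?Y. mpoly_scale (c b) b) \<in> mpoly_deg_le d" for c
    proof -
      have "(\<Sum>b\<in>?t ` ?Y. mpoly_scale (c b) b) \<in> mpoly_deg_le d"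
        using sub by (intro mpoly_deg_le_sum mpoly_deg_le_scale) auto
      then have "mpoly_scale (- 1) (\<Sum>b\<in>?t ` ?Y. mpoly_scale (c b) b) \<in> mpoly_deg_le d"
        by (rule mpoly_deg_le_scale)
      then have "u + mpoly_scale (- 1) (\<Sum>b\<in>?t ` ?Y. mpoly_scale (c b) b) \<in> mpoly_deg_le d"
        using u by (rule mpoly_deg_le_add[rotated])
      then show ?thesis by (simp add: mpoly_scale_def single_uminus)
    qed
    have mem: "u - (\<Sum>b\<in>?t ` ?Y. mpoly_scale (c b) b) \<in> lattice_ideal A \<inter> mpoly_deg_le d \<longleftrightarrow>
        (\<forall>y\<in>?Y. c (?t y) = class_sum A y u)" (is "?l \<longleftrightarrow> ?r") for c
    proof
      assume ?l
      show ?r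
      proof
        fix y assume y: "y \<in> ?Y"
        then have "class_rep A y = y" by auto
        with \<open>?l\<close> show "c (?t y) = class_sum A y u"
          using degY[OF y] csY[of y c] by (auto simp: lattice_ideal_iff class_sum_diff)
      qed
    next
      assume r: ?r
      have "class_sum A x (u - (\<Sum>b\<in>?t ` ?Y. mpoly_scale (c b) b)) = 0" for x
      proof (cases "exp_deg x \<le> d")
        case True
        then have "c (?t (class_rep A x)) = class_sum A (class_rep A x) u" using r by auto
        then show ?thesis
          using True by (simp add: class_sum_diff csY class_sum_cong[OF bcong_class_rep])
      next
        case False
        have "\<not> bcong A m x" if "m \<in> Poly_Mapping.keys u" for m
          using that u False bcong_exp_deg[OF deg, of m x] by (auto simp: mpoly_deg_le_iff)
        then have "class_sum A x u = 0"
          by (simp add: class_sum_def mpoly_ext_def)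
        then show ?thesis using False by (simp add: class_sum_diff csY)
      qed
      then show ?l using diff by (simp add: lattice_ideal_iff)
    qed
    \<comment> \<open>Taking \<open>the_elem\<close> of the keys recovers the exponent vector from
      the monomial \<open>b\<close>.\<close>
    define c where "c = restrict (\<lambda>b. class_sum A (the_elem (Poly_Mapping.keys b)) u) (?t ` ?Y)"
    show "\<exists>!c. c \<in> ?t ` ?Y \<rightarrow>\<^sub>E UNIV \<and>
        u - (\<Sum>b\<in>?t ` ?Y. mpoly_scale (c b) b) \<in> lattice_ideal A \<inter> mpoly_deg_le d"
      unfolding mem
    proof (rule ex1I[of _ c])
      show "c \<in> ?t ` ?Y \<rightarrow>\<^sub>E UNIV \<and> (\<forall>y\<in>?Y. c (?t y) = class_sum A y u)"
        by (auto simp: c_def)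
    next
      fix c' assume c': "c' \<in> ?t ` ?Y \<rightarrow>\<^sub>E UNIV \<and> (\<forall>y\<in>?Y. c' (?t y) = class_sum A y u)"
      show "c' = c"
      proof (rule ext)
        fix b show "c' b = c b"
        proof (cases "b \<in> ?t ` ?Y")
          case True
          then obtain y where "y \<in> ?Y" "b = ?t y" by blast
          moreover have "c' (?t y) = class_sum A y u" using c' \<open>y \<in> ?Y\<close> by blast
          ultimately show ?thesis by (simp add: c_def)
        next
          case False
          then show ?thesis using c' by (auto simp: c_def PiE_def extensional_def)
        qed
      qed
    qed
  qed
qed

lemma quotient_dim_lattice_ideal:
  fixes A :: "(int^'v::finite) set"
  assumes deg: "\<forall>a\<in>A. (\<Sum>i\<in>UNIV. a $ i) = 0"
  shows "quotient_dim mpoly_scale (mpoly_deg_le d :: ('v, 'k::field) mpoly set)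
      (lattice_ideal A \<inter> mpoly_deg_le d) = card (class_rep A ` {m. exp_deg m \<le> d})"
proof -
  have "inj_on (\<lambda>y. Poly_Mapping.single y 1 :: ('v, 'k) mpoly) (class_rep A ` {m. exp_deg m \<le> d})"
    by (rule inj_onI) (metis keys_single singleton_insert_inj_eq' zero_neq_one)
  then have "card ((\<lambda>y. Poly_Mapping.single y 1 :: ('v, 'k) mpoly) ` class_rep A ` {m. exp_deg m \<le> d}) =
      card (class_rep A ` {m. exp_deg m \<le> d})"
    by (rule card_image)
  with scaled_quotient.quotient_dim_eq_card[OF scaled_quotient_mpoly[OF ideal_lattice_ideal]
      basis_modulo_lattice_ideal[OF deg]]
  show ?thesis by (rule trans)
qed

text \<open>Lets the sizes of two quotients of \<open>S\<close> be compared through their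
  equivalence relations alone.\<close>

lemma card_image_eq_if_same_kernel:
  assumes "\<And>x y. x \<in> S \<Longrightarrow> y \<in> S \<Longrightarrow> f x = f y \<longleftrightarrow> g x = g y"
  shows "card (f ` S) = card (g ` S)"
proof (rule bij_betw_same_card)
  have inv: "g (inv_into S f (f x)) = g x" if "x \<in> S" for x
    using that assms[of "inv_into S f (f x)" x] by (simp add: inv_into_into f_inv_into_f)
  show "bij_betw (\<lambda>z. g (inv_into S f z)) (f ` S) (g ` S)"
    unfolding bij_betw_def
  proof
    show "inj_on (\<lambda>z. g (inv_into S f z)) (f ` S)"
      using assms inv by (auto simp: inj_on_def)
    show "(\<lambda>z. g (inv_into S f z)) ` f ` S = g ` S"
      using inv by (force simp: image_iff)
  qed
qed

lemma exp_split: "n \<le> Poly_Mapping.lookup m j \<Longrightarrow>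
    (m :: 'v \<Rightarrow>\<^sub>0 nat) = Poly_Mapping.single j n + (m - Poly_Mapping.single j n)"
  by (rule poly_mapping_eqI, simp only: lookup_add lookup_minus lookup_single) (auto simp: when_def)

lemma exp_nonzero_split:
  assumes "(m :: 'v \<Rightarrow>\<^sub>0 nat) \<noteq> 0"
  shows "\<exists>i m'. m = Poly_Mapping.single i 1 + m'"
proof -
  obtain i where "Poly_Mapping.lookup m i \<noteq> 0"
    using assms by (metis lookup_zero poly_mapping_eqI)
  then have "1 \<le> Poly_Mapping.lookup m i" by simp
  then show ?thesis by (intro exI, rule exp_split)
qed

section \<open>Homogeneous binomial ideals of dimension one\<close>

text \<open>The axiom \<open>absorb\<close> is what connectedness of the graph becomes for
  monomials. Both axioms pass from the columns to the group they generate.\<close>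

locale graded_binomials =
  fixes A :: "(int^'v::finite) set"
  assumes deg_zero: "\<forall>a\<in>A. (\<Sum>i\<in>UNIV. a $ i) = 0"
    and absorb: "\<exists>n m. bcong A (Poly_Mapping.single j n) (Poly_Mapping.single i 1 + m)"
begin

lemmas cong_deg = bcong_exp_deg[OF deg_zero]

lemma absorb_large:
  "\<exists>N. \<forall>m i. exp_deg m \<ge> N \<longrightarrow> (\<exists>m'. bcong A m (Poly_Mapping.single i 1 + m'))"
proof -
  obtain f where f: "\<And>j i. \<exists>m. bcong A (Poly_Mapping.single j (f j i)) (Poly_Mapping.single i 1 + m)"
    using absorb by metis
  \<comment> \<open>Pigeonhole: if the degree is at least the sum of the thresholds over
    \<open>j\<close>, some coordinate reaches its own threshold. Summing over \<open>i\<close> as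
    well makes one bound serve all variables.\<close>
  have "\<exists>m'. bcong A m (Poly_Mapping.single i 1 + m')" if m: "exp_deg m \<ge> (\<Sum>i\<in>UNIV. \<Sum>j\<in>UNIV. f j i)" for m i
  proof -
    have "(\<Sum>j\<in>UNIV. f j i) \<le> exp_deg m"
      using member_le_sum[of i UNIV "\<lambda>i. \<Sum>j\<in>UNIV. f j i"] m by simp
    then have "\<exists>j. f j i \<le> Poly_Mapping.lookup m j"
      using sum_strict_mono[of UNIV "Poly_Mapping.lookup m" "\<lambda>j. f j i"]
      by (force simp: exp_deg_def not_le)
    then obtain j where j: "f j i \<le> Poly_Mapping.lookup m j" by blast
    obtain m' where m': "bcong A (Poly_Mapping.single j (f j i)) (Poly_Mapping.single i 1 + m')" using f by blast
    have "bcong A (Poly_Mapping.single j (f j i) + (m - Poly_Mapping.single j (f j i)))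
        (Poly_Mapping.single i 1 + m' + (m - Poly_Mapping.single j (f j i)))"
      by (rule bcong_add[OF m' bcong_refl])
    then show ?thesis using exp_split[OF j] by (auto simp: add.assoc)
  qed
  then show ?thesis by blast
qed

definition hilb :: "nat \<Rightarrow> nat" where
  "hilb d = card (class_rep A ` {m. exp_deg m = d})"

definition hilb_sum :: "nat \<Rightarrow> nat" where
  "hilb_sum d = card (class_rep A ` {m. exp_deg m \<le> d})"

lemma hilb_sum_Suc: "hilb_sum (Suc d) = hilb_sum d + hilb (Suc d)"
proof -
  have "{m. exp_deg m \<le> Suc d} = {m. exp_deg m \<le> d} \<union> {m :: 'v \<Rightarrow>\<^sub>0 nat. exp_deg m = Suc d}" by auto
  moreover have "class_rep A ` {m. exp_deg m \<le> d} \<inter> class_rep A ` {m. exp_deg m = Suc d} = {}"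
    by (auto simp: class_rep_eq_iff dest!: cong_deg)
  ultimately show ?thesis
    unfolding hilb_sum_def hilb_def
    by (simp add: image_Un card_Un_disjoint finite_exp_deg_le finite_exp_deg_eq)
qed

lemma image_class_rep_Suc:
  assumes "\<And>m. exp_deg m = Suc d \<Longrightarrow> \<exists>m'. bcong A m (Poly_Mapping.single i 1 + m')"
  shows "class_rep A ` {m. exp_deg m = Suc d}
    \<subseteq> (\<lambda>y. class_rep A (Poly_Mapping.single i 1 + y)) ` class_rep A ` {m. exp_deg m = d}"
proof
  fix z assume "z \<in> class_rep A ` {m. exp_deg m = Suc d}"
  then obtain m where m: "exp_deg m = Suc d" "z = class_rep A m" by blast
  then obtain m' where m': "bcong A m (Poly_Mapping.single i 1 + m')" using assms by blast
  then have "exp_deg m' = d" using cong_deg[OF m'] m by (simp add: exp_deg_add)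
  moreover have "class_rep A (Poly_Mapping.single i 1 + class_rep A m') = z"
    unfolding m(2) class_rep_eq_iff
    using m' bcong_add_left[OF bcong_class_rep, of A "Poly_Mapping.single i 1" m']
    by (meson bcong_sym bcong_trans)
  ultimately show "z \<in> (\<lambda>y. class_rep A (Poly_Mapping.single i 1 + y)) ` class_rep A ` {m. exp_deg m = d}"
    by blast
qed

text \<open>One threshold covers both eventual phenomena, so that later statements carry a single
  \<open>N\<close>. The constant \<open>\<kappa>\<close> turns out to be the degree.\<close>

definition stable_from :: "nat \<Rightarrow> nat \<Rightarrow> bool" where
  "stable_from N \<kappa> \<longleftrightarrow> (\<forall>d\<ge>N. hilb d = \<kappa>) \<and>
    (\<forall>m i. exp_deg m \<ge> N \<longrightarrow> (\<exists>m'. bcong A m (Poly_Mapping.single i 1 + m')))"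

lemma ex_stable_from: "\<exists>N \<kappa>. stable_from N \<kappa>"
proof -
  obtain N where N: "\<And>m i. exp_deg m \<ge> N \<Longrightarrow> \<exists>m'. bcong A m (Poly_Mapping.single i 1 + m')"
    using absorb_large by blast
  have Suc_le: "hilb (Suc d) \<le> hilb d" if "N \<le> d" for d
  proof -
    have sub: "class_rep A ` {m. exp_deg m = Suc d}
        \<subseteq> (\<lambda>y. class_rep A (Poly_Mapping.single i 1 + y)) ` class_rep A ` {m. exp_deg m = d}" for i
      using N that by (intro image_class_rep_Suc) simp
    \<comment> \<open>Here and below \<open>undefined\<close> is just some vertex.\<close>
    have "hilb (Suc d) \<le> card ((\<lambda>y. class_rep A (Poly_Mapping.single undefined 1 + y)) ` class_rep A ` {m. exp_deg m = d})"
      unfolding hilb_def by (rule card_mono[OF _ sub]) (simp add: finite_exp_deg_eq)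
    also have "\<dots> \<le> hilb d"
      unfolding hilb_def by (rule card_image_le) (simp add: finite_exp_deg_eq)
    finally show ?thesis .
  qed
  \<comment> \<open>A place where the least value is attained; from there on a nonincreasing
    sequence is constant.\<close>
  obtain M where M: "M \<ge> N" "\<And>d. d \<ge> N \<Longrightarrow> hilb M \<le> hilb d"
    using ex_has_least_nat[of "\<lambda>d. d \<ge> N" N hilb] by auto
  have "hilb d \<le> hilb M" if "M \<le> d" for d
    using that
  proof (induction d rule: dec_induct)
    case (step n)
    then show ?case using Suc_le[of n] M(1) by simp
  qed simp
  moreover have "hilb M \<le> hilb d" if "M \<le> d" for d using M that by simp
  ultimately have "\<forall>d\<ge>M. hilb d = hilb M" using le_antisym by blast
  then have "stable_from M (hilb M)"
    unfolding stable_from_def using M(1) N le_trans by blast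
  then show ?thesis by blast
qed

lemma stable_absorb:
  "stable_from N \<kappa> \<Longrightarrow> exp_deg m \<ge> N \<Longrightarrow> \<exists>m'. bcong A m (Poly_Mapping.single i 1 + m')"
  unfolding stable_from_def by blast

text \<open>
  Multiplication by $t_i$ maps the classes of degree $d$ onto those of degree $d + 1$. The number of
  classes is therefore nonincreasing, eventually constant, and from then on the map is injective.
\<close>

lemma cancel_single:
  assumes st: "stable_from N \<kappa>" and x: "exp_deg x \<ge> N"
    and xy: "bcong A (Poly_Mapping.single i 1 + x) (Poly_Mapping.single i 1 + y)"
  shows "bcong A x y"
proof -
  define d where "d = exp_deg x"
  have y: "exp_deg y = d" using cong_deg[OF xy] by (simp add: exp_deg_add d_def)
  let ?Y = "class_rep A ` {m. exp_deg m = d}" and ?g = "\<lambda>y. class_rep A (Poly_Mapping.single i 1 + y)"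
  have "hilb (Suc d) \<le> card (?g ` ?Y)"
    unfolding hilb_def
  proof (rule card_mono)
    show "class_rep A ` {m. exp_deg m = Suc d} \<subseteq> ?g ` ?Y"
      using stable_absorb[OF st] x by (intro image_class_rep_Suc) (simp add: d_def)
  qed (simp add: finite_exp_deg_eq)
  moreover have "hilb (Suc d) = card ?Y"
    using st x unfolding stable_from_def hilb_def[symmetric] d_def by simp
  moreover have "card (?g ` ?Y) \<le> card ?Y"
    by (rule card_image_le) (simp add: finite_exp_deg_eq)
  ultimately have "inj_on ?g ?Y"
    by (intro eq_card_imp_inj_on) (simp_all add: finite_exp_deg_eq)
  moreover have g: "?g (class_rep A z) = class_rep A (Poly_Mapping.single i 1 + z)" for z
    unfolding class_rep_eq_iff by (rule bcong_add_left, rule bcong_class_rep)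
  moreover have "?g (class_rep A x) = ?g (class_rep A y)"
    unfolding g using xy by (simp only: class_rep_eq_iff)
  moreover have "class_rep A x \<in> ?Y" "class_rep A y \<in> ?Y" using y by (auto simp: d_def)
  ultimately have "class_rep A x = class_rep A y" by (blast dest: inj_onD)
  then show ?thesis by (simp add: class_rep_eq_iff)
qed

lemma cancel_add:
  assumes st: "stable_from N \<kappa>"
  shows "exp_deg x \<ge> N \<Longrightarrow> bcong A (c + x) (c + y) \<Longrightarrow> bcong A x y"
proof (induction "exp_deg c" arbitrary: c)
  case 0
  then show ?case by (simp add: exp_deg_eq_0_iff)
next
  case (Suc n)
  then have "c \<noteq> 0" by auto
  then obtain i c' where c: "c = Poly_Mapping.single i 1 + c'" using exp_nonzero_split by blast
  have "bcong A (Poly_Mapping.single i 1 + (c' + x)) (Poly_Mapping.single i 1 + (c' + y))"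
    using Suc.prems(2) unfolding c by (simp only: add.assoc)
  then have "bcong A (c' + x) (c' + y)"
    by (rule cancel_single[OF st, rotated]) (use Suc.prems(1) in \<open>simp add: exp_deg_add\<close>)
  moreover have "n = exp_deg c'" using Suc.hyps(2) by (simp add: c exp_deg_add)
  ultimately show ?case using Suc.hyps(1)[of c'] Suc.prems(1) by blast
qed

end

section \<open>Lattice congruence versus binomial congruence\<close>

lemma subgroup_generate: "subgroup (generate int_vec_group A) int_vec_group"
  by (rule group.generate_is_subgroup[OF group_int_vec_group]) simp

text \<open>A sum of generators may lead through vectors with negative entries; multiplying both
  monomials by a common \<open>c\<close> pays these debts.\<close>

lemma generate_cong:
  assumes "a \<in> generate int_vec_group A" "exp_vec x - exp_vec y = a"
  shows "\<exists>c. bcong A (c + x) (c + y)"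
  using assms
proof (induction arbitrary: x y rule: generate.induct)
  case one
  then have "x = y" by (simp add: exp_vec_inject)
  then show ?case by (auto intro: bcong_refl)
next
  case (incl a)
  obtain c where "x = c + pos_exponent a" "y = c + pos_exponent (- a)"
    using exp_vec_diff_split[OF incl.prems] by blast
  then have "bcong A (0 + x) (0 + y)" using bcong_base[OF incl.hyps, of c] by simp
  then show ?case by blast
next
  case (inv a)
  then have "exp_vec y - exp_vec x = a" by (simp add: algebra_simps)
  then obtain c where "y = c + pos_exponent a" "x = c + pos_exponent (- a)"
    using exp_vec_diff_split by blast
  then have "bcong A (0 + x) (0 + y)" using bcong_sym[OF bcong_base[OF inv.hyps, of c]] by simp
  then show ?case by blast
next
  case (eng h h')
  \<comment> \<open>The midpoint \<open>x - h\<close> may have negative entries. After a shift by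
    the positive part of \<open>h\<close> it becomes \<open>x\<close> plus the negative part of
    \<open>h\<close>.\<close>
  define v where "v = pos_exponent h"
  define u where "u = x + pos_exponent (- h)"
  have v: "exp_vec (pos_exponent h) = exp_vec (pos_exponent (- h)) + h"
    using exp_vec_pos_exponent[of h] by (simp add: algebra_simps)
  have "exp_vec (x + v) - exp_vec u = h"
    by (simp add: u_def v_def exp_vec_add v)
  then obtain c where c: "bcong A (c + (x + v)) (c + u)" using eng.IH(1) by blast
  have "exp_vec u - exp_vec (y + v) = h'"
    using eng.prems by (simp add: u_def v_def exp_vec_add v algebra_simps)
  then obtain c' where c': "bcong A (c' + u) (c' + (y + v))" using eng.IH(2) by blast
  have "bcong A (c' + (c + (x + v))) (c' + (c + u))" using c by (rule bcong_add_left)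
  moreover have "bcong A (c + (c' + u)) (c + (c' + (y + v)))" using c' by (rule bcong_add_left)
  ultimately have "bcong A (c' + (c + (x + v))) (c + (c' + (y + v)))"
    by (simp add: add.left_commute) (rule bcong_trans)
  then have "bcong A ((c + c' + v) + x) ((c + c' + v) + y)"
    by (simp add: ac_simps)
  then show ?case by blast
qed

context graded_binomials
begin

abbreviation lattice :: "(int^'v) set" where
  "lattice \<equiv> generate int_vec_group A"

lemma subset_lattice: "A \<subseteq> lattice"
  by (auto intro: generate.incl)

lemma lattice_cong_iff: "bcong lattice m n \<longleftrightarrow> exp_vec m - exp_vec n \<in> lattice"
  by (rule bcong_lattice_iff[OF subgroup_generate])

lemma graded_binomials_lattice: "graded_binomials lattice"
proof
  show "\<exists>n m. bcong lattice (Poly_Mapping.single j n) (Poly_Mapping.single i 1 + m)" for i j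
    using absorb bcong_mono[OF _ subset_lattice] by blast
  have "(\<Sum>i\<in>UNIV. a $ i) = 0" if "a \<in> lattice" for a :: "int^'v"
    using that by (induction rule: generate.induct) (use deg_zero in \<open>auto simp: sum.distrib sum_negf\<close>)
  then show "\<forall>a\<in>lattice. (\<Sum>i\<in>UNIV. a $ i) = 0" by blast
qed

lemma lattice_cong_large:
  assumes "stable_from N \<kappa>" "exp_deg m \<ge> N" 
  shows "bcong lattice m n \<longleftrightarrow> bcong A m n"
proof
  assume "bcong lattice m n"
  then obtain c where "bcong A (c + m) (c + n)"
    using generate_cong lattice_cong_iff by blast
  then show "bcong A m n" using cancel_add[OF assms] by blast
qed (rule bcong_mono[OF _ subset_lattice])

lemma hilb_sum_stable:
  assumes "stable_from N \<kappa>"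
  shows "hilb_sum (N + d) = hilb_sum N + \<kappa> * d"
proof (induction d)
  case (Suc d)
  have "hilb (Suc (N + d)) = \<kappa>" using assms unfolding stable_from_def by simp
  then show ?case using Suc hilb_sum_Suc[of "N + d"] by simp
qed simp

lemma hilb_sum_mono: "d \<le> e \<Longrightarrow> hilb_sum d \<le> hilb_sum e"
  unfolding hilb_sum_def by (intro card_mono image_mono) (auto simp: finite_exp_deg_le)

lemma hilb_sum_le:
  assumes "stable_from N \<kappa>"
  shows "hilb_sum d \<le> \<kappa> * d + hilb_sum N"
proof -
  have "hilb_sum d \<le> hilb_sum (N + d)" by (rule hilb_sum_mono) simp
  then show ?thesis using hilb_sum_stable[OF assms] by simp
qed

lemma hilb_sum_tendsto:
  assumes "stable_from N \<kappa>"
  shows "(\<lambda>d. real (hilb_sum d) / real d) \<longlonglongrightarrow> real \<kappa>"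
proof (rule Lim_transform_eventually)
  define c where "c = real (hilb_sum N) - real \<kappa> * real N"
  have "(\<lambda>d. real \<kappa> + c / real d) \<longlonglongrightarrow> real \<kappa> + 0"
    by (intro tendsto_add tendsto_const lim_const_over_n)
  then show "(\<lambda>d. real \<kappa> + c / real d) \<longlonglongrightarrow> real \<kappa>" by simp
  show "\<forall>\<^sub>F d in sequentially. real \<kappa> + c / real d = real (hilb_sum d) / real d"
    using eventually_ge_at_top[of "Suc N"]
  proof eventually_elim
    case (elim d)
    then obtain k where "d = N + k" "d > 0" by (metis Suc_le_eq le_add_diff_inverse less_imp_le_nat gr0I not_less0)
    moreover from this have "real N + real k \<noteq> 0" by linarith
    ultimately show ?case using hilb_sum_stable[OF assms, of k] by (simp add: c_def field_simps)
  qed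
qed

text \<open>
  The products $f_k g^j$ with $k < r$ and $j < M$ have degree at most $D + M e$, where $e$ bounds the
  degree of $g$, while the quotient has dimension at most $\kappa (D + M e) + O(1)$ in these
  degrees. So $r = \kappa e + 1$ forces a relation once $M$ is large.
\<close>

lemma dependent_mod_ideal:
  fixes g :: "('v, 'k::field) mpoly"
  shows "\<exists>r. \<forall>f :: nat \<Rightarrow> ('v, 'k) mpoly. \<exists>a M. (\<exists>k<r. \<exists>j<M. a k j \<noteq> 0) \<and>
    (\<Sum>k<r. \<Sum>j<M. mpoly_scale (a k j) (f k * g ^ j)) \<in> lattice_ideal A"
proof -
  obtain N \<kappa> where st: "stable_from N \<kappa>" using ex_stable_from by blast
  obtain e where e: "g \<in> mpoly_deg_le e" using ex_mpoly_deg_le by blast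
  let ?r = "\<kappa> * e + 1"
  have "\<exists>a M. (\<exists>k<?r. \<exists>j<M. a k j \<noteq> 0) \<and>
    (\<Sum>k<?r. \<Sum>j<M. mpoly_scale (a k j) (f k * g ^ j)) \<in> lattice_ideal A" for f :: "nat \<Rightarrow> ('v, 'k) mpoly"
  proof -
    obtain d where d: "f k \<in> mpoly_deg_le (d k)" for k
      by (rule that[of "\<lambda>k. SOME d. f k \<in> mpoly_deg_le d"], rule someI_ex, rule ex_mpoly_deg_le)
    define D where "D = (\<Sum>k<?r. d k)"
    have D: "f k \<in> mpoly_deg_le D" if "k < ?r" for k
      using mpoly_deg_le_mono[OF d[of k]] member_le_sum[of k "{..<?r}" d] that by (simp add: D_def)
    \<comment> \<open>There are \<open>?r * M = \<kappa> * e * M + M\<close> products against at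
      most \<open>\<kappa> * (D + M * e) + hilb_sum N\<close> dimensions, and this is the least
      \<open>M\<close> for which the first number is larger.\<close>
    define M where "M = \<kappa> * D + hilb_sum N + 1"
    let ?U = "mpoly_deg_le (D + M * e) :: ('v, 'k) mpoly set"
    let ?W = "lattice_ideal A \<inter> ?U"
    interpret scaled_quotient mpoly_scale ?U ?W
      by (rule scaled_quotient_mpoly[OF ideal_lattice_ideal])
    let ?F = "(\<lambda>y. Poly_Mapping.single y 1 :: ('v, 'k) mpoly) ` class_rep A ` {m. exp_deg m \<le> D + M * e}"
    have "card ?F \<le> hilb_sum (D + M * e)"
      unfolding hilb_sum_def by (rule card_image_le) (simp add: finite_exp_deg_le)
    also have "\<dots> \<le> \<kappa> * (D + M * e) + hilb_sum N" by (rule hilb_sum_le[OF st])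
    also have "\<dots> < ?r * M" by (simp add: M_def algebra_simps)
    finally have card: "card ?F < card ({..<?r} \<times> {..<M})" by simp
    have B: "basis_modulo mpoly_scale ?U ?W ?F" by (rule basis_modulo_lattice_ideal[OF deg_zero])
    have "\<exists>a. (\<exists>t\<in>{..<?r} \<times> {..<M}. a t \<noteq> 0) \<and>
        (\<Sum>t\<in>{..<?r} \<times> {..<M}. mpoly_scale (a t) (f (fst t) * g ^ snd t)) \<in> ?W"
    proof (rule dependent_modulo[OF _ _ card])
      show "\<exists>c. u - (\<Sum>b\<in>?F. mpoly_scale (c b) b) \<in> ?W" if "u \<in> ?U" for u
        using bspec[OF conjunct2[OF conjunct2[OF B[unfolded basis_modulo_def]]] that]
        by (elim ex1E conjE) (rule exI)
      fix t assume "t \<in> {..<?r} \<times> {..<M}"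
      then have t: "fst t < ?r" "snd t \<le> M" by auto
      have "g ^ snd t \<in> mpoly_deg_le (M * e)"
        by (rule mpoly_deg_le_mono[OF mpoly_deg_le_power[OF e]]) (simp add: t)
      then show "f (fst t) * g ^ snd t \<in> ?U" by (intro mpoly_deg_le_mult D t)
    qed (simp_all add: finite_exp_deg_le)
    then obtain a where a: "\<exists>t\<in>{..<?r} \<times> {..<M}. a t \<noteq> 0"
      "(\<Sum>t\<in>{..<?r} \<times> {..<M}. mpoly_scale (a t) (f (fst t) * g ^ snd t)) \<in> ?W" by blast
    from a(1) have "\<exists>k<?r. \<exists>j<M. a (k, j) \<noteq> 0" by auto
    moreover have "(\<Sum>k<?r. \<Sum>j<M. mpoly_scale (a (k, j)) (f k * g ^ j)) \<in> lattice_ideal A"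
      using a(2) unfolding sum.cartesian_product by (simp add: case_prod_beta)
    ultimately show ?thesis by (intro exI[of _ "\<lambda>k j. a (k, j)"] exI[of _ M]) simp
  qed
  then show ?thesis by blast
qed

end

text \<open>Factoring the lowest marked power of \<open>f\<close> out of the relation and cancelling
  it modulo \<open>P\<close> leaves \<open>b n\<close> plus a multiple of \<open>f\<close>, an
  element of \<open>P'\<close>. The predicate \<open>Z\<close> marks formally nonzero coefficients:
  when \<open>b k\<close> is a polynomial expression in some \<open>g\<close>, its scalars have to
  be remembered even if its value is 0.\<close>

lemma lowest_coefficient_mem:
  fixes P :: "'a::comm_ring_1 set"
  assumes P: "primeideal P ring_of_type_algebra" and P': "ideal P' ring_of_type_algebra" "P \<subseteq> P'"
    and f: "f \<in> P'" "f \<notin> P" and sum: "(\<Sum>k<r. b k * f ^ k) \<in> P"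
    and Z: "\<exists>k<r. Z k" "\<And>k. \<not> Z k \<Longrightarrow> b k = 0"
  shows "\<exists>k<r. Z k \<and> b k \<in> P'"
proof -
  define n where "n = (LEAST k. k < r \<and> Z k)"
  have n: "n < r" "Z n"
    using LeastI_ex[of "\<lambda>k. k < r \<and> Z k"] Z(1) unfolding n_def by blast+
  have zero: "b k = 0" if "k < n" for k
    using not_less_Least[of k "\<lambda>k. k < r \<and> Z k"] that n(1) Z(2)[of k] unfolding n_def by auto
  have "(\<Sum>k<r. b k * f ^ k) = (\<Sum>k\<in>{n..<r}. b k * f ^ k)"
    by (rule sum.mono_neutral_right) (auto simp: zero)
  also have "\<dots> = b n * f ^ n + (\<Sum>k\<in>{Suc n..<r}. b k * f ^ k)"
    using n(1) by (rule sum.atLeast_Suc_lessThan)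
  also have "(\<Sum>k\<in>{Suc n..<r}. b k * f ^ k) = f ^ n * (f * (\<Sum>k\<in>{Suc n..<r}. b k * f ^ (k - Suc n)))"
    unfolding sum_distrib_left
  proof (rule sum.cong)
    fix k assume "k \<in> {Suc n..<r}"
    then have "f ^ k = f ^ n * (f * f ^ (k - Suc n))"
      by (metis atLeastLessThan_iff le_add_diff_inverse power_Suc power_add power_commutes mult.assoc)
    then show "b k * f ^ k = f ^ n * (f * (b k * f ^ (k - Suc n)))" by (simp add: mult_ac)
  qed simp
  finally have "f ^ n * (b n + f * (\<Sum>k\<in>{Suc n..<r}. b k * f ^ (k - Suc n))) \<in> P"
    using sum by (simp add: algebra_simps)
  then have "b n + f * (\<Sum>k\<in>{Suc n..<r}. b k * f ^ (k - Suc n)) \<in> P'"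
    using P prime_power_mem[OF P, of f n] f(2) P'(2) unfolding primeideal_type_iff by blast
  then have "b n \<in> P'"
    using ideal_add_cancel[OF P'(1) ideal_mult_right[OF P'(1) f(1)]] by (simp add: add.commute)
  then show ?thesis using n by blast
qed

context graded_binomials
begin

text \<open>
  This replaces integrality over $K[t_i]$: the larger of two primes meets $K[g]$ for every $g$.
\<close>

lemma prime_step:
  fixes P P' :: "('v, 'k::field) mpoly set"
  assumes P: "primeideal P mpoly_ring" and P': "primeideal P' mpoly_ring"
    and sub: "lattice_ideal A \<subseteq> P" "P \<subset> P'"
  shows "\<exists>a M. (\<exists>j<M. a j \<noteq> 0) \<and> (\<Sum>j<M. mpoly_scale (a j) (g ^ j)) \<in> P'"
proof -
  obtain f where f: "f \<in> P'" "f \<notin> P" using sub by blast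
  obtain r where r: "\<forall>f :: nat \<Rightarrow> ('v, 'k) mpoly. \<exists>a M. (\<exists>k<r. \<exists>j<M. a k j \<noteq> 0) \<and>
      (\<Sum>k<r. \<Sum>j<M. mpoly_scale (a k j) (f k * g ^ j)) \<in> lattice_ideal A"
    using dependent_mod_ideal[of g] by (elim exE)
  obtain a M where "(\<exists>k<r. \<exists>j<M. a k j \<noteq> 0) \<and>
    (\<Sum>k<r. \<Sum>j<M. mpoly_scale (a k j) (f ^ k * g ^ j)) \<in> lattice_ideal A"
    using spec[OF r, of "\<lambda>k. f ^ k"] by (elim exE)
  then have a: "\<exists>k<r. \<exists>j<M. a k j \<noteq> 0"
    "(\<Sum>k<r. \<Sum>j<M. mpoly_scale (a k j) (f ^ k * g ^ j)) \<in> lattice_ideal A"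
    by simp_all
  have "(\<Sum>k<r. (\<Sum>j<M. mpoly_scale (a k j) (g ^ j)) * f ^ k) =
      (\<Sum>k<r. \<Sum>j<M. mpoly_scale (a k j) (f ^ k * g ^ j))"
    by (simp add: sum_distrib_left sum_distrib_right mpoly_scale_def mult_ac)
  with a(2) sub have "(\<Sum>k<r. (\<Sum>j<M. mpoly_scale (a k j) (g ^ j)) * f ^ k) \<in> P" by auto
  with a(1) P' sub f have "\<exists>k<r. (\<exists>j<M. a k j \<noteq> 0) \<and> (\<Sum>j<M. mpoly_scale (a k j) (g ^ j)) \<in> P'"
    by (intro lowest_coefficient_mem[OF P]) (auto simp: primeideal_type_iff mpoly_scale_def)
  then show ?thesis by blast
qed

text \<open>For \<open>g\<close> in \<open>R\<close> but not in \<open>Q\<close>, the first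
  inclusion puts a nonzero polynomial in \<open>g\<close> into \<open>Q\<close>. The
  lowest-coefficient argument across the second inclusion then puts a nonzero scalar into
  \<open>R\<close>.\<close>

lemma no_prime_chain:
  fixes P Q R :: "('v, 'k::field) mpoly set"
  assumes "primeideal P mpoly_ring" "primeideal Q mpoly_ring" "primeideal R mpoly_ring"
    and "lattice_ideal A \<subseteq> P" "P \<subset> Q" "Q \<subset> R"
  shows False
proof -
  obtain g where g: "g \<in> R" "g \<notin> Q" using assms by blast
  obtain a M where a: "\<exists>j<M. a j \<noteq> 0" "(\<Sum>j<M. mpoly_scale (a j) (g ^ j)) \<in> Q"
    using prime_step[OF assms(1,2,4,5), of g] by blast
  have R: "ideal R mpoly_ring" using assms(3) by (simp add: primeideal_type_iff)
  have "\<exists>j<M. a j \<noteq> 0 \<and> Poly_Mapping.single 0 (a j) \<in> R"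
    using a assms(6) by (intro lowest_coefficient_mem[OF assms(2) R _ g]) (auto simp: mpoly_scale_def)
  then obtain j where "a j \<noteq> 0" "Poly_Mapping.single 0 (a j) \<in> R" by blast
  then have "Poly_Mapping.single 0 (inverse (a j)) * Poly_Mapping.single 0 (a j) \<in> R" "a j \<noteq> 0"
    by (auto intro: ideal_mult_left[OF R])
  then have "1 \<in> R" by (simp add: mult_single)
  then show False using assms(3) by (simp add: primeideal_type_iff)
qed

end

text \<open>The kernel of substituting one indeterminate for all variables; geometrically the
  diagonal line. It supplies the lower prime of the chain that shows dimension at least one.\<close>

definition deg_kernel :: "('v::finite, 'k::field) mpoly set" where
  "deg_kernel = {p. mpoly_ext (\<lambda>c. [:c:]) (\<lambda>m. monom 1 (exp_deg m)) p = 0}"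

text \<open>The maximal ideal of the origin, presented as the kernel of taking the constant term so
  that the general kernel lemma shows it to be prime.\<close>

definition irrelevant_ideal :: "('v::finite, 'k::field) mpoly set" where
  "irrelevant_ideal = {p. mpoly_ext (\<lambda>c. c) (\<lambda>m. of_bool (m = 0)) p = 0}"

lemma mpoly_ext_constant_term: "mpoly_ext (\<lambda>c. c) (\<lambda>m. of_bool (m = 0)) p = Poly_Mapping.lookup p 0"
  by (simp add: mpoly_ext_def of_bool_def if_distrib sum.delta in_keys_iff cong: if_cong)

lemma irrelevant_ideal_iff: "p \<in> irrelevant_ideal \<longleftrightarrow> Poly_Mapping.lookup p 0 = 0"
  by (simp add: irrelevant_ideal_def mpoly_ext_constant_term)

lemma mpoly_var_irrelevant: "mpoly_var i \<in> irrelevant_ideal"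
  by (simp add: irrelevant_ideal_iff mpoly_var_def lookup_single when_def)
    (metis One_nat_def lookup_single_eq lookup_zero n_not_Suc_n)

lemma primeideal_irrelevant_ideal: "primeideal (irrelevant_ideal :: ('v::finite, 'k::field) mpoly set) mpoly_ring"
  unfolding irrelevant_ideal_def
proof (rule primeideal_mpoly_ext_kernel[OF ring_map_id])
  show "of_bool (m + n = 0) = of_bool (m = 0) * (of_bool (n = 0) :: 'k)" for m n :: "'v \<Rightarrow>\<^sub>0 nat"
    by (simp add: exp_deg_eq_0_iff[symmetric] exp_deg_add)
qed simp_all

lemma primeideal_deg_kernel: "primeideal (deg_kernel :: ('v::finite, 'k::field) mpoly set) mpoly_ring"
  unfolding deg_kernel_def
  by (rule primeideal_mpoly_ext_kernel[OF ring_map_const_poly])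
    (simp_all add: exp_deg_add mult_monom one_pCons)

lemma deg_kernel_psubset: "(deg_kernel :: ('v::finite, 'k::field) mpoly set) \<subset> irrelevant_ideal"
proof
  interpret additive_map "\<lambda>c::'k. [:c:]" by unfold_locales simp
  show "(deg_kernel :: ('v, 'k) mpoly set) \<subseteq> irrelevant_ideal"
  proof
    fix p :: "('v, 'k) mpoly" assume "p \<in> deg_kernel"
    then have "coeff (mpoly_ext (\<lambda>c. [:c:]) (\<lambda>m. monom 1 (exp_deg m)) p) 0 = 0"
      by (simp add: deg_kernel_def)
    also have "coeff (mpoly_ext (\<lambda>c. [:c:]) (\<lambda>m. monom 1 (exp_deg m)) p) 0 =
        (\<Sum>m\<in>Poly_Mapping.keys p. if m = 0 then Poly_Mapping.lookup p m else 0)"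
      unfolding mpoly_ext_def coeff_sum
      by (rule sum.cong) (auto simp: exp_deg_eq_0_iff)
    also have "\<dots> = Poly_Mapping.lookup p 0"
      by (simp add: sum.delta in_keys_iff)
    finally show "p \<in> irrelevant_ideal" by (simp add: irrelevant_ideal_iff)
  qed
  have "mpoly_var undefined \<notin> (deg_kernel :: ('v, 'k) mpoly set)"
    by (simp add: deg_kernel_def mpoly_var_def)
  then show "(deg_kernel :: ('v, 'k) mpoly set) \<noteq> irrelevant_ideal"
    using mpoly_var_irrelevant by blast
qed

section \<open>Dimension one and the degree\<close>

context graded_binomials
begin

lemma lattice_ideal_subset_deg_kernel: "(lattice_ideal A :: ('v, 'k::field) mpoly set) \<subseteq> deg_kernel"
proof
  fix p :: "('v, 'k) mpoly" assume p: "p \<in> lattice_ideal A"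
  interpret ring_map "\<lambda>c::'k. [:c:]" by (rule ring_map_const_poly)
  have "mpoly_ext (\<lambda>c. [:c:]) (\<lambda>m. monom 1 (exp_deg m)) p = 0"
  proof (rule mpoly_ext_class_invariant)
    show "additive_map (\<lambda>c::'k. [:c:])" by (rule additive_map_axioms)
    show "class_sum A x p = 0" for x using p by (simp add: lattice_ideal_iff)
  qed (simp add: cong_deg)
  then show "p \<in> deg_kernel" by (simp add: deg_kernel_def)
qed

lemma krull_dim_lattice_ideal:
  "krull_dim (mpoly_ring Quot (lattice_ideal A :: ('v, 'k::field) mpoly set)) = 1"
  by (rule krull_dim_quot_eq_1[OF ideal_lattice_ideal primeideal_deg_kernel primeideal_irrelevant_ideal
        lattice_ideal_subset_deg_kernel deg_kernel_psubset]) (rule no_prime_chain)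

lemma quotient_degree_lattice_ideal:
  assumes "stable_from N \<kappa>"
  shows "quotient_degree (lattice_ideal A :: ('v, 'k::field) mpoly set) = real \<kappa>"
proof -
  have "the_enat (krull_dim (mpoly_ring Quot (lattice_ideal A :: ('v, 'k) mpoly set))) = 1"
    unfolding krull_dim_lattice_ideal by (simp add: one_enat_def)
  moreover have "lim (\<lambda>d. real (hilb_sum d) / real d) = real \<kappa>"
    using hilb_sum_tendsto[OF assms] by (rule limI)
  ultimately show ?thesis
    unfolding quotient_degree_def
    by (simp add: quotient_dim_lattice_ideal[OF deg_zero] hilb_sum_def)
qed

end

section \<open>Noetherian splitting\<close>

definition saturated :: "'a::comm_ring_1 set \<Rightarrow> 'a set \<Rightarrow> bool" where
  "saturated T J \<longleftrightarrow> (\<forall>a\<in>T. \<forall>f. a * f \<in> J \<longrightarrow> f \<in> J)"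

lemma saturated_Int: "saturated T J \<Longrightarrow> saturated T J' \<Longrightarrow> saturated T (J \<inter> J')"
  unfolding saturated_def by blast

lemma saturated_power:
  assumes "saturated T J" "a \<in> T"
  shows "a ^ n * f \<in> J \<Longrightarrow> f \<in> J"
proof (induction n)
  case (Suc n)
  then have "a * (a ^ n * f) \<in> J" by (simp add: mult.assoc)
  then show ?case using assms Suc.IH unfolding saturated_def by blast
qed simp

lemma saturated_radical_disjoint:
  assumes "saturated T J" "1 \<notin> J" "a \<in> T"
  shows "a \<notin> radical ring_of_type_algebra J"
  using saturated_power[OF assms(1,3), of _ 1] assms(2) by (auto simp: radical_type)

text \<open>
  The Lasker--Noether argument inside the family of $T$-saturated ideals: an ideal $J$ that is not
  primary is the intersection of $J : b^n$ and of the $T$-saturation of $J + (b^n)$.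
\<close>

lemma saturated_primary_decomposition:
  fixes T I :: "'a::comm_ring_1 set"
  defines "S \<equiv> {J. ideal J ring_of_type_algebra \<and> I \<subseteq> J \<and> saturated T J}"
  assumes T: "1 \<in> T" "\<And>a b. a \<in> T \<Longrightarrow> b \<in> T \<Longrightarrow> a * b \<in> T"
    and wf: "wf {(J', J). J \<in> S \<and> J' \<in> S \<and> J \<subset> J'}"
    and J: "J \<in> S"
  shows "\<exists>D. finite D \<and> (\<forall>Q\<in>D. primary_ideal ring_of_type_algebra Q \<and> Q \<in> S) \<and> \<Inter>D = J"
  using wf J
proof (induction J rule: wf_induct_rule)
  case (less J)
  note J = less.prems
  have Ji: "ideal J ring_of_type_algebra" and IJ: "I \<subseteq> J" and sat: "saturated T J"
    using J by (auto simp: S_def)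
  show ?case
  proof (cases "primary_ideal ring_of_type_algebra J")
    case True
    then show ?thesis using J by (intro exI[of _ "{J}"]) auto
  next
    case notprim: False
    show ?thesis
    proof (cases "1 \<in> J")
      case True
      then have "J = UNIV" using ideal_mult_left[OF Ji True] by fastforce
      then show ?thesis by (intro exI[of _ "{}"]) auto
    next
      case False
      then obtain a b where ab: "a * b \<in> J" "a \<notin> J" "b \<notin> radical ring_of_type_algebra J"
        using notprim Ji by (auto simp: primary_type_iff)
      define C where "C n = {f. b ^ n * f \<in> J}" for n
      have C_S: "C n \<in> S" for n
        unfolding S_def mem_Collect_eq
      proof (intro conjI)
        show "ideal (C n) ring_of_type_algebra"
          unfolding ideal_type_iff C_def using ideal_zero[OF Ji] ideal_add[OF Ji] ideal_mult_left[OF Ji]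
          by (auto simp: ring_distribs mult.left_commute)
        show "I \<subseteq> C n" using IJ ideal_mult_left[OF Ji] by (auto simp: C_def)
        show "saturated T (C n)"
          using sat unfolding saturated_def C_def by (auto simp: mult.left_commute)
      qed
      have C_mono: "C n \<subseteq> C (n + m)" for n m
        using ideal_mult_left[OF Ji] by (auto simp: C_def power_add mult.assoc mult.left_commute)
      \<comment> \<open>Only stability under doubling the exponent is needed, so a largest member is
        sought among the exponents that are powers of two.\<close>
      obtain Z where Z: "Z \<in> range (\<lambda>k. C (2 ^ k))"
        and Zmin: "\<And>Y. (Y, Z) \<in> {(J', J). J \<in> S \<and> J' \<in> S \<and> J \<subset> J'} \<Longrightarrow> Y \<notin> range (\<lambda>k. C (2 ^ k))"
        using wfE_min[OF wf, of "C (2 ^ 0)" "range (\<lambda>k. C (2 ^ k))"] by (metis (no_types, lifting) rangeI)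
      obtain k where k: "Z = C (2 ^ k)" using Z by blast
      define n where "n = (2::nat) ^ k"
      have n: "n > 0" by (simp add: n_def)
      have "C (n + n) \<in> range (\<lambda>k. C (2 ^ k))"
        by (rule image_eqI[of _ _ "Suc k"]) (simp_all add: n_def mult_2)
      then have stab: "C (n + n) = C n"
        using Zmin[of "C (n + n)"] C_S C_mono[of n n] k by (auto simp: n_def)
      define J2 where "J2 = {f. \<exists>t\<in>T. \<exists>j\<in>J. \<exists>g. t * f = j + b ^ n * g}"
      have sub: "J \<subseteq> J2"
      proof
        fix j assume "j \<in> J"
        then show "j \<in> J2"
          unfolding J2_def mem_Collect_eq
          by (intro bexI[OF _ T(1)] bexI[of _ j] exI[of _ 0]) simp_all
      qed
      have J2_S: "J2 \<in> S"
        unfolding S_def mem_Collect_eq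
      proof (intro conjI)
        show "ideal J2 ring_of_type_algebra"
          unfolding ideal_type_iff
        proof (intro conjI ballI allI)
          show "0 \<in> J2"
            unfolding J2_def mem_Collect_eq
            by (rule bexI[OF _ T(1)], rule bexI[OF _ ideal_zero[OF Ji]], rule exI[of _ 0]) simp
        next
          fix f f' assume "f \<in> J2" "f' \<in> J2"
          then obtain t j g t' j' g' where *: "t \<in> T" "j \<in> J" "t * f = j + b ^ n * g"
            "t' \<in> T" "j' \<in> J" "t' * f' = j' + b ^ n * g'" unfolding J2_def by blast
          have "t * t' * (f + f') = t' * (t * f) + t * (t' * f')" by (simp add: algebra_simps)
          also have "\<dots> = (t' * j + t * j') + b ^ n * (t' * g + t * g')"
            unfolding *(3,6) by (simp add: algebra_simps)
          finally show "f + f' \<in> J2"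
            unfolding J2_def using T(2)[OF *(1,4)] ideal_add[OF Ji ideal_mult_left[OF Ji *(2)] ideal_mult_left[OF Ji *(5)]]
            by blast
        next
          fix f q assume "f \<in> J2"
          then obtain t j g where *: "t \<in> T" "j \<in> J" "t * f = j + b ^ n * g"
            unfolding J2_def by blast
          have "t * (q * f) = q * (t * f)" by (simp add: algebra_simps)
          also have "\<dots> = q * j + b ^ n * (q * g)" unfolding *(3) by (simp add: algebra_simps)
          finally show "q * f \<in> J2"
            unfolding J2_def using *(1) ideal_mult_left[OF Ji *(2)] by blast
        qed
        show "I \<subseteq> J2" using IJ sub by blast
        show "saturated T J2"
          unfolding saturated_def
        proof (intro ballI allI impI)
          fix a f assume a: "a \<in> T" "a * f \<in> J2"
          then obtain t j g where *: "t \<in> T" "j \<in> J" "t * (a * f) = j + b ^ n * g"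
            unfolding J2_def by blast
          then have "(t * a) * f = j + b ^ n * g" by (simp add: mult.assoc)
          then show "f \<in> J2" unfolding J2_def using T(2)[OF *(1) a(1)] *(2) by blast
        qed
      qed
      have JJ2: "J \<subset> J2"
      proof
        show "J \<subseteq> J2" by (rule sub)
        have "b ^ n \<in> J2"
          unfolding J2_def mem_Collect_eq
          by (intro bexI[OF _ T(1)] bexI[OF _ ideal_zero[OF Ji]] exI[of _ 1]) simp
        moreover have "b ^ n \<notin> J" using ab(3) n unfolding radical_type by blast
        ultimately show "J \<noteq> J2" by blast
      qed
      have JC: "J \<subset> C n"
      proof
        show "J \<subseteq> C n" using ideal_mult_left[OF Ji] by (auto simp: C_def)
        have "b ^ n * a = b ^ (n - 1) * (a * b)"
          using n by (cases n) (simp_all add: mult_ac)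
        then have "a \<in> C n" using ideal_mult_left[OF Ji ab(1)] by (simp add: C_def)
        then show "J \<noteq> C n" using ab(2) by blast
      qed
      have inter: "C n \<inter> J2 \<subseteq> J"
      proof
        fix f assume f: "f \<in> C n \<inter> J2"
        then obtain t j g where *: "t \<in> T" "j \<in> J" "t * f = j + b ^ n * g"
          unfolding J2_def by blast
        have "b ^ n * (t * f) \<in> J"
          using f ideal_mult_left[OF Ji, of "b ^ n * f" t] by (simp add: C_def mult.left_commute)
        \<comment> \<open>The term with \<open>j\<close> lies in \<open>J\<close>, which isolates
          \<open>b ^ (n + n) * g\<close>; by stability \<open>b ^ n * g\<close> is already in
          \<open>J\<close>.\<close>
        then have "b ^ n * j + b ^ (n + n) * g \<in> J"
          unfolding *(3) by (simp add: ring_distribs power_add mult.assoc)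
        then have "b ^ (n + n) * g \<in> J"
          using ideal_add_cancel[OF Ji ideal_mult_left[OF Ji *(2)]] by simp
        then have "g \<in> C n" unfolding stab[symmetric] by (simp add: C_def)
        then have "t * f \<in> J" unfolding *(3) using ideal_add[OF Ji *(2)] by (simp add: C_def)
        then show "f \<in> J" using sat *(1) unfolding saturated_def by blast
      qed
      obtain D1 where D1: "finite D1" "\<forall>Q\<in>D1. primary_ideal ring_of_type_algebra Q \<and> Q \<in> S" "\<Inter>D1 = C n"
        using less.IH[of "C n"] J C_S JC by auto
      obtain D2 where D2: "finite D2" "\<forall>Q\<in>D2. primary_ideal ring_of_type_algebra Q \<and> Q \<in> S" "\<Inter>D2 = J2"
        using less.IH[of J2] J J2_S JJ2 by auto
      have "\<Inter>(D1 \<union> D2) = J"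
        using D1(3) D2(3) inter JC JJ2 by (simp add: Inter_Un_distrib) blast
      then show ?thesis using D1 D2 by (intro exI[of _ "D1 \<union> D2"]) auto
    qed
  qed
qed

section \<open>The hull\<close>

lemma mpoly_var_power: "mpoly_var i ^ n = Poly_Mapping.single (Poly_Mapping.single i n) (1::'k::comm_ring_1)"
  by (induction n) (simp_all add: mpoly_var_def mult_single single_add[symmetric])

lemma lookup_zero_mult:
  "Poly_Mapping.lookup (p * q) 0 = Poly_Mapping.lookup p 0 * Poly_Mapping.lookup (q :: ('v::finite, 'k::field) mpoly) 0"
proof -
  have "mpoly_ext (\<lambda>c. c) (\<lambda>m. of_bool (m = 0)) (p * q) =
      mpoly_ext (\<lambda>c. c) (\<lambda>m. of_bool (m = 0)) p * mpoly_ext (\<lambda>c. c) (\<lambda>m. of_bool (m = 0)) q"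
    by (rule ring_map.mpoly_ext_mult[OF ring_map_id]) (simp add: exp_deg_eq_0_iff[symmetric] exp_deg_add)
  then show ?thesis unfolding mpoly_ext_constant_term .
qed

section \<open>Nonzerodivisors modulo the lattice ideal\<close>

context graded_binomials
begin

lemma cong_shift_lattice: "bcong lattice (c + m) (c + n) \<longleftrightarrow> bcong lattice m n"
  by (simp add: lattice_cong_iff exp_vec_add)

lemma class_sum_shift:
  "class_sum lattice (c + x) (Poly_Mapping.single c d * p) = d * class_sum lattice x p"
  by (simp add: class_sum_single_mult cong_shift_lattice) (simp add: class_sum_def)

text \<open>Shifting by \<open>c\<close> preserves and reflects lattice congruence, so each class
  sum of \<open>f\<close> reappears as a class sum of the product.\<close>

lemma monomial_regular:
  fixes f :: "('v, 'k::field) mpoly"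
  assumes "Poly_Mapping.single c 1 * f \<in> lattice_ideal lattice"
  shows "f \<in> lattice_ideal lattice"
  using assms class_sum_shift[of c _ 1 f] by (metis lattice_ideal_iff mult_1)

text \<open>The multiplicative set for which ideals are required to be saturated below. It contains
  the variables and all nonzero polynomials in one of them.\<close>

definition regulars :: "('v, 'k::field) mpoly set" where
  "regulars = {a. \<forall>f. a * f \<in> lattice_ideal lattice \<longrightarrow> f \<in> lattice_ideal lattice}"

lemma one_regulars: "1 \<in> regulars"
  by (simp add: regulars_def)

lemma mult_regulars: "a \<in> regulars \<Longrightarrow> b \<in> regulars \<Longrightarrow> a * b \<in> regulars"
  unfolding regulars_def mem_Collect_eq mult.assoc by blast

lemma var_regulars: "mpoly_var i \<in> regulars"
  by (auto simp: regulars_def mpoly_var_def intro: monomial_regular)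

text \<open>Take a class of least degree on which \<open>f\<close> has nonzero sum and shift it by
  the lowest exponent occurring in the polynomial. A higher exponent could contribute there only
  through a class of smaller degree, so a single nonzero term remains.\<close>

lemma poly_in_var_regulars:
  fixes a :: "nat \<Rightarrow> 'k::field"
  assumes "\<exists>j<M. a j \<noteq> 0"
  shows "(\<Sum>j<M. mpoly_scale (a j) (mpoly_var i ^ j)) \<in> regulars"
  unfolding regulars_def
proof (intro CollectI allI impI, rule ccontr)
  let ?p = "\<Sum>j<M. mpoly_scale (a j) (mpoly_var i ^ j)"
  fix f :: "('v, 'k) mpoly"
  assume pf: "?p * f \<in> lattice_ideal lattice" and f: "f \<notin> lattice_ideal lattice"
  then obtain x0 where "class_sum lattice x0 f \<noteq> 0" by (auto simp: lattice_ideal_iff)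
  then obtain x where x: "class_sum lattice x f \<noteq> 0"
    and xmin: "\<And>y. class_sum lattice y f \<noteq> 0 \<Longrightarrow> exp_deg x \<le> exp_deg y"
    using ex_has_least_nat[of "\<lambda>x. class_sum lattice x f \<noteq> 0" x0 exp_deg] by blast
  define n where "n = (LEAST j. j < M \<and> a j \<noteq> 0)"
  have n: "n < M" "a n \<noteq> 0"
    using LeastI_ex[of "\<lambda>j. j < M \<and> a j \<noteq> 0"] assms unfolding n_def by blast+
  have zero: "a j = 0" if "j < n" for j
    using not_less_Least[of j "\<lambda>j. j < M \<and> a j \<noteq> 0"] that n(1) unfolding n_def by auto
  let ?e = "Poly_Mapping.single i :: nat \<Rightarrow> 'v \<Rightarrow>\<^sub>0 nat"
  have shifted: "class_sum lattice (?e n + x) (mpoly_scale (a j) (mpoly_var i ^ j) * f) =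
      (if j = n then a n * class_sum lattice x f else 0)" for j
  proof -
    have single: "mpoly_scale (a j) (mpoly_var i ^ j) * f = Poly_Mapping.single (?e j) (a j) * f"
      by (simp add: mpoly_scale_def mpoly_var_power mult_single)
    consider "j < n" | "j = n" | "j > n" by linarith
    then show ?thesis
    proof cases
      case 1
      then show ?thesis by (simp add: single zero mpoly_scale_def)
    next
      case 2
      then show ?thesis unfolding single by (simp add: class_sum_shift)
    next
      case 3
      then have "?e j = ?e n + ?e (j - n)" by (simp add: single_add[symmetric])
      then have "bcong lattice (?e j + m) (?e n + x) \<longleftrightarrow> bcong lattice (?e (j - n) + m) x" for m
        using cong_shift_lattice[of "?e n" "?e (j - n) + m" x] by (simp add: add.assoc)
      then have "class_sum lattice (?e n + x) (mpoly_scale (a j) (mpoly_var i ^ j) * f) =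
          a j * mpoly_ext (\<lambda>c. c) (\<lambda>m. of_bool (bcong lattice (?e (j - n) + m) x)) f"
        unfolding single class_sum_single_mult by simp
      also have "mpoly_ext (\<lambda>c. c) (\<lambda>m. of_bool (bcong lattice (?e (j - n) + m) x)) f = 0"
      proof (cases "\<exists>y. bcong lattice (?e (j - n) + y) x")
        case True
        then obtain y where y: "bcong lattice (?e (j - n) + y) x" by blast
        then have "bcong lattice (?e (j - n) + m) x \<longleftrightarrow> bcong lattice (?e (j - n) + m) (?e (j - n) + y)" for m
          using bcong_sym bcong_trans by blast
        then have "mpoly_ext (\<lambda>c. c) (\<lambda>m. of_bool (bcong lattice (?e (j - n) + m) x)) f = class_sum lattice y f"
          by (simp add: cong_shift_lattice class_sum_def)
        moreover have "exp_deg x = (j - n) + exp_deg y"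
          using graded_binomials.cong_deg[OF graded_binomials_lattice y] by (simp add: exp_deg_add)
        ultimately show ?thesis using xmin[of y] 3 by force
      next
        case False
        then show ?thesis by (simp add: mpoly_ext_def)
      qed
      finally show ?thesis using 3 by simp
    qed
  qed
  have "class_sum lattice (?e n + x) (?p * f) = a n * class_sum lattice x f"
    using n(1) by (simp add: sum_distrib_right class_sum_sum shifted sum.delta)
  then show False using pf n(2) x by (simp add: lattice_ideal_iff)
qed

lemma lattice_ideal_subset: "(lattice_ideal A :: ('v, 'k::field) mpoly set) \<subseteq> lattice_ideal lattice"
  by (rule lattice_ideal_mono[OF subset_lattice])

text \<open>All monomials of the product have degree at least \<open>N\<close>, where the two
  congruences coincide, so its class sums may be computed for the lattice.\<close>

lemma monomial_mult_mem:
  fixes f :: "('v, 'k::field) mpoly"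
  assumes st: "stable_from N \<kappa>" and c: "exp_deg c \<ge> N" and f: "f \<in> lattice_ideal lattice"
  shows "Poly_Mapping.single c 1 * f \<in> lattice_ideal A"
  unfolding lattice_ideal_iff
proof
  fix x
  have "bcong A (c + m) x \<longleftrightarrow> bcong lattice (c + m) x" for m
    using lattice_cong_large[OF st, of "c + m" x] c by (simp add: exp_deg_add)
  then have "class_sum A x (Poly_Mapping.single c 1 * f) = class_sum lattice x (Poly_Mapping.single c 1 * f)"
    by (simp add: class_sum_single_mult)
  also have "\<dots> = 0" using ideal_mult_left[OF ideal_lattice_ideal f] by (simp add: lattice_ideal_iff)
  finally show "class_sum A x (Poly_Mapping.single c 1 * f) = 0" .
qed

text \<open>A high power of every variable is congruent to a multiple of \<open>mpoly_var i\<close>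
  and hence lies in \<open>R\<close>. Closure under roots is a bare hypothesis in order to serve
  prime ideals and radicals alike.\<close>

lemma irrelevant_subset:
  fixes R :: "('v, 'k::field) mpoly set"
  assumes R: "ideal R mpoly_ring" and rad: "\<And>x n. n > 0 \<Longrightarrow> x ^ n \<in> R \<Longrightarrow> x \<in> R"
    and sub: "lattice_ideal A \<subseteq> R" and i: "mpoly_var i \<in> R"
  shows "irrelevant_ideal \<subseteq> R"
proof -
  obtain N \<kappa> where st: "stable_from N \<kappa>" using ex_stable_from by blast
  have var: "mpoly_var j \<in> R" for j
  proof -
    obtain m where m: "bcong A (Poly_Mapping.single j (Suc N)) (Poly_Mapping.single i 1 + m)"
      using stable_absorb[OF st, of "Poly_Mapping.single j (Suc N)" i] by auto
    have "Poly_Mapping.single (Poly_Mapping.single j (Suc N)) (1::'k) - Poly_Mapping.single (Poly_Mapping.single i 1 + m) 1 \<in> R"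
      using monomial_diff_mem[OF m] sub by blast
    moreover have "Poly_Mapping.single (Poly_Mapping.single i 1 + m) (1::'k) \<in> R"
      using ideal_mult_right[OF R i, of "Poly_Mapping.single m 1"] by (simp add: mpoly_var_def mult_single)
    ultimately have "Poly_Mapping.single (Poly_Mapping.single j (Suc N)) (1::'k) \<in> R"
      using ideal_add[OF R] by fastforce
    then have "(mpoly_var j :: ('v, 'k) mpoly) ^ Suc N \<in> R" by (simp only: mpoly_var_power)
    then show ?thesis using rad by blast
  qed
  have mono: "Poly_Mapping.single m c \<in> R" if nz: "m \<noteq> 0" for m and c :: 'k
  proof -
    obtain j m' where "m = Poly_Mapping.single j 1 + m'" using exp_nonzero_split[OF nz] by blast
    then have "Poly_Mapping.single m c = mpoly_var j * Poly_Mapping.single m' c"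
      by (simp add: mpoly_var_def mult_single)
    then show ?thesis using ideal_mult_right[OF R var] by simp
  qed
  show ?thesis
  proof
    fix p :: "('v, 'k) mpoly" assume "p \<in> irrelevant_ideal"
    then have "0 \<notin> Poly_Mapping.keys p" by (simp add: irrelevant_ideal_iff in_keys_iff)
    then have "(\<Sum>m\<in>Poly_Mapping.keys p. Poly_Mapping.single m (Poly_Mapping.lookup p m)) \<in> R"
      by (intro ideal_sum[OF R] mono) auto
    then show "p \<in> R" unfolding mpoly_sum_single[symmetric] .
  qed
qed

text \<open>If the radical of \<open>Q\<close> contained a variable, it would contain the irrelevant
  ideal, and a component inside \<open>deg_kernel\<close> would have a strictly smaller radical. So
  a power of a variable that carries \<open>f\<close> into the ideal can be cancelled modulo
  \<open>Q\<close>. This works in whichever minimal decomposition \<open>Q\<close> occurs.\<close>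

lemma lattice_ideal_subset_isolated:
  fixes Q :: "('v, 'k::field) mpoly set"
  assumes "isolated_primary_component mpoly_ring (lattice_ideal A) Q"
  shows "lattice_ideal lattice \<subseteq> Q"
proof
  fix f :: "('v, 'k) mpoly" assume f: "f \<in> lattice_ideal lattice"
  obtain D where D: "minimal_primary_decomposition mpoly_ring (lattice_ideal A) D" "Q \<in> D"
    and iso: "\<And>Q'. Q' \<in> D \<Longrightarrow> \<not> radical mpoly_ring Q' \<subset> radical mpoly_ring Q"
    using assms unfolding isolated_primary_component_def by blast
  have fin: "finite D" and prim: "\<And>Q. Q \<in> D \<Longrightarrow> primary_ideal mpoly_ring Q" and I: "lattice_ideal A = \<Inter>D"
    using D(1) unfolding minimal_primary_decomposition_def primary_decomposition_def by auto
  have Q: "primary_ideal mpoly_ring Q" and Qi: "ideal Q mpoly_ring"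
    using prim D(2) by (auto simp: primary_type_iff)
  have IQ: "lattice_ideal A \<subseteq> Q" using I D(2) by blast
  have radP: "primeideal (radical mpoly_ring Q) mpoly_ring" by (rule primeideal_radical[OF Q])
  have novar: "mpoly_var i \<notin> radical mpoly_ring Q" for i
  proof
    assume "mpoly_var i \<in> radical mpoly_ring Q"
    then have irr: "irrelevant_ideal \<subseteq> radical mpoly_ring Q"
      using radP prime_power_mem[OF radP] IQ subset_radical[of Q]
      by (intro irrelevant_subset[of _ i]) (auto simp: primeideal_type_iff)
    have "\<exists>Q'\<in>D. Q' \<subseteq> deg_kernel"
      using fin primeideal_deg_kernel prim lattice_ideal_subset_deg_kernel I
      by (intro prime_contains_of_Inter) (auto simp: primary_type_iff)
    then obtain Q' where "Q' \<in> D" "radical mpoly_ring Q' \<subseteq> deg_kernel"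
      using radical_subset_prime[OF primeideal_deg_kernel] by blast
    then show False using iso irr deg_kernel_psubset by blast
  qed
  obtain N \<kappa> where st: "stable_from N \<kappa>" using ex_stable_from by blast
  let ?c = "Poly_Mapping.single undefined N :: 'v \<Rightarrow>\<^sub>0 nat"
  have "Poly_Mapping.single ?c 1 * f \<in> Q"
    using monomial_mult_mem[OF st _ f, of ?c] IQ by auto
  then have "f * mpoly_var undefined ^ N \<in> Q" by (simp add: mpoly_var_power mult.commute)
  moreover have "mpoly_var undefined ^ N \<notin> radical mpoly_ring Q"
    using prime_power_mem[OF radP] novar by blast
  ultimately show "f \<in> Q" using Q unfolding primary_type_iff by blast
qed

text \<open>
  The elements $f_k \in J_{k+1} \setminus J_k$ picked from a strictly ascending chain would be
  linearly independent over $K[t_i]$ modulo the ideal.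
\<close>

lemma wf_saturated:
  defines "S \<equiv> {J :: ('v, 'k::field) mpoly set. ideal J mpoly_ring \<and> lattice_ideal A \<subseteq> J \<and> saturated regulars J}"
  shows "wf {(J', J). J \<in> S \<and> J' \<in> S \<and> J \<subset> J'}"
  unfolding wf_iff_no_infinite_down_chain
proof
  assume "\<exists>C. \<forall>k. (C (Suc k), C k) \<in> {(J', J). J \<in> S \<and> J' \<in> S \<and> J \<subset> J'}"
  then obtain C where "\<forall>k. (C (Suc k), C k) \<in> {(J', J). J \<in> S \<and> J' \<in> S \<and> J \<subset> J'}" ..
  then have C: "\<And>k. C k \<in> S" "\<And>k. C k \<subset> C (Suc k)" by auto
  have mono: "C k \<subseteq> C l" if "k \<le> l" for k l
    using that by (rule lift_Suc_mono_le[rotated]) (rule psubset_imp_subset[OF C(2)])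
  have "\<forall>k. \<exists>f. f \<in> C (Suc k) \<and> f \<notin> C k" using C(2) by blast
  from choice[OF this] obtain f where "\<forall>k. f k \<in> C (Suc k) \<and> f k \<notin> C k" ..
  then have f: "\<And>k. f k \<in> C (Suc k)" "\<And>k. f k \<notin> C k" by simp_all
  let ?t = "mpoly_var undefined :: ('v, 'k) mpoly"
  obtain r where r: "\<forall>f :: nat \<Rightarrow> ('v, 'k) mpoly. \<exists>a M. (\<exists>k<r. \<exists>j<M. a k j \<noteq> 0) \<and>
      (\<Sum>k<r. \<Sum>j<M. mpoly_scale (a k j) (f k * ?t ^ j)) \<in> lattice_ideal A"
    using dependent_mod_ideal[of ?t] by (elim exE)
  obtain a M where aM: "(\<exists>k<r. \<exists>j<M. a k j \<noteq> 0) \<and>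
    (\<Sum>k<r. \<Sum>j<M. mpoly_scale (a k j) (f k * ?t ^ j)) \<in> lattice_ideal A"
    using spec[OF r, of f] by (elim exE)
  define b where "b k = (\<Sum>j<M. mpoly_scale (a k j) (?t ^ j))" for k
  define Z where "Z k \<longleftrightarrow> k < r \<and> (\<exists>j<M. a k j \<noteq> 0)" for k
  have "finite {k. Z k}" "{k. Z k} \<noteq> {}" using aM by (auto simp: Z_def)
  \<comment> \<open>The top index is chosen here: the terms with smaller index lie in
    \<open>C n\<close> and those with larger index vanish, so the relation puts
    \<open>b n * f n\<close> into \<open>C n\<close>.\<close>
  define n where "n = Max {k. Z k}"
  have n: "Z n" using Max_in[OF \<open>finite {k. Z k}\<close> \<open>{k. Z k} \<noteq> {}\<close>] by (simp add: n_def)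
  have nmax: "k \<le> n" if "Z k" for k using Max_ge[OF \<open>finite {k. Z k}\<close>, of k] that by (simp add: n_def)
  have zero: "b k = 0" if "n < k" "k < r" for k
    unfolding b_def
  proof (rule sum.neutral, rule ballI)
    fix j assume "j \<in> {..<M}"
    then have "a k j = 0" using nmax[of k] that by (auto simp: Z_def not_le)
    then show "mpoly_scale (a k j) (?t ^ j) = 0" by (simp add: mpoly_scale_def)
  qed
  have Ci: "ideal (C n) mpoly_ring" and Cs: "saturated regulars (C n)" and CI: "lattice_ideal A \<subseteq> C n"
    using C(1)[of n] by (auto simp: S_def)
  have "(\<Sum>k<r. \<Sum>j<M. mpoly_scale (a k j) (f k * ?t ^ j)) = (\<Sum>k<r. b k * f k)"
    by (simp add: b_def sum_distrib_left sum_distrib_right mpoly_scale_def mult_ac)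
  also have "\<dots> = b n * f n + (\<Sum>k\<in>{..<r} - {n}. b k * f k)"
    using n by (intro sum.remove) (auto simp: Z_def)
  finally have "b n * f n + (\<Sum>k\<in>{..<r} - {n}. b k * f k) \<in> C n" using aM CI by auto
  moreover have "(\<Sum>k\<in>{..<r} - {n}. b k * f k) \<in> C n"
  proof (rule ideal_sum[OF Ci])
    fix k assume k: "k \<in> {..<r} - {n}"
    show "b k * f k \<in> C n"
    proof (cases "k < n")
      case True
      then show ?thesis using f(1)[of k] mono[of "Suc k" n] ideal_mult_left[OF Ci] by auto
    next
      case False
      then show ?thesis using zero[of k] k ideal_zero[OF Ci] by simp
    qed
  qed
  ultimately have "b n * f n \<in> C n"
    using ideal_add_cancel[OF Ci, of "\<Sum>k\<in>{..<r} - {n}. b k * f k" "b n * f n"] by (simp add: add.commute)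
  moreover have "b n \<in> regulars"
    unfolding b_def using n by (intro poly_in_var_regulars) (simp add: Z_def)
  ultimately have "f n \<in> C n" using Cs unfolding saturated_def by blast
  then show False using f(2) by blast
qed

text \<open>The disjunction separates components that avoid the variables in their radical from
  those supported at the origin. It is preserved when components with equal radicals are
  intersected, which the reduction to a minimal decomposition relies on.\<close>

lemma ex_good_decomposition:
  defines "good \<equiv> \<lambda>Q :: ('v, 'k::field) mpoly set. primary_ideal mpoly_ring Q \<and>
      (lattice_ideal A \<subseteq> Q \<and> saturated regulars Q \<or> radical mpoly_ring Q = irrelevant_ideal)"
  shows "\<exists>D. finite D \<and> (\<forall>Q\<in>D. good Q) \<and> \<Inter>D = lattice_ideal A"
proof -
  let ?I = "lattice_ideal A :: ('v, 'k) mpoly set" and ?IL = "lattice_ideal lattice :: ('v, 'k) mpoly set"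
  have IL: "?IL \<in> {J. ideal J mpoly_ring \<and> ?I \<subseteq> J \<and> saturated regulars J}"
    by (auto simp: ideal_lattice_ideal saturated_def regulars_def dest: subsetD[OF lattice_ideal_subset])
  have "\<exists>D. finite D \<and> (\<forall>Q\<in>D. primary_ideal mpoly_ring Q \<and>
      Q \<in> {J. ideal J mpoly_ring \<and> ?I \<subseteq> J \<and> saturated regulars J}) \<and> \<Inter>D = ?IL"
    by (rule saturated_primary_decomposition[OF one_regulars _ wf_saturated IL]) (rule mult_regulars)
  then obtain D where D: "finite D" "\<forall>Q\<in>D. primary_ideal mpoly_ring Q \<and>
      Q \<in> {J. ideal J mpoly_ring \<and> ?I \<subseteq> J \<and> saturated regulars J}" "\<Inter>D = ?IL" by (elim exE conjE)
  obtain N \<kappa> where st: "stable_from N \<kappa>" using ex_stable_from by blast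
  let ?t = "mpoly_var undefined :: ('v, 'k) mpoly"
  \<comment> \<open>With \<open>Suc N\<close> instead of \<open>N\<close> the power is not 1, so
    \<open>Q\<close> is a proper ideal even for \<open>N = 0\<close>.\<close>
  let ?tN = "?t ^ Suc N"
  have tN: "?tN = Poly_Mapping.single (Poly_Mapping.single undefined (Suc N)) 1" by (rule mpoly_var_power)
  define Q where "Q = {j + ?tN * g | j g. j \<in> ?I}"
  have Qi: "ideal Q mpoly_ring"
    unfolding Q_def by (rule ideal_plus_principal[OF ideal_lattice_ideal])
  have IQ: "?I \<subseteq> Q"
  proof
    fix j assume "j \<in> ?I"
    moreover have "j = j + ?tN * 0" by simp
    ultimately show "j \<in> Q" unfolding Q_def by blast
  qed
  have tQ: "?tN \<in> Q"
  proof -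
    have "?tN = 0 + ?tN * 1" by simp
    then show ?thesis unfolding Q_def using ideal_zero[OF ideal_lattice_ideal] by blast
  qed
  have irr: "ideal (irrelevant_ideal :: ('v, 'k) mpoly set) mpoly_ring"
    using primeideal_irrelevant_ideal primeideal_type_iff by blast
  have "?tN \<in> irrelevant_ideal" using ideal_mult_right[OF irr mpoly_var_irrelevant] by simp
  then have Qirr: "Q \<subseteq> irrelevant_ideal"
    unfolding Q_def
    using lattice_ideal_subset_deg_kernel deg_kernel_psubset ideal_add[OF irr] ideal_mult_right[OF irr] by blast
  have rad: "radical mpoly_ring Q = irrelevant_ideal"
  proof
    show "radical mpoly_ring Q \<subseteq> irrelevant_ideal"
      by (rule radical_subset_prime[OF primeideal_irrelevant_ideal Qirr])
    show "irrelevant_ideal \<subseteq> radical mpoly_ring Q"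
    proof (rule irrelevant_subset[OF ideal_radical[OF Qi]])
      show "?I \<subseteq> radical mpoly_ring Q" using IQ subset_radical by blast
      show "?t \<in> radical mpoly_ring Q" using tQ by (auto simp: radical_type simp del: power_Suc)
      fix x :: "('v, 'k) mpoly" and n :: nat assume "n > 0" "x ^ n \<in> radical mpoly_ring Q"
      then obtain k where "k > 0" "x ^ (n * k) \<in> Q" by (auto simp: radical_type power_mult)
      then show "x \<in> radical mpoly_ring Q"
        using \<open>n > 0\<close> by (auto simp: radical_type intro!: exI[of _ "n * k"])
    qed
  qed
  have prim: "primary_ideal mpoly_ring Q"
  proof (rule primary_of_maximal_radical[OF Qi])
    show "1 \<notin> Q" using Qirr primeideal_irrelevant_ideal by (auto simp: primeideal_type_iff)
    fix b :: "('v, 'k) mpoly" assume "b \<notin> radical mpoly_ring Q"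
    then have "Poly_Mapping.lookup b 0 \<noteq> 0" unfolding rad by (simp add: irrelevant_ideal_iff)
    then have "1 - Poly_Mapping.single 0 (inverse (Poly_Mapping.lookup b 0)) * b \<in> irrelevant_ideal"
      by (simp add: irrelevant_ideal_iff lookup_minus lookup_zero_mult)
    then show "\<exists>u. 1 - u * b \<in> radical mpoly_ring Q" unfolding rad by blast
  qed
  \<comment> \<open>If a multiple of \<open>?tN\<close> lies in the lattice ideal, so does the
    cofactor; multiplying back lands in the smaller ideal because \<open>?tN\<close> has large
    degree.\<close>
  have "?IL \<inter> Q \<subseteq> ?I"
  proof
    fix f assume f: "f \<in> ?IL \<inter> Q"
    then obtain j g where jg: "f = j + ?tN * g" "j \<in> ?I" unfolding Q_def by blast
    have "j \<in> ?IL" using jg(2) lattice_ideal_subset by blast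
    then have "?tN * g \<in> ?IL" using f ideal_add_cancel[OF ideal_lattice_ideal] jg(1) by blast
    then have "g \<in> ?IL" unfolding tN by (rule monomial_regular)
    then have "?tN * g \<in> ?I" unfolding tN by (intro monomial_mult_mem[OF st]) auto
    then show "f \<in> ?I" unfolding jg(1) using ideal_add[OF ideal_lattice_ideal jg(2)] by blast
  qed
  then have "\<Inter>(insert Q D) = ?I" using D(3) IQ lattice_ideal_subset by auto
  moreover have "good Q" using prim rad by (simp add: good_def)
  ultimately show ?thesis
    using D(1,2) by (intro exI[of _ "insert Q D"]) (auto simp: good_def)
qed

lemma hull_subset:
  "ideal_hull mpoly_ring (lattice_ideal A :: ('v, 'k::field) mpoly set) \<subseteq> lattice_ideal lattice"
proof
  fix f :: "('v, 'k) mpoly" assume f: "f \<in> ideal_hull mpoly_ring (lattice_ideal A)"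
  let ?I = "lattice_ideal A :: ('v, 'k) mpoly set" and ?IL = "lattice_ideal lattice :: ('v, 'k) mpoly set"
  let ?t = "mpoly_var undefined :: ('v, 'k) mpoly" and ?irr = "irrelevant_ideal :: ('v, 'k) mpoly set"
  define sat where "sat Q \<longleftrightarrow> ?I \<subseteq> Q \<and> saturated regulars Q" for Q
  define good where "good Q \<longleftrightarrow> primary_ideal mpoly_ring Q \<and> (sat Q \<or> radical mpoly_ring Q = ?irr)" for Q
  define dec where "dec D \<longleftrightarrow> finite D \<and> (\<forall>Q\<in>D. good Q) \<and> \<Inter>D = ?I" for D
  obtain D0 where "dec D0"
    using ex_good_decomposition unfolding dec_def good_def sat_def by blast
  \<comment> \<open>The size is minimized among good decompositions only. Merging members with equal
    radicals and dropping a redundant member both stay good and both shrink \<open>D\<close>, so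
    neither is possible.\<close>
  then obtain D where D: "dec D" and Dmin: "\<And>D'. dec D' \<Longrightarrow> card D \<le> card D'"
    using ex_has_least_nat[of dec D0 card] by blast
  have fin: "finite D" and Dgood: "\<And>Q. Q \<in> D \<Longrightarrow> good Q" and DI: "\<Inter>D = ?I"
    using D unfolding dec_def by auto
  have t: "?t \<in> ?irr" by (rule mpoly_var_irrelevant)
  have not_irr: "?t \<notin> radical mpoly_ring Q" if "sat Q" "good Q" for Q
    using that saturated_radical_disjoint[OF _ _ var_regulars] unfolding sat_def good_def primary_type_iff by blast
  have good_Int: "good (Q \<inter> Q')" if Q: "good Q" "good Q'" "radical mpoly_ring Q = radical mpoly_ring Q'" for Q Q'
  proof -
    have prim: "primary_ideal mpoly_ring (Q \<inter> Q')" "radical mpoly_ring (Q \<inter> Q') = radical mpoly_ring Q"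
      using primary_Int[of Q Q'] Q unfolding good_def by auto
    show ?thesis
    proof (cases "radical mpoly_ring Q = ?irr")
      case True
      then show ?thesis using prim by (simp add: good_def)
    next
      case False
      then have "sat (Q \<inter> Q')" using Q saturated_Int unfolding good_def sat_def by blast
      then show ?thesis using prim by (simp add: good_def)
    qed
  qed
  have minimal: "minimal_primary_decomposition mpoly_ring ?I D"
    unfolding minimal_primary_decomposition_def primary_decomposition_def
  proof (intro conjI ballI)
    show "finite D" by (rule fin)
    show "primary_ideal mpoly_ring Q" if "Q \<in> D" for Q using Dgood[OF that] by (simp add: good_def)
    show "?I = carrier mpoly_ring \<inter> \<Inter>D" using DI by simp
    show "inj_on (radical mpoly_ring) D"
    proof (rule inj_onI, rule ccontr)
      fix Q Q' assume Q: "Q \<in> D" "Q' \<in> D" "radical mpoly_ring Q = radical mpoly_ring Q'" "Q \<noteq> Q'"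
      let ?D = "insert (Q \<inter> Q') (D - {Q, Q'})"
      have "\<Inter>?D = \<Inter>D" using Q(1,2) by auto
      then have "dec ?D" using good_Int Q Dgood fin DI unfolding dec_def by auto
      then have "card D \<le> card ?D" by (rule Dmin)
      also have "card ?D \<le> Suc (card (D - {Q, Q'}))" by (rule card_insert_le_m1[THEN le_trans]) (auto simp: fin card_insert_if)
      also have "card (D - {Q, Q'}) = card D - 2" using Q fin by (simp add: card_Diff_subset)
      finally have "card D \<le> Suc (card D - 2)" .
      moreover have "2 \<le> card D" using Q fin card_mono[of D "{Q, Q'}"] by simp
      ultimately show False by simp
    qed
    show "\<not> carrier mpoly_ring \<inter> \<Inter>(D - {Q}) \<subseteq> Q" if "Q \<in> D" for Q
    proof
      assume "carrier mpoly_ring \<inter> \<Inter>(D - {Q}) \<subseteq> Q"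
      then have "\<Inter>(D - {Q}) = \<Inter>D" using that by auto
      then have "dec (D - {Q})" using fin Dgood DI unfolding dec_def by auto
      then have "card D \<le> card (D - {Q})" by (rule Dmin)
      then show False using that fin by (metis card_Diff1_less not_le)
    qed
  qed
  have fQ: "f \<in> Q" if Q: "Q \<in> D" "sat Q" for Q
  proof -
    have "\<not> radical mpoly_ring Q' \<subset> radical mpoly_ring Q" if Q': "Q' \<in> D" for Q'
    proof
      assume lt: "radical mpoly_ring Q' \<subset> radical mpoly_ring Q"
      show False
      proof (cases "sat Q'")
        case False
        then have "radical mpoly_ring Q' = ?irr" using Dgood[OF Q'] by (simp add: good_def)
        then show False using lt t not_irr[OF Q(2) Dgood[OF Q(1)]] by blast
      next
        case True
        \<comment> \<open>A strict inclusion of radicals puts a nonzero polynomial in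
          \<open>?t\<close> into the larger one; but this polynomial is a nonzerodivisor modulo the
          saturated component \<open>Q\<close>.\<close>
        have P: "primeideal (radical mpoly_ring Q') mpoly_ring" "primeideal (radical mpoly_ring Q) mpoly_ring"
          using Dgood Q(1) Q' primeideal_radical unfolding good_def by blast+
        have "?I \<subseteq> radical mpoly_ring Q'" using True subset_radical[of Q'] unfolding sat_def by blast
        then obtain a M where a: "\<exists>j<M. a j \<noteq> 0" "(\<Sum>j<M. mpoly_scale (a j) (?t ^ j)) \<in> radical mpoly_ring Q"
          using prime_step[OF P _ lt, of ?t] by blast
        then show False
          using saturated_radical_disjoint[OF _ _ poly_in_var_regulars[OF a(1)]] Q(2) Dgood[OF Q(1)]
          unfolding sat_def good_def primary_type_iff by blast
      qed
    qed
    then have "isolated_primary_component mpoly_ring ?I Q"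
      using minimal Q(1) unfolding isolated_primary_component_def by blast
    then show ?thesis using f unfolding ideal_hull_def by blast
  qed
  \<comment> \<open>The saturated components contain \<open>f\<close> itself; the remaining ones
    contain a power of \<open>?t\<close>.\<close>
  have "\<exists>n. ?t ^ n * f \<in> Q" if Q: "Q \<in> D" for Q
  proof (cases "sat Q")
    case True
    then show ?thesis using fQ[OF Q] by (intro exI[of _ 0]) simp
  next
    case False
    then have "?t \<in> radical mpoly_ring Q" using Dgood[OF Q] t by (simp add: good_def)
    then obtain n where "?t ^ n \<in> Q" by (auto simp: radical_type)
    then show ?thesis
      using Dgood[OF Q] ideal_mult_right[of Q] unfolding good_def primary_type_iff by blast
  qed
  then obtain n where n: "\<And>Q. Q \<in> D \<Longrightarrow> ?t ^ n Q * f \<in> Q" by metis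
  have "?t ^ (\<Sum>Q\<in>D. n Q) * f \<in> Q" if Q: "Q \<in> D" for Q
  proof -
    have "ideal Q mpoly_ring" using Dgood[OF Q] by (simp add: good_def primary_type_iff)
    moreover have "?t ^ (\<Sum>Q\<in>D. n Q) * f = ?t ^ (\<Sum>Q\<in>D - {Q}. n Q) * (?t ^ n Q * f)"
      using sum.remove[OF fin Q, of n] by (simp add: power_add mult_ac)
    ultimately show ?thesis using n[OF Q] ideal_mult_left by metis
  qed
  then have "?t ^ (\<Sum>Q\<in>D. n Q) * f \<in> ?IL" using DI lattice_ideal_subset by blast
  then show "f \<in> ?IL" unfolding mpoly_var_power by (rule monomial_regular)
qed

lemma ideal_hull_eq:
  "ideal_hull mpoly_ring (lattice_ideal A :: ('v, 'k::field) mpoly set) = lattice_ideal lattice"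
  using hull_subset lattice_ideal_subset_isolated unfolding ideal_hull_def by auto

end

section \<open>The zero locus and the torsion group\<close>

definition int_coset :: "(int^'v) set \<Rightarrow> int^'v \<Rightarrow> (int^'v) set" where
  "int_coset H x = {y. y - x \<in> H}"

definition sum_zero_vectors :: "(int^'v::finite) set" where
  "sum_zero_vectors = {x. (\<Sum>i\<in>UNIV. x $ i) = 0}"

lemma int_coset_eq_iff:
  assumes "subgroup H int_vec_group"
  shows "int_coset H x = int_coset H y \<longleftrightarrow> x - y \<in> H"
proof
  have H: "0 \<in> H" "\<And>x y. x \<in> H \<Longrightarrow> y \<in> H \<Longrightarrow> x + y \<in> H" "\<And>x. x \<in> H \<Longrightarrow> - x \<in> H"
    using assms by (auto simp: subgroup_int_vec_iff)
  show "x - y \<in> H" if "int_coset H x = int_coset H y"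
  proof -
    have "x \<in> int_coset H x" using H(1) by (simp add: int_coset_def)
    then have "x \<in> int_coset H y" using that by (simp only:)
    then show ?thesis by (simp add: int_coset_def)
  qed
  assume xy: "x - y \<in> H"
  have "z - x \<in> H \<longleftrightarrow> z - y \<in> H" for z
    using H(2)[OF _ xy, of "z - x"] H(2)[OF _ H(3)[OF xy], of "z - y"] by auto
  then show "int_coset H x = int_coset H y" by (simp add: int_coset_def)
qed

lemma prod_zero_power_lookup:
  "(\<Prod>i\<in>UNIV. (0 :: 'k::field) ^ Poly_Mapping.lookup (m :: 'v::finite \<Rightarrow>\<^sub>0 nat) i) = of_bool (m = 0)"
proof (cases "m = 0")
  case False
  then obtain i where "Poly_Mapping.lookup m i \<noteq> 0" by (metis lookup_zero poly_mapping_eqI)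
  then have "(0 :: 'k) ^ Poly_Mapping.lookup m i = 0" by simp
  then have "(\<Prod>i\<in>UNIV. (0 :: 'k) ^ Poly_Mapping.lookup m i) = 0" by (meson UNIV_I finite prod_zero)
  then show ?thesis using False by simp
qed simp

context graded_binomials
begin

lemma zero_locus_with_var:
  "zero_locus (genideal mpoly_ring (lattice_ideal A \<union> {mpoly_var i})) = {0 :: 'k::field^'v}"
proof (intro equalityI subsetI)
  fix x :: "'k^'v" assume "x \<in> zero_locus (genideal mpoly_ring (lattice_ideal A \<union> {mpoly_var i}))"
  then have x: "\<And>p. p \<in> lattice_ideal A \<Longrightarrow> mpoly_eval p x = 0" and "mpoly_eval (mpoly_var i) x = 0"
    unfolding zero_locus_genideal by (auto simp: zero_locus_def)
  have prod_single: "(\<Prod>k\<in>UNIV. (x $ k) ^ Poly_Mapping.lookup (Poly_Mapping.single j n) k) = (x $ j) ^ n" for j n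
  proof -
    have "(\<Prod>k\<in>UNIV. (x $ k) ^ Poly_Mapping.lookup (Poly_Mapping.single j n) k) =
        (\<Prod>k\<in>UNIV. if k = j then (x $ j) ^ n else 1)"
      by (rule prod.cong) (auto simp: lookup_single when_def)
    then show ?thesis by (simp add: prod.delta)
  qed
  have xi: "x $ i = 0"
    using \<open>mpoly_eval (mpoly_var i) x = 0\<close> by (simp add: mpoly_var_def mpoly_eval_single prod_single del: One_nat_def)
  have "x $ j = 0" for j
  proof -
    obtain n m where nm: "bcong A (Poly_Mapping.single j n) (Poly_Mapping.single i 1 + m)" using absorb by blast
    have "mpoly_eval (Poly_Mapping.single (Poly_Mapping.single j n) 1 - Poly_Mapping.single (Poly_Mapping.single i 1 + m) 1) x = 0"
      by (rule x[OF monomial_diff_mem[OF nm]])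
    then have "(x $ j) ^ n = (\<Prod>k\<in>UNIV. (x $ k) ^ Poly_Mapping.lookup (Poly_Mapping.single i 1) k)
        * (\<Prod>k\<in>UNIV. (x $ k) ^ Poly_Mapping.lookup m k)"
      by (simp add: mpoly_eval_diff mpoly_eval_single prod_single lookup_add power_add prod.distrib del: One_nat_def)
    also have "\<dots> = 0" unfolding prod_single xi by simp
    finally show ?thesis by simp
  qed
  then show "x \<in> {0}" by (simp add: vec_eq_iff)
next
  fix x :: "'k^'v" assume "x \<in> {0}"
  then have x: "x = 0" by simp
  have "mpoly_eval (binomial_of a) (0 :: 'k^'v) = 0" if a: "a \<in> A" for a
  proof -
    \<comment> \<open>By homogeneity both monomials of the binomial are constant or neither is, so
      it vanishes at the origin.\<close>
    have "exp_deg (pos_exponent a) = exp_deg (pos_exponent (- a))"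
      using cong_deg[OF bcong_base[OF a, of 0]] by simp
    then have "pos_exponent a = 0 \<longleftrightarrow> pos_exponent (- a) = 0"
      by (metis exp_deg_eq_0_iff)
    then show ?thesis
      by (simp add: binomial_of_def mpoly_eval_diff mpoly_eval_single prod_zero_power_lookup
          del: lookup_pos_exponent)
  qed
  then have "0 \<in> zero_locus (binomial_of ` A :: ('v, 'k) mpoly set)" by (simp add: zero_locus_def)
  then have "0 \<in> zero_locus (lattice_ideal A :: ('v, 'k) mpoly set)"
    unfolding lattice_ideal_def zero_locus_genideal .
  moreover have "mpoly_eval (mpoly_var i) (0 :: 'k^'v) = 0"
    using exp_deg_single[of i 1] exp_deg_eq_0_iff[of "Poly_Mapping.single i 1"]
    by (simp add: mpoly_var_def mpoly_eval_single prod_zero_power_lookup)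
  ultimately show "x \<in> zero_locus (genideal mpoly_ring (lattice_ideal A \<union> {mpoly_var i}))"
    unfolding x zero_locus_genideal by (auto simp: zero_locus_def)
qed

text \<open>Sharing \<open>N\<close> and \<open>\<kappa>\<close> is what makes the two quotients
  have equal degree.\<close>

lemma stable_from_lattice:
  assumes st: "stable_from N \<kappa>"
  shows "graded_binomials.stable_from lattice N \<kappa>"
proof -
  interpret l: graded_binomials lattice by (rule graded_binomials_lattice)
  have "l.hilb d = \<kappa>" if "d \<ge> N" for d
  proof -
    have "l.hilb d = hilb d"
      unfolding l.hilb_def hilb_def
      using that lattice_cong_large[OF st] by (intro card_image_eq_if_same_kernel) (simp add: class_rep_eq_iff)
    then show ?thesis using st that by (simp add: stable_from_def)
  qed
  moreover have "\<exists>m'. bcong lattice m (Poly_Mapping.single i 1 + m')" if "exp_deg m \<ge> N" for m i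
    using stable_absorb[OF st that] bcong_mono[OF _ subset_lattice] by blast
  ultimately show ?thesis unfolding l.stable_from_def by blast
qed

text \<open>A constant vector shifts sum-zero vectors to exponent vectors of one common degree, and
  subtracting a fixed exponent of degree \<open>N\<close> leads back. Only a finite family can be
  shifted uniformly, so finiteness itself comes from the bound \<open>\<kappa>\<close> on all finite
  families.\<close>

lemma finite_cosets_and_card:
  assumes st: "stable_from N \<kappa>"
  shows "finite (int_coset lattice ` sum_zero_vectors)"
    and "card (int_coset lattice ` sum_zero_vectors) = \<kappa>"
proof -
  interpret l: graded_binomials lattice by (rule graded_binomials_lattice)
  have hl: "l.hilb d = \<kappa>" if "d \<ge> N" for d
    using stable_from_lattice[OF st] that by (simp add: l.stable_from_def)
  let ?q = "int_coset lattice"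
  have q: "?q x = ?q y \<longleftrightarrow> x - y \<in> lattice" for x y
    by (rule int_coset_eq_iff[OF subgroup_generate])
  have bound: "card (?q ` F) \<le> \<kappa>" if F: "finite F" "F \<subseteq> sum_zero_vectors" for F
  proof -
    \<comment> \<open>Large enough to make all entries over \<open>F\<close> nonnegative, and at
      least \<open>N\<close>, so that the degree \<open>CARD('v) * k\<close> is in the stable
      range.\<close>
    define k where "k = N + (\<Sum>x\<in>F. \<Sum>i\<in>UNIV. nat \<bar>x $ i\<bar>)"
    define v :: "int^'v" where "v = (\<chi> i. int k)"
    have nonneg: "0 \<le> (x + v) $ i" if "x \<in> F" for x i
    proof -
      have "nat \<bar>x $ i\<bar> \<le> (\<Sum>i\<in>UNIV. nat \<bar>x $ i\<bar>)" by (rule member_le_sum) auto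
      also have "\<dots> \<le> (\<Sum>x\<in>F. \<Sum>i\<in>UNIV. nat \<bar>x $ i\<bar>)"
        using member_le_sum[of x F "\<lambda>x :: int^'v. \<Sum>i\<in>UNIV. nat \<bar>x $ i\<bar>"] that F by simp
      finally have "nat \<bar>x $ i\<bar> \<le> k" by (simp add: k_def)
      then show ?thesis by (simp add: v_def)
    qed
    define e where "e x = pos_exponent (x + v)" for x
    have e: "exp_vec (e x) = x + v" if "x \<in> F" for x
      unfolding e_def by (rule exp_vec_pos_exponent_nonneg) (rule nonneg[OF that])
    have "exp_deg (e x) = CARD('v) * k" if "x \<in> F" for x
    proof -
      have "int (exp_deg (e x)) = (\<Sum>i\<in>UNIV. x $ i) + int (CARD('v) * k)"
        unfolding int_exp_deg e[OF that] by (simp add: sum.distrib v_def)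
      also have "(\<Sum>i\<in>UNIV. x $ i) = 0" using F that by (auto simp: sum_zero_vectors_def)
      finally have "int (exp_deg (e x)) = int (CARD('v) * k)" by simp
      then show ?thesis unfolding of_nat_eq_iff .
    qed
    then have sub: "class_rep lattice ` e ` F \<subseteq> class_rep lattice ` {m. exp_deg m = CARD('v) * k}" by auto
    have "card (?q ` F) = card ((\<lambda>x. class_rep lattice (e x)) ` F)"
      by (rule card_image_eq_if_same_kernel) (simp add: class_rep_eq_iff lattice_cong_iff e q)
    also have "\<dots> \<le> l.hilb (CARD('v) * k)"
      unfolding l.hilb_def using sub by (intro card_mono) (auto simp: finite_exp_deg_eq image_image)
    also have "\<dots> = \<kappa>"
    proof (rule hl)
      have "0 < CARD('v)" by simp
      then have "k \<le> CARD('v) * k" by (simp add: Suc_leI)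
      moreover have "N \<le> k" by (simp add: k_def)
      ultimately show "N \<le> CARD('v) * k" by (rule le_trans[rotated])
    qed
    finally show ?thesis .
  qed
  have bound': "card G \<le> \<kappa>" if "G \<subseteq> ?q ` sum_zero_vectors" "finite G" for G
    using bound finite_subset_image[OF that(2,1)] by metis
  show fin: "finite (?q ` sum_zero_vectors)"
    using finite_if_finite_subsets_card_bdd[of "?q ` sum_zero_vectors" \<kappa>] bound' by blast
  have "\<kappa> = card (class_rep lattice ` {m. exp_deg m = N})"
    using hl[of N] by (simp add: l.hilb_def)
  also have "\<dots> = card ((\<lambda>m. ?q (exp_vec m - exp_vec (Poly_Mapping.single undefined N))) ` {m. exp_deg m = N})"
    by (rule card_image_eq_if_same_kernel) (simp add: class_rep_eq_iff lattice_cong_iff q)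
  also have "\<dots> \<le> card (?q ` sum_zero_vectors)"
  proof (rule card_mono[OF fin], rule image_subsetI)
    fix m :: "'v \<Rightarrow>\<^sub>0 nat" assume "m \<in> {m. exp_deg m = N}"
    then have "int (exp_deg m) = int (exp_deg (Poly_Mapping.single (undefined :: 'v) N))" by simp
    then have "exp_vec m - exp_vec (Poly_Mapping.single undefined N) \<in> sum_zero_vectors"
      unfolding int_exp_deg sum_zero_vectors_def by (simp add: sum_subtractf)
    then show "?q (exp_vec m - exp_vec (Poly_Mapping.single undefined N)) \<in> ?q ` sum_zero_vectors" by blast
  qed
  finally show "card (?q ` sum_zero_vectors) = \<kappa>"
    using bound'[OF subset_refl fin] by simp
qed

lemma quotient_degree_eq_card_cosets:
  "quotient_degree (lattice_ideal A :: ('v, 'k::field) mpoly set)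
    = real (card (int_coset lattice ` sum_zero_vectors))"
  "quotient_degree (lattice_ideal lattice :: ('v, 'k::field) mpoly set)
    = real (card (int_coset lattice ` sum_zero_vectors))"
proof -
  obtain N \<kappa> where st: "stable_from N \<kappa>" using ex_stable_from by blast
  show "quotient_degree (lattice_ideal A :: ('v, 'k) mpoly set)
      = real (card (int_coset lattice ` sum_zero_vectors))"
    using quotient_degree_lattice_ideal[OF st] finite_cosets_and_card(2)[OF st] by simp
  show "quotient_degree (lattice_ideal lattice :: ('v, 'k) mpoly set)
      = real (card (int_coset lattice ` sum_zero_vectors))"
    using graded_binomials.quotient_degree_lattice_ideal[OF graded_binomials_lattice stable_from_lattice[OF st]]
      finite_cosets_and_card(2)[OF st] by simp
qed

text \<open>The coordinate sum is an integer-valued homomorphism on the quotient, so it vanishes on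
  torsion. Conversely, the multiples of a sum-zero class stay among finitely many classes, and two
  of them coincide.\<close>

lemma order_torsion_subgroup:
  "Coset.order (torsion_subgroup (int_vec_group Mod lattice)) = card (int_coset lattice ` sum_zero_vectors)"
proof -
  let ?G = "int_vec_group :: (int^'v) monoid" and ?q = "int_coset lattice"
  have sub: "subgroup lattice ?G" by (rule subgroup_generate)
  have comm: "comm_group ?G"
    by (rule group.group_comm_groupI[OF group_int_vec_group]) simp
  have normal: "lattice \<lhd> ?G"
    by (rule comm_group.normal_iff_subgroup[OF comm, THEN iffD2, OF sub])
  have rcos: "lattice #>\<^bsub>?G\<^esub> x = ?q x" for x
  proof -
    have "y \<in> lattice #>\<^bsub>?G\<^esub> x \<longleftrightarrow> y - x \<in> lattice" for y
      by (auto simp: r_coset_def) (metis diff_add_cancel)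
    then show ?thesis by (auto simp: int_coset_def)
  qed
  have carr: "carrier (?G Mod lattice) = range ?q"
    by (auto simp: FactGroup_def RCOSETS_def rcos)
  have one: "\<one>\<^bsub>?G Mod lattice\<^esub> = ?q 0"
    by (auto simp: FactGroup_def int_coset_def)
  have mult: "?q x \<otimes>\<^bsub>?G Mod lattice\<^esub> ?q y = ?q (x + y)" for x y
    using normal.rcos_sum[OF normal, of x y] by (simp add: FactGroup_def rcos)
  have pow: "?q x [^]\<^bsub>?G Mod lattice\<^esub> n = ?q (of_nat n *s x)" for x and n :: nat
  proof (induction n)
    case 0
    then show ?case using one by (simp add: nat_pow_def vec_eq_iff)
  next
    case (Suc n)
    have "of_nat n *s x + x = of_nat (Suc n) *s x" by (simp add: vec_eq_iff algebra_simps)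
    then show ?case using Suc mult[of "of_nat n *s x" x] by (simp add: nat_pow_def)
  qed
  have tors: "(\<exists>n>0. ?q x [^]\<^bsub>?G Mod lattice\<^esub> (n::nat) = \<one>\<^bsub>?G Mod lattice\<^esub>) \<longleftrightarrow> x \<in> sum_zero_vectors" for x
  proof
    assume "\<exists>n>0. ?q x [^]\<^bsub>?G Mod lattice\<^esub> (n::nat) = \<one>\<^bsub>?G Mod lattice\<^esub>"
    then obtain n where n: "n > 0" "of_nat n *s x \<in> lattice"
      unfolding pow one int_coset_eq_iff[OF sub] by auto
    then have "(\<Sum>i\<in>UNIV. (of_nat n *s x) $ i) = 0"
      using graded_binomials.deg_zero[OF graded_binomials_lattice] by blast
    then have "int n * (\<Sum>i\<in>UNIV. x $ i) = 0" by (simp add: sum_distrib_left)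
    then show "x \<in> sum_zero_vectors" using n(1) by (simp add: sum_zero_vectors_def)
  next
    assume x: "x \<in> sum_zero_vectors"
    obtain N \<kappa> where st: "stable_from N \<kappa>" using ex_stable_from by blast
    have "of_nat n *s x \<in> sum_zero_vectors" for n
      using x by (simp add: sum_zero_vectors_def sum_distrib_left[symmetric])
    then have "range (\<lambda>n::nat. ?q (of_nat n *s x)) \<subseteq> ?q ` sum_zero_vectors" by blast
    then have "finite (range (\<lambda>n::nat. ?q (of_nat n *s x)))"
      using finite_cosets_and_card(1)[OF st] finite_subset by blast
    then have "\<not> inj (\<lambda>n::nat. ?q (of_nat n *s x))"
      using finite_imageD by fastforce
    then obtain k l :: nat where kl: "k \<noteq> l" "?q (of_nat k *s x) = ?q (of_nat l *s x)"
      by (auto simp: inj_on_def)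
    have *: "?q (of_nat (a - b) *s x) = ?q 0" if "b < a" "?q (of_nat a *s x) = ?q (of_nat b *s x)" for a b :: nat
    proof -
      have "of_nat (a - b) *s x = of_nat a *s x - of_nat b *s x"
        using that(1) by (simp add: vec_eq_iff of_nat_diff algebra_simps)
      then show ?thesis using that(2) unfolding int_coset_eq_iff[OF sub] by simp
    qed
    have "\<exists>n::nat>0. ?q (of_nat n *s x) = ?q 0"
    proof (cases "k < l")
      case True
      then show ?thesis using *[of k l] kl by (intro exI[of _ "l - k"]) auto
    next
      case False
      then show ?thesis using *[of l k] kl by (intro exI[of _ "k - l"]) auto
    qed
    then show "\<exists>n>0. ?q x [^]\<^bsub>?G Mod lattice\<^esub> (n::nat) = \<one>\<^bsub>?G Mod lattice\<^esub>"
      unfolding pow one .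
  qed
  have "carrier (torsion_subgroup (?G Mod lattice)) = ?q ` sum_zero_vectors"
    using tors by (auto simp: torsion_subgroup_def carr)
  then show ?thesis by (simp add: Coset.order_def)
qed

text \<open>By \<open>isolated\<close> no move applies to the positive part of \<open>a\<close>, so
  its class is a singleton. A subgroup \<open>H\<close> with the same ideal would contain
  \<open>A\<close>, hence \<open>a\<close>, and would join the positive part of \<open>a\<close> to
  its negative part.\<close>

lemma not_lattice_ideal:
  assumes a: "a \<in> lattice" "a \<noteq> 0"
    and isolated: "\<And>b c. b \<in> A \<Longrightarrow> c + pos_exponent b \<noteq> pos_exponent a"
      "\<And>b c. b \<in> A \<Longrightarrow> c + pos_exponent (- b) \<noteq> pos_exponent a"
  shows "\<not> is_lattice_ideal (lattice_ideal A :: ('v, 'k::field) mpoly set)"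
proof
  assume "is_lattice_ideal (lattice_ideal A :: ('v, 'k) mpoly set)"
  then obtain H where H: "subgroup H int_vec_group" "(lattice_ideal A :: ('v, 'k) mpoly set) = lattice_ideal H"
    unfolding is_lattice_ideal_def by blast
  have cong: "bcong A m n \<longleftrightarrow> exp_vec m - exp_vec n \<in> H" for m n
    using monomial_diff_mem_iff[where 'k = 'k, of m n A] monomial_diff_mem_iff[where 'k = 'k, of m n H]
    by (simp add: H(2) bcong_lattice_iff[OF H(1)])
  have "A \<subseteq> H"
  proof
    fix b assume "b \<in> A"
    from bcong_base[OF this, of 0] show "b \<in> H" by (simp add: cong exp_vec_pos_exponent)
  qed
  then have "lattice \<subseteq> H"
    by (intro group.generate_subgroup_incl[OF group_int_vec_group _ H(1)])
  then have "bcong A (pos_exponent a) (pos_exponent (- a))"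
    using a by (auto simp: cong exp_vec_pos_exponent)
  moreover have "m = pos_exponent a \<longleftrightarrow> n = pos_exponent a" if "bcong A m n" for m n
    using that by (induction rule: bcong.induct) (use isolated in auto)
  ultimately have "pos_exponent (- a) = pos_exponent a" by blast
  then have "a = 0" using exp_vec_pos_exponent[of a] by simp
  then show False using a(2) by simp
qed

end

section \<open>The Laplacian of a weighted graph\<close>

text \<open>Reconciles the group generated by the columns with the image of the matrix, through
  which the critical group is defined.\<close>

lemma column_lattice_eq_range:
  fixes M :: "int^'v::finite^'v"
  shows "column_lattice M = range (\<lambda>x. M *v x)"
proof
  have sub: "subgroup (column_lattice M) int_vec_group"
    unfolding column_lattice_def by (rule subgroup_generate)
  have H: "0 \<in> column_lattice M" "\<And>x y. x \<in> column_lattice M \<Longrightarrow> y \<in> column_lattice M \<Longrightarrow> x + y \<in> column_lattice M"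
    "\<And>x. x \<in> column_lattice M \<Longrightarrow> - x \<in> column_lattice M"
    using sub by (auto simp: subgroup_int_vec_iff)
  have nat_mult: "of_nat n *s x \<in> column_lattice M" if "x \<in> column_lattice M" for n x
  proof (induction n)
    case (Suc n)
    have "of_nat (Suc n) *s x = of_nat n *s x + x" by (simp add: vec_eq_iff algebra_simps)
    then show ?case using H(2)[OF Suc that] by simp
  qed (simp add: H(1))
  have mult: "c *s x \<in> column_lattice M" if "x \<in> column_lattice M" for c x
  proof (cases "c \<ge> 0")
    case True
    then show ?thesis using nat_mult[OF that, of "nat c"] by simp
  next
    case False
    then have "c *s x = - (of_nat (nat (- c)) *s x)" by (simp add: vec_eq_iff)
    then show ?thesis using H(3)[OF nat_mult[OF that]] by metis
  qed
  have sum: "(\<And>i. i \<in> T \<Longrightarrow> g i \<in> column_lattice M) \<Longrightarrow> sum g T \<in> column_lattice M" for g :: "'v \<Rightarrow> int^'v" and T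
    by (induction T rule: infinite_finite_induct) (auto simp: H)
  have col: "column j M \<in> column_lattice M" for j
    unfolding column_lattice_def by (rule generate.incl) (auto simp: columns_def)
  show "range (\<lambda>x. M *v x) \<subseteq> column_lattice M"
    by (auto simp: matrix_mult_sum intro!: sum mult col)
  show "column_lattice M \<subseteq> range (\<lambda>x. M *v x)"
    unfolding column_lattice_def
  proof (rule group.generate_subgroup_incl[OF group_int_vec_group])
    have "column j M = M *v axis j 1" for j
      by (simp add: vec_eq_iff matrix_vector_mult_def column_def axis_def if_distrib sum.delta cong: if_cong)
    then show "columns M \<subseteq> range (\<lambda>x. M *v x)"
      unfolding columns_def by blast
    have add: "M *v x + M *v y = M *v (x + y)" and neg: "- (M *v x) = M *v (- x)" and zero: "0 = M *v 0" for x y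
      by (simp_all add: vec_eq_iff matrix_vector_mult_def sum_negf sum.distrib distrib_left)
    show "subgroup (range (\<lambda>x. M *v x)) int_vec_group"
      unfolding subgroup_int_vec_iff
    proof (intro conjI ballI)
      show "0 \<in> range (\<lambda>x. M *v x)" by (rule range_eqI, rule zero)
      show "x + y \<in> range (\<lambda>x. M *v x)" if "x \<in> range (\<lambda>x. M *v x)" "y \<in> range (\<lambda>x. M *v x)" for x y
        using that by (elim rangeE) (simp only: add rangeI)
      show "- x \<in> range (\<lambda>x. M *v x)" if "x \<in> range (\<lambda>x. M *v x)" for x
        using that by (elim rangeE) (simp only: neg rangeI)
    qed
  qed
qed

locale weighted_graph =
  fixes E :: "'v::finite set set" and w :: "'v set \<Rightarrow> nat"
  assumes simple: "simple_graph E" and connected: "connected_graph E" and weight_pos: "\<forall>e\<in>E. w e > 0"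
begin

definition nbrs :: "'v \<Rightarrow> 'v set" where
  "nbrs j = {i. {i, j} \<in> E}"

definition wdeg :: "'v \<Rightarrow> nat" where
  "wdeg j = (\<Sum>i\<in>nbrs j. w {i, j})"

lemma not_self_nbr [simp]: "j \<notin> nbrs j" "{j} \<notin> E"
proof -
  show "{j} \<notin> E"
  proof
    assume "{j} \<in> E"
    then have "card {j} = 2" using simple unfolding simple_graph_def by blast
    then show False by simp
  qed
  then show "j \<notin> nbrs j" by (simp add: nbrs_def)
qed

lemma nbrs_sym: "i \<in> nbrs j \<longleftrightarrow> j \<in> nbrs i"
  by (simp add: nbrs_def insert_commute)

lemma incident_edges_eq: "incident_edges E j = (\<lambda>i. {i, j}) ` nbrs j"
proof
  show "incident_edges E j \<subseteq> (\<lambda>i. {i, j}) ` nbrs j"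
  proof
    fix e assume "e \<in> incident_edges E j"
    then have e: "e \<in> E" "j \<in> e" "card e = 2" using simple by (auto simp: incident_edges_def simple_graph_def)
    then obtain x y where "e = {x, y}" by (auto simp: card_2_iff)
    then have "e = {x, j} \<or> e = {y, j}" using e(2) by auto
    then show "e \<in> (\<lambda>i. {i, j}) ` nbrs j" using e(1) by (auto simp: nbrs_def)
  qed
qed (auto simp: incident_edges_def nbrs_def)

lemma inj_on_edge: "inj_on (\<lambda>i. {i, j}) S"
  by (auto simp: inj_on_def doubleton_eq_iff)

lemma card_incident_edges: "card (incident_edges E j) = card (nbrs j)"
  unfolding incident_edges_eq by (rule card_image[OF inj_on_edge])

lemma laplacian_nth:
  "laplacian E w $ i $ j = (if i = j then int (wdeg j) else if i \<in> nbrs j then - int (w {i, j}) else 0)"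
proof -
  have "(\<Sum>e\<in>incident_edges E j. int (w e)) = int (wdeg j)"
    unfolding incident_edges_eq wdeg_def by (simp add: sum.reindex[OF inj_on_edge])
  then show ?thesis by (simp add: laplacian_def nbrs_def)
qed

text \<open>In terms of differences across edges, the image of an indicator vector is visible: only
  edges with exactly one end in the set contribute.\<close>

lemma laplacian_mult:
  "(laplacian E w *v y) $ i = (\<Sum>j\<in>nbrs i. int (w {j, i}) * (y $ i - y $ j))"
proof -
  have "(laplacian E w *v y) $ i = (\<Sum>j\<in>UNIV. laplacian E w $ i $ j * y $ j)"
    by (simp add: matrix_vector_mult_def)
  also have "\<dots> = int (wdeg i) * y $ i + (\<Sum>j\<in>UNIV - {i}. laplacian E w $ i $ j * y $ j)"
    by (subst sum.remove[of UNIV i]) (simp_all add: laplacian_nth)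
  also have "(\<Sum>j\<in>UNIV - {i}. laplacian E w $ i $ j * y $ j) = (\<Sum>j\<in>nbrs i. laplacian E w $ i $ j * y $ j)"
    by (rule sum.mono_neutral_right) (auto simp: laplacian_nth nbrs_sym)
  also have "\<dots> = (\<Sum>j\<in>nbrs i. - (int (w {j, i}) * y $ j))"
    by (rule sum.cong) (auto simp: laplacian_nth nbrs_sym insert_commute)
  finally show ?thesis
    by (simp add: wdeg_def sum_distrib_right right_diff_distrib sum_subtractf sum_negf)
qed

definition lap_column :: "'v \<Rightarrow> int^'v" where
  "lap_column j = column j (laplacian E w)"

lemma lap_column_nth:
  "lap_column j $ i = (if i = j then int (wdeg j) else if i \<in> nbrs j then - int (w {i, j}) else 0)"
  by (simp add: lap_column_def column_def laplacian_nth)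

lemma columns_laplacian: "columns (laplacian E w) = range lap_column"
  by (auto simp: columns_def lap_column_def)

lemma sum_lap_column: "(\<Sum>i\<in>UNIV. lap_column j $ i) = 0"
proof -
  have "(\<Sum>i\<in>UNIV. lap_column j $ i) = int (wdeg j) + (\<Sum>i\<in>UNIV - {j}. lap_column j $ i)"
    by (subst sum.remove[of UNIV j]) (simp_all add: lap_column_nth)
  also have "(\<Sum>i\<in>UNIV - {j}. lap_column j $ i) = (\<Sum>i\<in>nbrs j. lap_column j $ i)"
    by (rule sum.mono_neutral_right) (auto simp: lap_column_nth)
  also have "\<dots> = (\<Sum>i\<in>nbrs j. - int (w {i, j}))"
    by (rule sum.cong) (auto simp: lap_column_nth)
  finally show ?thesis by (simp add: wdeg_def sum_negf)
qed

lemma weight_nbr_pos: "i \<in> nbrs j \<Longrightarrow> w {i, j} > 0"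
  using weight_pos by (simp add: nbrs_def)

lemma pos_exponent_lap_column: "pos_exponent (lap_column j) = Poly_Mapping.single j (wdeg j)"
  by (rule poly_mapping_eqI) (simp add: lap_column_nth lookup_single when_def)

lemma lookup_neg_lap_column:
  "Poly_Mapping.lookup (pos_exponent (- lap_column j)) i = (if i \<in> nbrs j then w {i, j} else 0)"
  by (simp add: lap_column_nth)

text \<open>Each toppling of \<open>j\<close> sends at least one chip to \<open>k\<close>, so enough
  of them produce any prescribed power of the variable of \<open>k\<close>. A prescribed power, not
  just one factor, is needed to continue along a path.\<close>

lemma absorb_nbr:
  assumes "k \<in> nbrs j"
  shows "\<exists>d y. bcong (columns (laplacian E w)) (Poly_Mapping.single j d) (Poly_Mapping.single k n + y)"
proof (induction n)
  case 0
  then show ?case by (intro exI[of _ 0]) (auto intro: bcong_refl)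
next
  case (Suc n)
  let ?A = "columns (laplacian E w)" and ?q = "pos_exponent (- lap_column j)"
  obtain d y where dy: "bcong ?A (Poly_Mapping.single j d) (Poly_Mapping.single k n + y)" using Suc by blast
  have base: "bcong ?A (Poly_Mapping.single j (wdeg j)) ?q"
    using bcong_base[of "lap_column j" ?A 0] by (simp add: columns_laplacian pos_exponent_lap_column)
  have q: "?q = Poly_Mapping.single k 1 + (?q - Poly_Mapping.single k 1)"
    using weight_nbr_pos[OF assms] assms by (intro exp_split) (simp only: lookup_neg_lap_column, simp)
  have "bcong ?A (Poly_Mapping.single j (wdeg j)) (Poly_Mapping.single k 1 + (?q - Poly_Mapping.single k 1))"
    unfolding q[symmetric] by (rule base)
  from bcong_add[OF this dy] have "bcong ?A (Poly_Mapping.single j (wdeg j + d))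
      (Poly_Mapping.single k (Suc n) + ((?q - Poly_Mapping.single k 1) + y))"
    by (simp only: single_add add.assoc add.left_commute Suc_eq_plus1_left)
  then show ?case by blast
qed

sublocale graded_binomials "columns (laplacian E w)"
proof
  let ?A = "columns (laplacian E w)"
  show "\<forall>a\<in>?A. (\<Sum>i\<in>UNIV. a $ i) = 0"
    by (auto simp: columns_laplacian sum_lap_column)
  fix j i :: 'v
  have "(i, j) \<in> {(x, y). {x, y} \<in> E}\<^sup>*" using connected by (simp add: connected_graph_def)
  then show "\<exists>n m. bcong ?A (Poly_Mapping.single j n) (Poly_Mapping.single i 1 + m)"
  proof (induction rule: rtrancl_induct)
    case base
    show ?case by (intro exI[of _ 1] exI[of _ 0]) (simp add: bcong_refl)
  next
    case (step k j)
    then have kj: "k \<in> nbrs j" by (simp add: nbrs_def)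
    obtain n m where nm: "bcong ?A (Poly_Mapping.single k n) (Poly_Mapping.single i 1 + m)" using step by blast
    obtain d y where "bcong ?A (Poly_Mapping.single j d) (Poly_Mapping.single k n + y)"
      using absorb_nbr[OF kj] by blast
    moreover have "bcong ?A (Poly_Mapping.single k n + y) (Poly_Mapping.single i 1 + m + y)"
      by (rule bcong_add[OF nm bcong_refl])
    ultimately have "bcong ?A (Poly_Mapping.single j d) (Poly_Mapping.single i 1 + (m + y))"
      using bcong_trans by (simp only: add.assoc) blast
    then show ?case by blast
  qed
qed

lemma lattice_eq_range: "lattice = range (\<lambda>y. laplacian E w *v y)"
  using column_lattice_eq_range[of "laplacian E w"] by (simp add: column_lattice_def)

lemma laplacian_ideal_eq: "laplacian_ideal E w = lattice_ideal (columns (laplacian E w))"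
  by (simp add: laplacian_ideal_def lattice_ideal_def)

lemma not_lattice_ideal_of_degree_ge_3:
  assumes deg: "\<And>j. card (incident_edges E j) \<ge> 3"
  shows "\<not> is_lattice_ideal (laplacian_ideal E w :: ('v, 'k::field) mpoly set)"
proof -
  fix i0 :: 'v
  have card: "card (nbrs j) \<ge> 3" for j using deg[of j] by (simp add: card_incident_edges)
  then have "nbrs i0 \<noteq> {}" by (metis card.empty not_numeral_le_zero)
  then obtain j0 where j0: "j0 \<in> nbrs i0" by blast
  have ne: "i0 \<noteq> j0" and i0: "i0 \<in> nbrs j0" using j0 nbrs_sym by auto
  have wdeg_gt: "w {i, j} < wdeg j" if "i \<in> nbrs j" for i j
  proof -
    have "\<not> nbrs j \<subseteq> {i}" using card[of j] card_mono[of "{i}" "nbrs j"] by auto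
    then obtain k where k: "k \<in> nbrs j" "k \<noteq> i" by blast
    have "w {i, j} < w {i, j} + w {k, j}" using weight_nbr_pos[OF k(1)] by simp
    also have "\<dots> = (\<Sum>l\<in>{i, k}. w {l, j})" using k(2) by simp
    also have "\<dots> \<le> wdeg j" unfolding wdeg_def using that k(1) by (intro sum_mono2) auto
    finally show ?thesis .
  qed
  \<comment> \<open>Adding two adjacent columns subtracts the weight of the shared edge from both
    diagonal entries and makes no other entry positive.\<close>
  let ?a = "lap_column i0 + lap_column j0"
  have lookup_a: "Poly_Mapping.lookup (pos_exponent ?a) k =
      (if k = i0 then wdeg i0 - w {i0, j0} else if k = j0 then wdeg j0 - w {i0, j0} else 0)" for k
    using wdeg_gt[OF j0, unfolded insert_commute[of j0 i0 "{}"]] wdeg_gt[OF i0] ne i0 j0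
    by (auto simp: lap_column_nth insert_commute nat_diff_distrib)
  show ?thesis
    unfolding laplacian_ideal_eq
  proof (rule not_lattice_ideal[of ?a])
    have "lap_column i0 \<in> lattice" "lap_column j0 \<in> lattice"
      by (auto intro!: generate.incl simp: columns_laplacian)
    then show "?a \<in> lattice" using generate.eng[of "lap_column i0" int_vec_group _ "lap_column j0"] by simp
    have "?a $ i0 > 0" using wdeg_gt[OF j0] ne i0 j0 by (simp add: lap_column_nth insert_commute)
    then show "?a \<noteq> 0" by (metis less_irrefl zero_index)
  next
    fix b :: "int^'v" and c assume "b \<in> columns (laplacian E w)"
    then obtain k where b: "b = lap_column k" by (auto simp: columns_laplacian)
    show "c + pos_exponent b \<noteq> pos_exponent ?a"
    proof
      assume eq: "c + pos_exponent b = pos_exponent ?a"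
      have "wdeg k \<le> Poly_Mapping.lookup (c + pos_exponent b) k"
        unfolding b pos_exponent_lap_column by (simp add: lookup_add)
      also have "\<dots> < wdeg k"
      proof -
        have "\<exists>l. l \<in> nbrs k" using card[of k] by (metis all_not_in_conv card.empty not_numeral_le_zero)
        then have "wdeg k > 0" using wdeg_gt[of _ k] by fastforce
        moreover have "w {i0, j0} > 0" using weight_nbr_pos[OF i0] .
        ultimately show ?thesis unfolding eq lookup_a by auto
      qed
      finally show False by simp
    qed
    show "c + pos_exponent (- b) \<noteq> pos_exponent ?a"
    proof
      assume eq: "c + pos_exponent (- b) = pos_exponent ?a"
      \<comment> \<open>Divisibility by a negative part would confine the three or more neighbours
        of \<open>k\<close> to the two vertices that support the positive part of
        \<open>?a\<close>.\<close>
      have "nbrs k \<subseteq> {i0, j0}"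
      proof
        fix l assume l: "l \<in> nbrs k"
        have "0 < w {l, k}" by (rule weight_nbr_pos[OF l])
        also have "\<dots> \<le> Poly_Mapping.lookup (c + pos_exponent (- b)) l"
          unfolding b lookup_add lookup_neg_lap_column using l by simp
        finally show "l \<in> {i0, j0}" unfolding eq lookup_a by (auto split: if_splits)
      qed
      then have "card (nbrs k) \<le> card {i0, j0}" by (intro card_mono) auto
      also have "\<dots> \<le> 2" using ne by simp
      finally show False using card[of k] by simp
    qed
  qed
qed

lemma one_coset:
  assumes "sum_zero_vectors \<subseteq> lattice"
  shows "card (int_coset lattice ` sum_zero_vectors) = 1"
proof -
  have "0 \<in> sum_zero_vectors" by (simp add: sum_zero_vectors_def)
  moreover have "int_coset lattice x = int_coset lattice 0" if "x \<in> sum_zero_vectors" for x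
    using that assms by (auto simp: int_coset_eq_iff[OF subgroup_generate])
  ultimately have "int_coset lattice ` sum_zero_vectors = {int_coset lattice 0}" by auto
  then show ?thesis by simp
qed

end

section \<open>Complete graphs and trees\<close>

text \<open>A coset is determined by the residues modulo s of the differences to the coordinate at
  \<open>v0\<close>. Of these s - 2 are free, because the coordinate at \<open>v1\<close> is spent
  on the sum condition.\<close>

lemma card_cosets_complete_graph:
  fixes w :: "'v::finite set \<Rightarrow> nat"
  assumes "weighted_graph complete_graph_edges w" and w1: "\<And>e. e \<in> complete_graph_edges \<Longrightarrow> w e = 1"
    and two: "CARD('v) \<ge> 2"
  shows "card (int_coset (column_lattice (laplacian complete_graph_edges w)) ` sum_zero_vectors)
    = CARD('v) ^ (CARD('v) - 2)"
proof -
  interpret weighted_graph complete_graph_edges w by (rule assms(1))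
  let ?s = "int CARD('v)"
  have nbrs: "nbrs i = UNIV - {i}" for i
    unfolding nbrs_def by (auto simp: complete_graph_edges_def doubleton_eq_iff)
  have mult: "(laplacian complete_graph_edges w *v y) $ i = ?s * y $ i - (\<Sum>j\<in>UNIV. y $ j)" for y i
  proof -
    have "(laplacian complete_graph_edges w *v y) $ i = (\<Sum>j\<in>UNIV - {i}. y $ i - y $ j)"
      unfolding laplacian_mult nbrs using w1
      by (intro sum.cong) (auto simp: complete_graph_edges_def)
    also have "\<dots> = (\<Sum>j\<in>UNIV. y $ i - y $ j)"
      by (rule sum.mono_neutral_left) auto
    finally show ?thesis by (simp add: sum_subtractf)
  qed
  have "\<not> UNIV \<subseteq> {undefined :: 'v}" using two card_mono[of "{undefined :: 'v}" UNIV] by auto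
  then obtain v0 v1 :: 'v where v: "v0 \<noteq> v1" by blast
  \<comment> \<open>The lattice consists of the sum-zero vectors whose coordinates are all congruent modulo
    \<open>s\<close>; the condition at \<open>v1\<close> follows from the others because the sum is zero.\<close>
  have lat: "z \<in> lattice \<longleftrightarrow> (\<forall>i\<in>UNIV - {v0, v1}. ?s dvd z $ i - z $ v0)" if z: "z \<in> sum_zero_vectors" for z
  proof
    assume "z \<in> lattice"
    then obtain y where y: "z = laplacian complete_graph_edges w *v y" unfolding lattice_eq_range by blast
    have "z $ i - z $ v0 = ?s * (y $ i - y $ v0)" for i
      unfolding y mult by (simp add: algebra_simps)
    then show "\<forall>i\<in>UNIV - {v0, v1}. ?s dvd z $ i - z $ v0" by simp
  next
    assume a: "\<forall>i\<in>UNIV - {v0, v1}. ?s dvd z $ i - z $ v0"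
    have sum: "(\<Sum>i\<in>UNIV. z $ i - z $ v0) = - ?s * z $ v0"
      using z by (simp add: sum_subtractf sum_zero_vectors_def)
    have "(\<Sum>i\<in>UNIV. z $ i - z $ v0) = (z $ v1 - z $ v0) + (\<Sum>i\<in>UNIV - {v1}. z $ i - z $ v0)"
      by (rule sum.remove) auto
    moreover have "?s dvd (\<Sum>i\<in>UNIV - {v1}. z $ i - z $ v0)"
      using a by (intro dvd_sum) (metis Diff_iff UNIV_I diff_self dvd_0_right insertE singletonI)
    ultimately have "?s dvd z $ v1 - z $ v0"
      using sum by (metis dvd_add_left_iff dvd_minus_iff dvd_triv_left mult_minus_left)
    then have all: "?s dvd z $ i - z $ v0" for i
      using a by (cases "i = v0"; cases "i = v1") auto
    define y :: "int^'v" where "y = (\<chi> i. (z $ i - z $ v0) div ?s)"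
    have y: "?s * y $ i = z $ i - z $ v0" for i using all[of i] by (simp add: y_def)
    have "?s * (\<Sum>i\<in>UNIV. y $ i) = - ?s * z $ v0"
      unfolding sum_distrib_left y by (rule sum)
    then have "?s * (\<Sum>i\<in>UNIV. y $ i) = ?s * (- z $ v0)" by simp
    then have "(\<Sum>i\<in>UNIV. y $ i) = - z $ v0" unfolding mult_cancel_left by simp
    then have "laplacian complete_graph_edges w *v y = z"
      by (simp add: vec_eq_iff mult y)
    then show "z \<in> lattice" unfolding lattice_eq_range by blast
  qed
  let ?F = "\<lambda>x :: int^'v. restrict (\<lambda>i. (x $ i - x $ v0) mod ?s) (UNIV - {v0, v1})"
  have "card (int_coset lattice ` sum_zero_vectors) = card (?F ` sum_zero_vectors)"
  proof (rule card_image_eq_if_same_kernel)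
    fix x y :: "int^'v" assume xy: "x \<in> sum_zero_vectors" "y \<in> sum_zero_vectors"
    then have "x - y \<in> sum_zero_vectors" by (simp add: sum_zero_vectors_def sum_subtractf)
    then have "int_coset lattice x = int_coset lattice y \<longleftrightarrow>
        (\<forall>i\<in>UNIV - {v0, v1}. ?s dvd (x $ i - y $ i) - (x $ v0 - y $ v0))"
      unfolding int_coset_eq_iff[OF subgroup_generate] by (simp add: lat)
    also have "\<dots> \<longleftrightarrow> (\<forall>i\<in>UNIV - {v0, v1}. (x $ i - x $ v0) mod ?s = (y $ i - y $ v0) mod ?s)"
      unfolding mod_eq_dvd_iff by (simp add: algebra_simps)
    also have "\<dots> \<longleftrightarrow> ?F x = ?F y"
      by (auto simp: fun_eq_iff restrict_def)
    finally show "int_coset lattice x = int_coset lattice y \<longleftrightarrow> ?F x = ?F y" .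
  qed
  also have "?F ` sum_zero_vectors = (UNIV - {v0, v1}) \<rightarrow>\<^sub>E {0..<?s}"
  proof
    show "?F ` sum_zero_vectors \<subseteq> (UNIV - {v0, v1}) \<rightarrow>\<^sub>E {0..<?s}"
    proof (rule image_subsetI, rule PiE_I)
      fix x :: "int^'v" and i :: 'v
      show "?F x i \<in> {0..<?s}" if "i \<in> UNIV - {v0, v1}"
        using that by simp
      show "?F x i = undefined" if "i \<notin> UNIV - {v0, v1}"
        using that by (simp only: restrict_apply if_False)
    qed
    show "(UNIV - {v0, v1}) \<rightarrow>\<^sub>E {0..<?s} \<subseteq> ?F ` sum_zero_vectors"
    proof
      fix g assume g: "g \<in> (UNIV - {v0, v1}) \<rightarrow>\<^sub>E {0..<?s}"
      \<comment> \<open>The entry at \<open>v1\<close> makes the sum zero and is invisible to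
        \<open>?F\<close>.\<close>
      define x :: "int^'v" where
        "x = (\<chi> i. if i = v0 then 0 else if i = v1 then - (\<Sum>i\<in>UNIV - {v0, v1}. g i) else g i)"
      have "(\<Sum>i\<in>UNIV. x $ i) = (\<Sum>i\<in>{v0, v1}. x $ i) + (\<Sum>i\<in>UNIV - {v0, v1}. x $ i)"
        by (subst add.commute) (rule sum.subset_diff, auto)
      also have "(\<Sum>i\<in>UNIV - {v0, v1}. x $ i) = (\<Sum>i\<in>UNIV - {v0, v1}. g i)"
        by (rule sum.cong) (auto simp: x_def)
      finally have "x \<in> sum_zero_vectors" using v by (simp add: sum_zero_vectors_def x_def)
      moreover have "g = ?F x"
      proof
        fix i show "g i = ?F x i"
        proof (cases "i \<in> UNIV - {v0, v1}")
          case True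
          then have "g i \<in> {0..<?s}" using g by (rule PiE_mem[rotated])
          then show ?thesis using True by (simp add: x_def)
        next
          case False
          then show ?thesis using g by (auto simp: PiE_def extensional_def)
        qed
      qed
      ultimately show "g \<in> ?F ` sum_zero_vectors" by blast
    qed
  qed
  also have "card ((UNIV - {v0, v1}) \<rightarrow>\<^sub>E {0..<?s}) = CARD('v) ^ (CARD('v) - 2)"
    using v by (simp add: card_PiE card_Diff_subset numeral_2_eq_2)
  finally show ?thesis by (simp add: column_lattice_def)
qed

text \<open>If the new end point was visited before, the path is cut back to it instead of being
  extended.\<close>

lemma rtrancl_distinct_path:
  assumes "(u, z) \<in> R\<^sup>*"
  shows "\<exists>p. p \<noteq> [] \<and> hd p = u \<and> last p = z \<and> distinct p \<and>
    (\<forall>i. Suc i < length p \<longrightarrow> (p ! i, p ! Suc i) \<in> R)"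
  using assms
proof (induction rule: rtrancl_induct)
  case base
  show ?case by (intro exI[of _ "[u]"]) simp
next
  case (step y z)
  then obtain p where p: "p \<noteq> []" "hd p = u" "last p = y" "distinct p"
    "\<And>i. Suc i < length p \<Longrightarrow> (p ! i, p ! Suc i) \<in> R" by blast
  show ?case
  proof (cases "z \<in> set p")
    case True
    then obtain p1 p2 where split: "p = p1 @ z # p2" by (auto simp: in_set_conv_decomp)
    let ?q = "p1 @ [z]"
    have "?q ! i = p ! i" if "i < length ?q" for i
      using that by (auto simp: split nth_append)
    then have "(?q ! i, ?q ! Suc i) \<in> R" if "Suc i < length ?q" for i
      using p(5)[of i] that by (simp add: split)
    moreover have "hd ?q = u" using p(2) by (cases p1) (simp_all add: split)
    ultimately show ?thesis using p(4) by (intro exI[of _ ?q]) (auto simp: split)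
  next
    case False
    let ?q = "p @ [z]"
    have "(?q ! i, ?q ! Suc i) \<in> R" if "Suc i < length ?q" for i
    proof (cases "Suc i < length p")
      case True
      then show ?thesis using p(5)[of i] by (simp add: nth_append)
    next
      case False
      then have i: "i = length p - 1" "length p > 0" using that p(1) by auto
      then have "?q ! i = y" "?q ! Suc i = z" using p(1,3) by (auto simp: nth_append last_conv_nth)
      then show ?thesis using step(2) by simp
    qed
    then show ?thesis using p False by (intro exI[of _ ?q]) auto
  qed
qed

lemma tree_edge_in_lattice:
  fixes E :: "'v::finite set set"
  assumes "weighted_graph E w" and tree: "tree_graph E" and w1: "\<And>e. e \<in> E \<Longrightarrow> w e = 1"
    and uv: "{u, v} \<in> E"
  shows "axis u 1 - axis v 1 \<in> column_lattice (laplacian E w)"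
proof -
  interpret weighted_graph E w by (rule assms(1))
  have ne: "u \<noteq> v" using uv by auto
  \<comment> \<open>Deleting the edge separates \<open>u\<close> from \<open>v\<close>; the columns over the component of \<open>u\<close> add up to
    the difference of the two unit vectors.\<close>
  let ?R = "{(x, y). {x, y} \<in> E - {{u, v}}}"
  define C where "C = {z. (u, z) \<in> ?R\<^sup>*}"
  have uC: "u \<in> C" by (simp add: C_def)
  have vC: "v \<notin> C"
  proof
    assume "v \<in> C"
    then obtain p where p: "p \<noteq> []" "hd p = u" "last p = v" "distinct p"
      "\<And>i. Suc i < length p \<Longrightarrow> (p ! i, p ! Suc i) \<in> ?R"
      using rtrancl_distinct_path[of u v ?R] unfolding C_def by blast
    have p0: "p ! 0 = u" and pl: "p ! (length p - 1) = v"
      using p(1-3) by (simp_all add: hd_conv_nth last_conv_nth)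
    \<comment> \<open>A single vertex is impossible since \<open>u\<close> and \<open>v\<close>
      differ, and two vertices since their edge was deleted. So closing the path with that edge
      gives a genuine cycle.\<close>
    have "length p \<noteq> 1" using p0 pl ne by auto
    moreover have "length p \<noteq> 2" using p(5)[of 0] p0 pl by auto
    moreover have "length p \<noteq> 0" using p(1) by simp
    ultimately have len: "3 \<le> length p" by linarith
    have "{p ! i, p ! (Suc i mod length p)} \<in> E" if "i < length p" for i
    proof (cases "Suc i < length p")
      case True
      then show ?thesis using p(5)[OF True] by simp
    next
      case False
      then have i: "i = length p - 1" "Suc i = length p" using that by auto
      then show ?thesis using p0 pl uv by (simp add: insert_commute)
    qed
    then have "graph_cycle E p" using len p(4) by (simp add: graph_cycle_def)
    then show False using tree by (auto simp: tree_graph_def)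
  qed
  \<comment> \<open>Any other edge leaving \<open>C\<close> would survive the deletion and extend
    the component.\<close>
  have step: "{i, j} = {u, v}" if "i \<in> C" "j \<notin> C" "{i, j} \<in> E" for i j
  proof (rule ccontr)
    assume "{i, j} \<noteq> {u, v}"
    then have "(i, j) \<in> ?R" using that by simp
    then have "j \<in> C" using that(1) unfolding C_def by (auto intro: rtrancl_into_rtrancl)
    then show False using that by simp
  qed
  let ?y = "\<chi> j. of_bool (j \<in> C) :: int^'v"
  have "(laplacian E w *v ?y) $ i = (axis u 1 - axis v 1) $ i" for i
  proof -
    have "(laplacian E w *v ?y) $ i = (\<Sum>j\<in>nbrs i. of_bool (i \<in> C) - of_bool (j \<in> C))"
      unfolding laplacian_mult by (rule sum.cong) (auto simp: w1 nbrs_def)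
    also have "\<dots> = (\<Sum>j\<in>nbrs i. if i = u \<and> j = v then 1 else if i = v \<and> j = u then - 1 else 0)"
    proof (rule sum.cong)
      fix j assume j: "j \<in> nbrs i"
      then have "{i, j} \<in> E" "{j, i} \<in> E" by (simp_all add: nbrs_def insert_commute)
      then show "of_bool (i \<in> C) - of_bool (j \<in> C) =
          (if i = u \<and> j = v then 1 else if i = v \<and> j = u then - 1 else (0 :: int))"
        using step[of i j] step[of j i] uC vC ne by (auto simp: doubleton_eq_iff)
    qed simp
    also have "\<dots> = (axis u 1 - axis v 1) $ i"
    proof -
      have "v \<in> nbrs u" "u \<in> nbrs v" using uv by (simp_all add: nbrs_def insert_commute)
      then show ?thesis
        using ne by (cases "i = u"; cases "i = v") (simp_all add: axis_def sum.delta cong: if_cong)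
    qed
    finally show ?thesis .
  qed
  then have "laplacian E w *v ?y = axis u 1 - axis v 1" by (simp add: vec_eq_iff)
  then show ?thesis unfolding column_lattice_eq_range by (metis rangeI)
qed

text \<open>Differences of unit vectors span the sum-zero vectors, and along a path they telescope
  into differences over edges.\<close>

lemma sum_zero_subset_lattice_tree:
  fixes E :: "'v::finite set set"
  assumes "weighted_graph E w" and tree: "tree_graph E" and w1: "\<And>e. e \<in> E \<Longrightarrow> w e = 1"
  shows "sum_zero_vectors \<subseteq> column_lattice (laplacian E w)"
proof
  interpret weighted_graph E w by (rule assms(1))
  let ?H = "column_lattice (laplacian E w)"
  have H: "0 \<in> ?H" "\<And>x y. x \<in> ?H \<Longrightarrow> y \<in> ?H \<Longrightarrow> x + y \<in> ?H"
    using subgroup_generate[of "columns (laplacian E w)"] by (auto simp: subgroup_int_vec_iff column_lattice_def)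
  have mult: "c *s x \<in> ?H" if x: "x \<in> ?H" for c x
  proof -
    obtain y where "x = laplacian E w *v y" using x unfolding column_lattice_eq_range by blast
    then have "c *s x = laplacian E w *v (c *s y)"
      by (simp add: vec_eq_iff matrix_vector_mult_def sum_distrib_left mult.left_commute)
    then show ?thesis unfolding column_lattice_eq_range by blast
  qed
  have sum: "(\<And>i. i \<in> T \<Longrightarrow> g i \<in> ?H) \<Longrightarrow> sum g T \<in> ?H" for g :: "'v \<Rightarrow> int^'v" and T
    by (induction T rule: infinite_finite_induct) (auto simp: H)
  have path: "axis u 1 - axis z 1 \<in> ?H" for u z
  proof -
    have "(u, z) \<in> {(x, y). {x, y} \<in> E}\<^sup>*" using connected by (simp add: connected_graph_def)
    then show ?thesis
    proof (induction rule: rtrancl_induct)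
      case (step y z)
      then show ?case
        using H(2)[OF step.IH tree_edge_in_lattice[OF assms(1) tree w1, of y z]] by simp
    qed (simp add: H(1))
  qed
  fix x :: "int^'v" assume x: "x \<in> sum_zero_vectors"
  have "x = (\<Sum>i\<in>UNIV. x $ i *s (axis i 1 - axis undefined 1))"
  proof -
    have "(\<Sum>i\<in>UNIV. x $ i * (axis i 1 $ k - axis undefined 1 $ k)) = x $ k" for k
    proof -
      have "(\<Sum>i\<in>UNIV. x $ i * (axis i 1 $ k - axis undefined 1 $ k)) =
          (\<Sum>i\<in>UNIV. if i = k then x $ k else 0) - (\<Sum>i\<in>UNIV. x $ i) * axis undefined 1 $ k"
        unfolding sum_distrib_right sum_subtractf[symmetric]
        by (rule sum.cong) (auto simp: axis_def algebra_simps)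
      then show ?thesis using x by (simp add: sum_zero_vectors_def)
    qed
    then show ?thesis by (simp add: vec_eq_iff)
  qed
  also have "\<dots> \<in> ?H" by (intro sum mult path)
  finally show "x \<in> ?H" .
qed

theorem proposition7p1:
  fixes E :: "'v::finite set set"
    and w :: "'v set \<Rightarrow> nat"
    and I :: "('v, 'k::field) mpoly set"
    and L :: "(int^'v) set"
  assumes "simple_graph E"
    and "connected_graph E"
    and "\<forall>e\<in>E. w e > 0"
    and "I = laplacian_ideal E w"
    and "L = column_lattice (laplacian E w)"
  shows "(\<forall>i. zero_locus (genideal mpoly_ring (I \<union> {mpoly_var i})) = {0})
    \<and> (quotient_degree I = quotient_degree (lattice_ideal L :: ('v, 'k) mpoly set)
        \<and> quotient_degree (lattice_ideal L :: ('v, 'k) mpoly set)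
            = real (Coset.order (critical_group E w)))
    \<and> ideal_hull mpoly_ring I = lattice_ideal L
    \<and> ((\<forall>i. card (incident_edges E i) \<ge> 3) \<longrightarrow> \<not> is_lattice_ideal I)
    \<and> (E = complete_graph_edges \<and> (\<forall>e\<in>E. w e = 1) \<longrightarrow>
        quotient_degree I = real CARD('v) powi (int CARD('v) - 2))
    \<and> (tree_graph E \<and> (\<forall>e\<in>E. w e = 1) \<longrightarrow>
        quotient_degree I = 1
        \<and> quotient_degree (lattice_ideal L :: ('v, 'k) mpoly set) = 1)"
  proof -
  interpret weighted_graph E w
    using assms(1-3) by unfold_locales
  let ?M = "laplacian E w" and ?card = "card (int_coset L ` sum_zero_vectors)"
  have I: "I = lattice_ideal (columns ?M)" using assms(4) by (simp only: laplacian_ideal_eq)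
  have L: "L = lattice" using assms(5) by (simp only: column_lattice_def)
  have degI: "quotient_degree I = real ?card"
    unfolding I L by (rule quotient_degree_eq_card_cosets(1))
  have degL: "quotient_degree (lattice_ideal L :: ('v, 'k) mpoly set) = real ?card"
    unfolding L by (rule quotient_degree_eq_card_cosets(2))
  have order: "Coset.order (critical_group E w) = ?card"
    unfolding critical_group_def lattice_eq_range[symmetric] L by (rule order_torsion_subgroup)
  have graph: "weighted_graph E w" by (rule weighted_graph_axioms)
  have "\<forall>i. zero_locus (genideal mpoly_ring (I \<union> {mpoly_var i})) = {0}"
    unfolding I using zero_locus_with_var by blast
  moreover have "ideal_hull mpoly_ring I = lattice_ideal L"
    unfolding I L by (rule ideal_hull_eq)
  moreover have "(\<forall>i. card (incident_edges E i) \<ge> 3) \<longrightarrow> \<not> is_lattice_ideal I"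
    using not_lattice_ideal_of_degree_ge_3[where 'k = 'k] unfolding assms(4) by blast
  moreover have "quotient_degree I = real CARD('v) powi (int CARD('v) - 2)"
    if K: "E = complete_graph_edges \<and> (\<forall>e\<in>E. w e = 1)"
  proof (cases "CARD('v) \<ge> 2")
    case True
    have "?card = CARD('v) ^ (CARD('v) - 2)"
      using card_cosets_complete_graph[of w] graph K True unfolding assms(5) by auto
    moreover have "int CARD('v) - 2 = int (CARD('v) - 2)" using True by simp
    ultimately show ?thesis unfolding degI by (simp only: power_int_of_nat of_nat_power)
  next
    \<comment> \<open>With one vertex the exponent is -1, hence the power with integer exponent; its
      value 1 matches the single coset.\<close>
    case False
    then have one: "CARD('v) = 1" using zero_less_card_finite[where 'a = 'v] by linarith
    then obtain v :: 'v where v: "UNIV = {v}" by (auto simp: card_1_singleton_iff)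
    have "x \<in> lattice" if "x \<in> sum_zero_vectors" for x
    proof -
      have "x $ v = 0" using that unfolding sum_zero_vectors_def v by simp
      moreover have "i = v" for i using v by auto
      ultimately have "x = 0" unfolding vec_eq_iff by (metis zero_index)
      then show ?thesis using generate.one[of int_vec_group] by simp
    qed
    then have "?card = 1" unfolding L by (intro one_coset) blast
    then show ?thesis unfolding degI one by simp
  qed
  moreover have "?card = 1" if "tree_graph E \<and> (\<forall>e\<in>E. w e = 1)"
    using sum_zero_subset_lattice_tree[OF graph] that unfolding L
    by (intro one_coset) (auto simp: column_lattice_def)
  ultimately show ?thesis
    unfolding order degI[symmetric] using degI degL by auto
qed

end
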